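(* Let $X$, $\psi$, $\{a_j\}$, $\{m_j\}$, $\{b_{jk}\}$ and $\delta_{jk}$ be as in the context. For positive integers $M$ set $\overline\delta_j^{(2,M)}:=\frac1M\sum_{k=1}^{M}\delta_{jk}^2$, let $M_j:=\Big[\dfrac{m_j}{(a_{j+1}^{-2}-a_{j+2}^{-2})^2}\Big]$ (integer part), and \[ \Delta\overline\delta_{j+1}^{(2,M_j)}:=\frac{\overline\delta_{j+1}^{(2,M_j)}-\overline\delta_{j+2}^{(2,M_j)}}{a_{j+1}^{-2}-a_{j+2}^{-2}} . \] Assume: (i) there is $B\in(0,A)$ with $\mathrm{supp}\,\widehat\psi\subseteq\{\xi\in\mathbb R: B\le|\xi|\le A\}$; (ii) for all $j\in\mathbb N$ and $(k,l)\in\mathbb Z^2$, $b_{jk}-b_{jl}=\gamma_j(k-l)$ where $\{\gamma_j\}$ is a sequence of positive reals with $\lim_{j\to+\infty}a_j/\gamma_j=c\in(0,+\infty)$ and $\lim_{j\to+\infty}m_j^2a_j^8\big(\gamma_j/a_j-1/c\big)=0$; and for some $j_0\in\mathbb N$, $a_{j+1}/a_j\ge A/B>1$ for all $j\ge j_0$; (iii) $\lim_{j\to+\infty}m_ja_j^{-4}=0$. Then, as $j\to+\infty$, the random variables \[ \overline Z_j:=\sqrt{m_j}\Big(\Delta\overline\delta_{j+1}^{(2,M_j)}-2\alpha s_0^{-4\alpha-2}\int_{\mathbb R}\eta^2|\widehat\psi(\eta)|^2d\eta\Big) \] converge in distribution to a centred Gaussian random variable with variance $2\mathcal V_1$, where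 \[ \mathcal V_1:=4c\pi s_0^{-8\alpha}\int_{-c\pi}^{c\pi}\Big|\sum_{n\in\mathbb Z}|\widehat\psi(\eta+2nc\pi)|^2\Big|^2d\eta . \]
   Context: Standing setting. $X(t)$, $t\in\mathbb R$, is a measurable mean-square continuous real-valued stationary zero-mean Gaussian process whose spectral density is $f(\lambda)=h(\lambda)/|\lambda^2-s_0^2|^{2\alpha}$, where $s_0>1$, $\alpha\in(0,1/2)$, and $h$ is an even, non-negative, bounded, four times continuously differentiable function with $h^{(i)}(0)=0$ for $i=1,2,3,4$, $h(0)=1$, $h>0$ in some neighbourhood of $\pm s_0$, and $\int_{\mathbb R}h(\lambda)(1+|\lambda|)^{-\varepsilon}d\lambda<\infty$ for every $\varepsilon>0$. $\psi\in L_1(\mathbb R)$ is real-valued with Fourier transform $\widehat\psi(\lambda)=\int_{\mathbb R}e^{-i\lambda t}\psi(t)\,dt$ supported in $[-A,A]$ for some $A>0$ and of bounded variation on $[-A,A]$. $\{a_j\}$ is an unbounded strictly increasing sequence of positive reals, $\{m_j\}$ an unboundedly increasing sequence of positive integers, $\{b_{jk}\}_{(j,k)\in\mathbb N\times\mathbb Z}$ an array of reals. $\delta_{jk}:=a_j^{-1/2}\int_{\mathbb R}\psi\big((t-b_{jk})/a_j\big)X(t)\,dt$. *)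

theory Defs
  imports "HOL-Probability.Probability"
begin

definition fourier_tr :: "(real \<Rightarrow> real) \<Rightarrow> real \<Rightarrow> complex" where
  "fourier_tr \<psi> u = (LINT t|lborel. cis (- u * t) * complex_of_real (\<psi> t))"

definition bounded_variation_on :: "(real \<Rightarrow> 'b::real_normed_vector) \<Rightarrow> real \<Rightarrow> real \<Rightarrow> bool" where
  "bounded_variation_on f a b \<longleftrightarrow>
     (\<exists>V. \<forall>(n::nat) (x::nat \<Rightarrow> real).
        x 0 = a \<and> x n = b \<and> (\<forall>i<n. x i \<le> x (Suc i)) \<longrightarrow>
        (\<Sum>i<n. norm (f (x (Suc i)) - f (x i))) \<le> V)"

definition real_gaussian_rv :: "'a measure \<Rightarrow> ('a \<Rightarrow> real) \<Rightarrow> bool" where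
  "real_gaussian_rv M Y \<longleftrightarrow> Y \<in> borel_measurable M \<and>
     (\<exists>\<mu> \<sigma>. (\<sigma> = 0 \<and> (AE \<omega> in M. Y \<omega> = \<mu>)) \<or>
             (\<sigma> > 0 \<and> distributed M lborel Y (normal_density \<mu> \<sigma>)))"

definition gaussian_process :: "'a measure \<Rightarrow> (real \<Rightarrow> 'a \<Rightarrow> real) \<Rightarrow> bool" where
  "gaussian_process M X \<longleftrightarrow>
     (\<forall>(ts::real list) (cs::real list). length cs = length ts \<longrightarrow>
        real_gaussian_rv M (\<lambda>\<omega>. \<Sum>i<length ts. cs ! i * X (ts ! i) \<omega>))"

definition gaussian_law :: "real \<Rightarrow> real \<Rightarrow> real measure" where
  "gaussian_law \<mu> v = (if v = 0 then return borel \<mu> else density lborel (normal_density \<mu> (sqrt v)))"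

definition spec_dens :: "(real \<Rightarrow> real) \<Rightarrow> real \<Rightarrow> real \<Rightarrow> real \<Rightarrow> real" where
  "spec_dens h s0 \<alpha> u = h u / (\<bar>u\<^sup>2 - s0\<^sup>2\<bar> powr (2 * \<alpha>))"

definition wcoef :: "(real \<Rightarrow> real) \<Rightarrow> (real \<Rightarrow> 'a \<Rightarrow> real) \<Rightarrow> (nat \<Rightarrow> real) \<Rightarrow> (nat \<Rightarrow> int \<Rightarrow> real)
    \<Rightarrow> nat \<Rightarrow> int \<Rightarrow> 'a \<Rightarrow> real" where
  "wcoef \<psi> X a b j k \<omega> = a j powr (-1/2) * (LINT t|lborel. \<psi> ((t - b j k) / a j) * X t \<omega>)"

definition wmean2 :: "(real \<Rightarrow> real) \<Rightarrow> (real \<Rightarrow> 'a \<Rightarrow> real) \<Rightarrow> (nat \<Rightarrow> real) \<Rightarrow> (nat \<Rightarrow> int \<Rightarrow> real)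
    \<Rightarrow> nat \<Rightarrow> nat \<Rightarrow> 'a \<Rightarrow> real" where
  "wmean2 \<psi> X a b j M \<omega> = (1 / real M) * (\<Sum>k\<in>{1..M}. (wcoef \<psi> X a b j (int k) \<omega>)\<^sup>2)"

end

theory Submission
  imports Defs "HOL-Real_Asymp.Real_Asymp"
begin

text \<open>
  The wavelet coefficients of all levels form a Gaussian family, because each is an \<open>L\<^sup>1\<close>-limit of
  finite combinations of the process. By the support condition (i) and the growth of \<open>a\<^sub>j\<close>, the
  levels \<open>j+1\<close> and \<open>j+2\<close> use disjoint frequency bands and are uncorrelated, and within a level the
  covariance matrix is Toeplitz with a bounded symbol, a periodization of \<open>f (\<eta> / a\<^sub>j) |\<psi>^ (\<eta>)|\<^sup>2\<close>.

  For a quadratic form \<open>T = \<rho> \<Sum> \<epsilon>\<^sub>k (Y\<^sub>k\<^sup>2 - E Y\<^sub>k\<^sup>2)\<close> in a Gaussian family with covariance \<open>S\<close>, two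
  Gaussian integrations by parts show that \<open>\<phi> (t) = E exp (i t T)\<close> solves \<open>\<phi>' = - v t \<phi>\<close> up to an
  error of order \<open>t\<^sup>2 \<rho>\<^sup>3 \<parallel>S\<parallel>\<^sup>2 tr S\<close>, where \<open>v = 2 \<rho>\<^sup>2 \<Sum> \<epsilon>\<^sub>k \<epsilon>\<^sub>l S\<^sub>k\<^sub>l\<^sup>2\<close>. The error vanishes in the limit, and
  the Fejer kernel identifies the limit of \<open>v\<close>. The expansion of the spectral density at \<open>0\<close> to
  fourth order makes the bias negligible under (iii).
\<close>

subsection \<open>Laws with equal joint characteristic functions\<close>

text \<open>The covariance matrix of the coefficients may be singular, so no joint density is at
  hand. Gaussian families are therefore encoded by their joint characteristic function, and
  integration by parts comes from replacing one coordinate by an independent normal copy plus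
  regression terms. The two levels enter a single quadratic form, with signs
  \<open>\<epsilon>\<close> = 1 and -1. The sample size N is the integer part of m divided by the
  squared denominator; this makes \<open>\<rho>\<^sup>2 N\<close> tend to 1. As the trace of S is of
  order N and its norm stays bounded, the error is of order \<open>\<rho>\<close>. Differencing two
  levels cancels the constant term of the covariance expansion, and dividing by the difference of
  the a^(-2) isolates the quadratic coefficient 2 \<alpha> s0^(-4 \<alpha> - 2). Growth of a by at
  least A/B keeps the denominator comparable to a^(-2), so a remainder of order a^(-4) costs a^(-2)
  after division, and sqrt m times this tends to 0. Each level contributes the same limit to the
  variance.\<close>

lemma measurable_cis [measurable]: "cis \<in> borel_measurable borel"
  by (intro borel_measurable_continuous_onI continuous_intros)

text \<open>Reduction to Levy's uniqueness theorem for probability laws: \<open>u = 0\<close> shows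
  that the total masses agree, a null mass is trivial, and otherwise both measures are normalised.
  General finite measures are needed because weights and restrictions to events occur below.\<close>

lemma finite_measure_char_unique:
  fixes M1 M2 :: "real measure"
  assumes "finite_measure M1" "finite_measure M2"
    and sets [measurable_cong]: "sets M1 = sets borel" "sets M2 = sets borel"
    and char_eq: "\<And>u. (LINT x|M1. cis (u * x)) = (LINT x|M2. cis (u * x))"
  shows "M1 = M2"
proof -
  interpret M1: finite_measure M1 by fact
  interpret M2: finite_measure M2 by fact
  have sp [simp]: "space M1 = UNIV" "space M2 = UNIV"
    using sets_eq_imp_space_eq[OF sets(1)] sets_eq_imp_space_eq[OF sets(2)] by auto
  have tot: "measure M1 UNIV = measure M2 UNIV"
    using char_eq[of 0] by (simp add: scaleR_conv_of_real)
  define c where "c = measure M1 UNIV"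
  have c: "c \<ge> 0" "emeasure M1 UNIV = ennreal c" "emeasure M2 UNIV = ennreal c"
    using tot by (auto simp: c_def M1.emeasure_eq_measure M2.emeasure_eq_measure)
  show ?thesis
  proof (cases "c = 0")
    case True
    show ?thesis
    proof (rule measure_eqI)
      fix A assume "A \<in> sets M1"
      show "emeasure M1 A = emeasure M2 A"
        using emeasure_mono[of A UNIV M1] emeasure_mono[of A UNIV M2] c True sets
        by (metis ennreal_0 le_zero_eq sets.top sp subset_UNIV)
    qed (simp add: sets)
  next
    case False
    with c have cpos: "c > 0" by simp
    define N1 where "N1 = density M1 (\<lambda>_. ennreal (1/c))"
    define N2 where "N2 = density M2 (\<lambda>_. ennreal (1/c))"
    have e1: "emeasure N1 A = ennreal (1/c) * emeasure M1 A" if "A \<in> sets borel" for A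
      unfolding N1_def using that sets by (subst emeasure_density) (auto simp: nn_integral_cmult_indicator)
    have e2: "emeasure N2 A = ennreal (1/c) * emeasure M2 A" if "A \<in> sets borel" for A
      unfolding N2_def using that sets by (subst emeasure_density) (auto simp: nn_integral_cmult_indicator)
    have "real_distribution N1"
      unfolding real_distribution_def real_distribution_axioms_def
      using e1[of UNIV] c cpos
      by (auto intro!: prob_spaceI simp: N1_def sets ennreal_mult[symmetric])
    moreover have "real_distribution N2"
      unfolding real_distribution_def real_distribution_axioms_def
      using e2[of UNIV] c cpos
      by (auto intro!: prob_spaceI simp: N2_def sets ennreal_mult[symmetric])
    moreover have "char N1 = char N2"
    proof
      fix t
      have "char N1 t = (LINT x|M1. (1/c) *\<^sub>R cis (t * x))"
        unfolding char_def N1_def using c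
        by (subst integral_density) (auto simp: cis_conv_exp mult.commute)
      also have "\<dots> = (LINT x|M2. (1/c) *\<^sub>R cis (t * x))"
        by (simp add: char_eq)
      also have "\<dots> = char N2 t"
        unfolding char_def N2_def using c
        by (subst integral_density) (auto simp: cis_conv_exp mult.commute)
      finally show "char N1 t = char N2 t" .
    qed
    ultimately have eq: "N1 = N2" by (rule Levy_uniqueness)
    show ?thesis
    proof (rule measure_eqI)
      fix A assume "A \<in> sets M1"
      then have "ennreal (1/c) * emeasure M1 A = ennreal (1/c) * emeasure M2 A"
        using e1 e2 eq sets by metis
      then show "emeasure M1 A = emeasure M2 A"
        using cpos by (simp add: ennreal_mult_cancel_left)
    qed (simp add: sets)
  qed
qed

text \<open>The weight becomes a density, and the image of the weighted measure under
  \<open>Y\<close> has the weighted transform as its characteristic function. The bound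
  \<open>c\<close> keeps the weighted measure finite.\<close>

lemma weighted_char_unique:
  fixes w Y :: "'a \<Rightarrow> real" and w' Y' :: "'b \<Rightarrow> real"
  assumes "finite_measure M" "finite_measure M'"
    and [measurable]: "w \<in> borel_measurable M" "Y \<in> borel_measurable M"
      "w' \<in> borel_measurable M'" "Y' \<in> borel_measurable M'" "A \<in> sets borel"
    and w: "\<And>x. 0 \<le> w x" "\<And>x. w x \<le> c" and w': "\<And>x. 0 \<le> w' x" "\<And>x. w' x \<le> c"
    and eq: "\<And>u. (LINT x|M. w x *\<^sub>R cis (u * Y x)) = (LINT x|M'. w' x *\<^sub>R cis (u * Y' x))"
  shows "(LINT x|M. w x * indicator A (Y x)) = (LINT x|M'. w' x * indicator A (Y' x))"
proof -
  interpret M: finite_measure M by fact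
  interpret M': finite_measure M' by fact
  define D where "D = distr (density M w) borel Y"
  define D' where "D' = distr (density M' w') borel Y'"
  have iw: "integrable M w" using w by (intro M.integrable_const_bound[of _ c]) auto
  have iw': "integrable M' w'" using w' by (intro M'.integrable_const_bound[of _ c]) auto
  have fd: "finite_measure (density M w)"
  proof (rule finite_measureI)
    have "emeasure (density M w) (space M) = (\<integral>\<^sup>+x. w x \<partial>M)"
      by (subst emeasure_density) (auto intro!: nn_integral_cong simp: indicator_def)
    also have "\<dots> < \<infinity>" using iw w by (simp add: nn_integral_eq_integral)
    finally show "emeasure (density M w) (space (density M w)) \<noteq> \<infinity>" by simp
  qed
  have fd': "finite_measure (density M' w')"
  proof (rule finite_measureI)
    have "emeasure (density M' w') (space M') = (\<integral>\<^sup>+x. w' x \<partial>M')"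
      by (subst emeasure_density) (auto intro!: nn_integral_cong simp: indicator_def)
    also have "\<dots> < \<infinity>" using iw' w' by (simp add: nn_integral_eq_integral)
    finally show "emeasure (density M' w') (space (density M' w')) \<noteq> \<infinity>" by simp
  qed
  have "D = D'"
  proof (rule finite_measure_char_unique)
    show "finite_measure D" unfolding D_def by (rule finite_measure.finite_measure_distr[OF fd]) simp
    show "finite_measure D'" unfolding D'_def by (rule finite_measure.finite_measure_distr[OF fd']) simp
    fix u
    have "(LINT x|D. cis (u * x)) = (LINT x|M. w x *\<^sub>R cis (u * Y x))"
      unfolding D_def using w by (simp add: integral_distr integral_density)
    moreover have "(LINT x|D'. cis (u * x)) = (LINT x|M'. w' x *\<^sub>R cis (u * Y' x))"
      unfolding D'_def using w' by (simp add: integral_distr integral_density)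
    ultimately show "(LINT x|D. cis (u * x)) = (LINT x|D'. cis (u * x))" using eq by simp
  qed (auto simp: D_def D'_def)
  moreover have "(LINT x|D. indicator A x) = (LINT x|M. w x * indicator A (Y x) :: real)"
    unfolding D_def using w by (subst integral_distr, simp, simp, subst integral_density) auto
  moreover have "(LINT x|D'. indicator A x) = (LINT x|M'. w' x * indicator A (Y' x) :: real)"
    unfolding D'_def using w' by (subst integral_distr, simp, simp, subst integral_density) auto
  ultimately show ?thesis by simp
qed

lemma integrable_cis [simp, intro]:
  assumes "finite_measure M" and [measurable]: "f \<in> borel_measurable M"
  shows "integrable M (\<lambda>x. cis (f x))"
  using assms(1) by (intro finite_measure.integrable_const_bound[of _ _ 1]) auto

text \<open>Coordinates are removed one at a time. Restricting both measures to the event that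
  coordinate \<open>i\<close> lies in \<open>A i\<close> keeps the joint characteristic functions of
  the other coordinates equal, so the induction hypothesis applies to the restricted measures. These
  are not probability measures, hence the generality in \<open>M\<close> and
  \<open>M'\<close>.\<close>

lemma joint_char_unique_box:
  fixes Y :: "'i \<Rightarrow> 'a \<Rightarrow> real" and Y' :: "'i \<Rightarrow> 'b \<Rightarrow> real"
  assumes "finite I" "finite_measure M" "finite_measure M'"
    and "\<And>k. k \<in> I \<Longrightarrow> Y k \<in> borel_measurable M" "\<And>k. k \<in> I \<Longrightarrow> Y' k \<in> borel_measurable M'"
    and "\<And>k. k \<in> I \<Longrightarrow> A k \<in> sets borel"
    and "\<And>v. (LINT x|M. cis (\<Sum>k\<in>I. v k * Y k x)) = (LINT x|M'. cis (\<Sum>k\<in>I. v k * Y' k x))"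
  shows "measure M {x \<in> space M. \<forall>k\<in>I. Y k x \<in> A k} = measure M' {x \<in> space M'. \<forall>k\<in>I. Y' k x \<in> A k}"
  using assms
proof (induction I arbitrary: M M' rule: finite_induct)
  case empty
  then show ?case using empty.prems(6)[of undefined] by (simp add: scaleR_conv_of_real)
next
  case (insert i I)
  interpret M: finite_measure M by fact
  interpret M': finite_measure M' by fact
  have [measurable]: "Y i \<in> borel_measurable M" "Y' i \<in> borel_measurable M'" "A i \<in> sets borel"
    "k \<in> I \<Longrightarrow> Y k \<in> borel_measurable M" "k \<in> I \<Longrightarrow> Y' k \<in> borel_measurable M'"
    "k \<in> I \<Longrightarrow> A k \<in> sets borel" for k
    using insert.prems by auto
  have cf: "(LINT x|M. cis (u * Y i x + (\<Sum>k\<in>I. v k * Y k x))) = (LINT x|M'. cis (u * Y' i x + (\<Sum>k\<in>I. v k * Y' k x)))" for u v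
  proof -
    have "(\<Sum>k\<in>I. (if k = i then u else v k) * Z k) = (\<Sum>k\<in>I. v k * Z k)" for Z :: "'i \<Rightarrow> real"
      using insert.hyps by (intro sum.cong) auto
    then show ?thesis using insert.prems(6)[of "\<lambda>k. if k = i then u else v k"] insert.hyps by simp
  qed
  \<comment> \<open>A unimodular complex weight is not admissible in
    \<open>weighted_char_unique\<close>. The nonnegative weights 1, 1 + cos and 1 + sin are, and by
    \<open>cosi\<close> and \<open>sini\<close> their transforms are combinations of joint
    characteristic functions at \<open>v\<close>, \<open>- v\<close> and 0; \<open>dec\<close>
    recovers the complex weight from them.\<close>
  have ind: "(LINT x|M. indicator (A i) (Y i x) *\<^sub>R cis (\<Sum>k\<in>I. v k * Y k x))
      = (LINT x|M'. indicator (A i) (Y' i x) *\<^sub>R cis (\<Sum>k\<in>I. v k * Y' k x))" for v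
  proof -
    let ?s = "\<lambda>x. \<Sum>k\<in>I. v k * Y k x" and ?s' = "\<lambda>x. \<Sum>k\<in>I. v k * Y' k x"
    have neg: "(\<Sum>k\<in>I. - v k * Z k) = - (\<Sum>k\<in>I. v k * Z k)" for Z :: "'i \<Rightarrow> real"
      by (simp add: sum_negf)
    have cp: "(LINT x|M. cis (u * Y i x + ?s x)) = (LINT x|M'. cis (u * Y' i x + ?s' x))" for u
      by (rule cf)
    have cm: "(LINT x|M. cis (u * Y i x - ?s x)) = (LINT x|M'. cis (u * Y' i x - ?s' x))" for u
      using cf[of u "\<lambda>k. - v k"] unfolding neg by simp
    have c0: "(LINT x|M. cis (u * Y i x)) = (LINT x|M'. cis (u * Y' i x))" for u
      using cf[of u "\<lambda>k. 0"] by simp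
    have cosi: "(1 + cos b) *\<^sub>R cis a = cis a + (1/2) *\<^sub>R cis (a + b) + (1/2) *\<^sub>R cis (a - b)" for a b
      by (auto simp: complex_eq_iff cos_add cos_diff sin_add sin_diff algebra_simps)
    have sini: "(1 + sin b) *\<^sub>R cis a = cis a + (-\<i>/2) * cis (a + b) - (-\<i>/2) * cis (a - b)" for a b
      by (auto simp: complex_eq_iff cos_add cos_diff sin_add sin_diff field_simps)
    have "(LINT x|M. 1 * indicator (A i) (Y i x)) = (LINT x|M'. 1 * indicator (A i) (Y' i x) :: real)"
      by (rule weighted_char_unique[where c=1]) (use c0 M.finite_measure_axioms M'.finite_measure_axioms in auto)
    then have e0: "(LINT x|M. indicator (A i) (Y i x)) = (LINT x|M'. indicator (A i) (Y' i x) :: real)" by simp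
    have ec: "(LINT x|M. (1 + cos (?s x)) * indicator (A i) (Y i x)) = (LINT x|M'. (1 + cos (?s' x)) * indicator (A i) (Y' i x) :: real)"
    proof (rule weighted_char_unique[where c=2])
      show "(LINT x|M. (1 + cos (?s x)) *\<^sub>R cis (u * Y i x)) = (LINT x|M'. (1 + cos (?s' x)) *\<^sub>R cis (u * Y' i x))" for u
        unfolding cosi using M.finite_measure_axioms M'.finite_measure_axioms
        by (simp add: cp cm c0)
      show "0 \<le> 1 + cos (?s x)" "1 + cos (?s x) \<le> 2" for x
        using cos_ge_minus_one[of "?s x"] cos_le_one[of "?s x"] by linarith+
      show "0 \<le> 1 + cos (?s' x)" "1 + cos (?s' x) \<le> 2" for x
        using cos_ge_minus_one[of "?s' x"] cos_le_one[of "?s' x"] by linarith+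
    qed (use M.finite_measure_axioms M'.finite_measure_axioms in auto)
    have es: "(LINT x|M. (1 + sin (?s x)) * indicator (A i) (Y i x)) = (LINT x|M'. (1 + sin (?s' x)) * indicator (A i) (Y' i x) :: real)"
    proof (rule weighted_char_unique[where c=2])
      show "(LINT x|M. (1 + sin (?s x)) *\<^sub>R cis (u * Y i x)) = (LINT x|M'. (1 + sin (?s' x)) *\<^sub>R cis (u * Y' i x))" for u
        unfolding sini using M.finite_measure_axioms M'.finite_measure_axioms
        by (simp add: cp cm c0)
      show "0 \<le> 1 + sin (?s x)" "1 + sin (?s x) \<le> 2" for x
        using sin_ge_minus_one[of "?s x"] sin_le_one[of "?s x"] by linarith+
      show "0 \<le> 1 + sin (?s' x)" "1 + sin (?s' x) \<le> 2" for x
        using sin_ge_minus_one[of "?s' x"] sin_le_one[of "?s' x"] by linarith+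
    qed (use M.finite_measure_axioms M'.finite_measure_axioms in auto)
    have dec: "indicator B y *\<^sub>R cis b = of_real ((1 + cos b) * indicator B y) + \<i> * of_real ((1 + sin b) * indicator B y)
        - (1 + \<i>) * of_real (indicator B y)" for B :: "real set" and y b
      by (auto simp: indicator_def complex_eq_iff)
    have iM: "integrable M (\<lambda>x. f (?s x) * indicator (A i) (Y i x))" "integrable M (\<lambda>x. indicator (A i) (Y i x) :: real)"
      if "f = (\<lambda>x. 1 + cos x) \<or> f = (\<lambda>x. 1 + sin x)" for f :: "real \<Rightarrow> real"
    proof -
      have [measurable]: "f \<in> borel_measurable borel" using that by auto
      have "\<bar>f x\<bar> \<le> 2" for x
      proof -
        have "f x = 1 + cos x \<or> f x = 1 + sin x" using that by auto
        then show ?thesis using sin_ge_minus_one[of x] sin_le_one[of x] cos_ge_minus_one[of x] cos_le_one[of x] by linarith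
      qed
      then show "integrable M (\<lambda>x. f (?s x) * indicator (A i) (Y i x))"
        by (intro M.integrable_const_bound[of _ 2]) (auto simp: indicator_def)
      show "integrable M (\<lambda>x. indicator (A i) (Y i x) :: real)"
        by (intro M.integrable_const_bound[of _ 1]) (auto simp: indicator_def)
    qed
    have iM': "integrable M' (\<lambda>x. f (?s' x) * indicator (A i) (Y' i x))" "integrable M' (\<lambda>x. indicator (A i) (Y' i x) :: real)"
      if "f = (\<lambda>x. 1 + cos x) \<or> f = (\<lambda>x. 1 + sin x)" for f :: "real \<Rightarrow> real"
    proof -
      have [measurable]: "f \<in> borel_measurable borel" using that by auto
      have "\<bar>f x\<bar> \<le> 2" for x
      proof -
        have "f x = 1 + cos x \<or> f x = 1 + sin x" using that by auto
        then show ?thesis using sin_ge_minus_one[of x] sin_le_one[of x] cos_ge_minus_one[of x] cos_le_one[of x] by linarith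
      qed
      then show "integrable M' (\<lambda>x. f (?s' x) * indicator (A i) (Y' i x))"
        by (intro M'.integrable_const_bound[of _ 2]) (auto simp: indicator_def)
      show "integrable M' (\<lambda>x. indicator (A i) (Y' i x) :: real)"
        by (intro M'.integrable_const_bound[of _ 1]) (auto simp: indicator_def)
    qed
    show ?thesis
      unfolding dec using iM[of "\<lambda>x. 1 + cos x"] iM[of "\<lambda>x. 1 + sin x"] iM'[of "\<lambda>x. 1 + cos x"] iM'[of "\<lambda>x. 1 + sin x"]
      by (simp add: e0 ec es del: of_real_mult of_real_add)
  qed
  define N where "N = density M (indicator {x. Y i x \<in> A i})"
  define N' where "N' = density M' (indicator {x. Y' i x \<in> A i})"
  have N_alt: "N = density M (\<lambda>x. ennreal (indicator (A i) (Y i x)))" "N' = density M' (\<lambda>x. ennreal (indicator (A i) (Y' i x)))"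
    unfolding N_def N'_def by (auto intro!: arg_cong[where f="density _"] simp: indicator_def)
  have Nm: "emeasure N B = emeasure M ({x\<in>space M. Y i x \<in> A i} \<inter> B)" if "B \<in> sets M" for B
  proof -
    have "emeasure N B = (\<integral>\<^sup>+x. ennreal (indicator (A i) (Y i x)) * indicator B x \<partial>M)"
      unfolding N_alt using that by (subst emeasure_density) auto
    also have "\<dots> = (\<integral>\<^sup>+x. indicator ({x\<in>space M. Y i x \<in> A i} \<inter> B) x \<partial>M)"
      by (auto intro!: nn_integral_cong simp: indicator_def)
    also have "\<dots> = emeasure M ({x\<in>space M. Y i x \<in> A i} \<inter> B)"
      using that by (intro nn_integral_indicator) auto
    finally show ?thesis .
  qed
  have Nm': "emeasure N' B = emeasure M' ({x\<in>space M'. Y' i x \<in> A i} \<inter> B)" if "B \<in> sets M'" for B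
  proof -
    have "emeasure N' B = (\<integral>\<^sup>+x. ennreal (indicator (A i) (Y' i x)) * indicator B x \<partial>M')"
      unfolding N_alt using that by (subst emeasure_density) auto
    also have "\<dots> = (\<integral>\<^sup>+x. indicator ({x\<in>space M'. Y' i x \<in> A i} \<inter> B) x \<partial>M')"
      by (auto intro!: nn_integral_cong simp: indicator_def)
    also have "\<dots> = emeasure M' ({x\<in>space M'. Y' i x \<in> A i} \<inter> B)"
      using that by (intro nn_integral_indicator) auto
    finally show ?thesis .
  qed
  have sN [simp]: "space N = space M" "space N' = space M'" by (auto simp: N_def N'_def)
  have "measure N {x \<in> space N. \<forall>k\<in>I. Y k x \<in> A k} = measure N' {x \<in> space N'. \<forall>k\<in>I. Y' k x \<in> A k}"
  proof (rule insert.IH)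
    show "finite_measure N" by (rule finite_measureI) (simp add: Nm M.emeasure_eq_measure)
    show "finite_measure N'" by (rule finite_measureI) (simp add: Nm' M'.emeasure_eq_measure)
    fix v
    show "(LINT x|N. cis (\<Sum>k\<in>I. v k * Y k x)) = (LINT x|N'. cis (\<Sum>k\<in>I. v k * Y' k x))"
      unfolding N_alt by (subst (1 2) integral_density) (auto simp: ind)
  qed (use insert.prems in \<open>auto simp: N_def N'_def\<close>)
  moreover have "measure N {x \<in> space N. \<forall>k\<in>I. Y k x \<in> A k} = measure M {x \<in> space M. \<forall>k\<in>insert i I. Y k x \<in> A k}"
  proof -
    have "{x \<in> space M. \<forall>k\<in>I. Y k x \<in> A k} \<in> sets M" using \<open>finite I\<close> by measurable
    from Nm[OF this] show ?thesis unfolding measure_def by (auto intro!: arg_cong[where f="\<lambda>A. enn2real (emeasure M A)"])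
  qed
  moreover have "measure N' {x \<in> space N'. \<forall>k\<in>I. Y' k x \<in> A k} = measure M' {x \<in> space M'. \<forall>k\<in>insert i I. Y' k x \<in> A k}"
  proof -
    have "{x \<in> space M'. \<forall>k\<in>I. Y' k x \<in> A k} \<in> sets M'" using \<open>finite I\<close> by measurable
    from Nm'[OF this] show ?thesis unfolding measure_def by (auto intro!: arg_cong[where f="\<lambda>A. enn2real (emeasure M' A)"])
  qed
  ultimately show ?case by simp
qed

text \<open>Boxes generate the product \<sigma>-algebra and are stable under intersection, so
  agreement of the finite laws on boxes suffices.\<close>

lemma joint_char_unique:
  fixes Y :: "'i \<Rightarrow> 'a \<Rightarrow> real" and Y' :: "'i \<Rightarrow> 'b \<Rightarrow> real"
  assumes I: "finite I" and fin: "finite_measure M" "finite_measure M'"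
    and [measurable]: "\<And>k. k \<in> I \<Longrightarrow> Y k \<in> borel_measurable M" "\<And>k. k \<in> I \<Longrightarrow> Y' k \<in> borel_measurable M'"
    and eq: "\<And>v. (LINT x|M. cis (\<Sum>k\<in>I. v k * Y k x)) = (LINT x|M'. cis (\<Sum>k\<in>I. v k * Y' k x))"
  shows "distr M (PiM I (\<lambda>_. borel)) (\<lambda>x. \<lambda>k\<in>I. Y k x) = distr M' (PiM I (\<lambda>_. borel)) (\<lambda>x. \<lambda>k\<in>I. Y' k x)"
proof -
  interpret M: finite_measure M by fact
  interpret M': finite_measure M' by fact
  have [measurable]: "(\<lambda>x. \<lambda>k\<in>I. Y k x) \<in> measurable M (PiM I (\<lambda>_. borel))"
    "(\<lambda>x. \<lambda>k\<in>I. Y' k x) \<in> measurable M' (PiM I (\<lambda>_. borel))"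
    by (auto intro!: measurable_restrict)
  show ?thesis
  proof (rule measure_eqI_PiM_finite[where A="\<lambda>_. Pi\<^sub>E I (\<lambda>_. UNIV)"])
    fix A :: "'i \<Rightarrow> real set" assume A: "\<And>i. i \<in> I \<Longrightarrow> A i \<in> sets borel"
    then have "Pi\<^sub>E I A \<in> sets (PiM I (\<lambda>_. borel))" using I by (auto intro!: sets_PiM_I_finite)
    then show "emeasure (distr M (PiM I (\<lambda>_. borel)) (\<lambda>x. \<lambda>k\<in>I. Y k x)) (Pi\<^sub>E I A)
      = emeasure (distr M' (PiM I (\<lambda>_. borel)) (\<lambda>x. \<lambda>k\<in>I. Y' k x)) (Pi\<^sub>E I A)"
      using joint_char_unique_box[of I M M' Y Y' A] I A eq fin
      by (auto simp: emeasure_distr M.emeasure_eq_measure M'.emeasure_eq_measure PiE_iff vimage_def Int_def conj_commute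
           cong: conj_cong)
  next
    show "range (\<lambda>_. Pi\<^sub>E I (\<lambda>_. UNIV)) \<subseteq> prod_algebra I (\<lambda>_. borel)"
      using I by (auto intro!: prod_algebraI_finite)
    show "emeasure (distr M (PiM I (\<lambda>_. borel)) (\<lambda>x. \<lambda>k\<in>I. Y k x)) (Pi\<^sub>E I (\<lambda>_. UNIV)) \<noteq> \<infinity>"
      using sets_PiM_I_finite[OF I, of "\<lambda>_. UNIV" "\<lambda>_. borel"] by (subst emeasure_distr) (auto simp: M.emeasure_eq_measure)
  qed (auto simp: I space_PiM)
qed

subsection \<open>Gaussian families and integration by parts\<close>

lemma abs_mult_le_sum_squares: "\<bar>x * y\<bar> \<le> x\<^sup>2 + (y :: real)\<^sup>2"
proof -
  have "0 \<le> (\<bar>x\<bar> - \<bar>y\<bar>)\<^sup>2" by simp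
  then have "2 * (\<bar>x\<bar> * \<bar>y\<bar>) \<le> x\<^sup>2 + y\<^sup>2" by (simp add: power2_diff)
  moreover have "0 \<le> \<bar>x\<bar> * \<bar>y\<bar>" by simp
  ultimately show ?thesis unfolding abs_mult by linarith
qed

lemma std_normal_integral_eq:
  fixes f :: "real \<Rightarrow> 'b::{banach, second_countable_topology}"
  assumes "f \<in> borel_measurable borel"
  shows "(LINT y|std_normal_distribution. f y) = (LINT y|lborel. std_normal_density y *\<^sub>R f y)"
  using assms by (subst integral_density) auto

text \<open>Stein's identity: the normal density times \<open>g\<close> has derivative density times
  g' - y g, and the boundary terms vanish because Gaussian decay beats quadratic growth. Quadratic
  growth is what the application produces: there, up to a phase, \<open>g\<close> is affine and
  \<open>g'\<close> quadratic in y.\<close>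

lemma std_normal_integration_by_parts:
  fixes g g' :: "real \<Rightarrow> complex"
  assumes deriv: "\<And>y. (g has_vector_derivative g' y) (at y)"
    and cont: "continuous_on UNIV g'"
    and gb: "\<And>y. norm (g y) \<le> K * (1 + y\<^sup>2)" and g'b: "\<And>y. norm (g' y) \<le> K * (1 + y\<^sup>2)"
  shows "(LINT y|std_normal_distribution. y *\<^sub>R g y) = (LINT y|std_normal_distribution. g' y)"
proof -
  have gc: "continuous_on UNIV g"
    using deriv by (meson has_vector_derivative_continuous continuous_at_imp_continuous_on)
  have [measurable]: "g \<in> borel_measurable borel" "g' \<in> borel_measurable borel"
    using gc cont by (auto intro: borel_measurable_continuous_onI)
  have K: "K \<ge> 0" using order_trans[OF norm_ge_zero gb[of 0]] by simp
  let ?\<phi> = std_normal_density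
  have mom: "integrable lborel (\<lambda>y. ?\<phi> y * \<bar>y\<bar> ^ k)" for k
    by (rule integrable_std_normal_moment_abs)
  have i1: "integrable lborel (\<lambda>y. ?\<phi> y *\<^sub>R (y *\<^sub>R g y))"
  proof (rule Bochner_Integration.integrable_bound)
    show "integrable lborel (\<lambda>y. K * (?\<phi> y * \<bar>y\<bar>^1) + K * (?\<phi> y * \<bar>y\<bar>^3))" by (intro Bochner_Integration.integrable_add integrable_mult_right mom)
    show "AE y in lborel. norm (?\<phi> y *\<^sub>R (y *\<^sub>R g y)) \<le> norm (K * (?\<phi> y * \<bar>y\<bar>^1) + K * (?\<phi> y * \<bar>y\<bar>^3))"
    proof (rule AE_I2)
      fix y :: real
      have "norm (?\<phi> y *\<^sub>R (y *\<^sub>R g y)) \<le> ?\<phi> y * (\<bar>y\<bar> * (K * (1 + y\<^sup>2)))"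
        using gb[of y] by (auto simp: abs_mult mult.assoc intro!: mult_left_mono)
      also have "\<dots> = K * (?\<phi> y * \<bar>y\<bar>^1) + K * (?\<phi> y * \<bar>y\<bar>^3)"
        by (subst power2_abs[symmetric], algebra)
      finally show "norm (?\<phi> y *\<^sub>R (y *\<^sub>R g y)) \<le> norm (K * (?\<phi> y * \<bar>y\<bar>^1) + K * (?\<phi> y * \<bar>y\<bar>^3))" by simp
    qed
  qed simp
  have i2: "integrable lborel (\<lambda>y. ?\<phi> y *\<^sub>R g' y)"
  proof (rule Bochner_Integration.integrable_bound)
    show "integrable lborel (\<lambda>y. K * (?\<phi> y * \<bar>y\<bar>^0) + K * (?\<phi> y * \<bar>y\<bar>^2))" by (intro Bochner_Integration.integrable_add integrable_mult_right mom)
    show "AE y in lborel. norm (?\<phi> y *\<^sub>R g' y) \<le> norm (K * (?\<phi> y * \<bar>y\<bar>^0) + K * (?\<phi> y * \<bar>y\<bar>^2))"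
    proof (rule AE_I2)
      fix y :: real
      have "norm (?\<phi> y *\<^sub>R g' y) \<le> ?\<phi> y * (K * (1 + y\<^sup>2))"
        by (auto intro!: mult_left_mono g'b)
      also have "\<dots> = K * (?\<phi> y * \<bar>y\<bar>^0) + K * (?\<phi> y * \<bar>y\<bar>^2)"
        by (simp add: algebra_simps)
      finally show "norm (?\<phi> y *\<^sub>R g' y) \<le> norm (K * (?\<phi> y * \<bar>y\<bar>^0) + K * (?\<phi> y * \<bar>y\<bar>^2))" by simp
    qed
  qed simp
  define F where "F y = ?\<phi> y *\<^sub>R g y" for y
  define f where "f y = ?\<phi> y *\<^sub>R g' y - ?\<phi> y *\<^sub>R (y *\<^sub>R g y)" for y
  have fi: "integrable lborel f" unfolding f_def by (intro Bochner_Integration.integrable_diff i1 i2)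
  have dphi: "(?\<phi> has_real_derivative (- y * ?\<phi> y)) (at y)" for y
  proof -
    have "((\<lambda>x. k * exp (- x\<^sup>2 / 2)) has_real_derivative (- y * (k * exp (- y\<^sup>2 / 2)))) (at y)" for k :: real
      by (auto intro!: derivative_eq_intros)
    then show ?thesis unfolding std_normal_density_def .
  qed
  have dF: "(F has_vector_derivative f y) (at y)" for y
    unfolding F_def f_def
    by (rule derivative_eq_intros dphi deriv refl)+ (simp add: scaleR_left_diff_distrib algebra_simps)
  have cphi: "continuous_on UNIV ?\<phi>" unfolding std_normal_density_def by (intro continuous_intros) auto
  have cf: "continuous_on S f" for S unfolding f_def
    by (intro continuous_intros continuous_on_subset[OF cphi] continuous_on_subset[OF cont] continuous_on_subset[OF gc]) auto
  have "(LINT y|lborel. indicator {- real n..real n} y *\<^sub>R f y) = F (real n) - F (- real n)" for n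
    by (rule integral_FTC_Icc) (auto intro: has_vector_derivative_at_within dF cf)
  moreover have "(\<lambda>n. LINT y|lborel. indicator {- real n..real n} y *\<^sub>R f y) \<longlonglongrightarrow> (LINT y|lborel. f y)"
  proof (rule integral_dominated_convergence[where w="\<lambda>y. norm (f y)"])
    show "AE y in lborel. (\<lambda>n. indicator {- real n..real n} y *\<^sub>R f y) \<longlonglongrightarrow> f y"
    proof (rule AE_I2, rule tendsto_eventually)
      fix y :: real
      have "eventually (\<lambda>n. real n \<ge> \<bar>y\<bar>) sequentially" by real_asymp
      then show "\<forall>\<^sub>F n in sequentially. indicator {- real n..real n} y *\<^sub>R f y = f y"
        by eventually_elim (auto simp: indicator_def)
    qed
  qed (use fi integrable_norm[OF fi] in \<open>auto simp: indicator_def\<close>)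
  moreover have "(\<lambda>n. F (real n) - F (- real n)) \<longlonglongrightarrow> 0"
  proof (rule Lim_null_comparison)
    have b: "norm (F y) \<le> K * ((1 + y\<^sup>2) * ?\<phi> y)" for y
    proof -
      have "norm (F y) \<le> ?\<phi> y * (K * (1 + y\<^sup>2))" unfolding F_def by (auto intro!: mult_left_mono gb)
      then show ?thesis by (simp add: algebra_simps)
    qed
    show "\<forall>\<^sub>F n in sequentially. norm (F (real n) - F (- real n)) \<le> 2 * K * ((1 + (real n)\<^sup>2) * ?\<phi> (real n))"
    proof (rule always_eventually, rule allI)
      fix n
      have "norm (F (real n) - F (- real n)) \<le> norm (F (real n)) + norm (F (- real n))" by (rule norm_triangle_ineq4)
      also have "\<dots> \<le> K * ((1 + (real n)\<^sup>2) * ?\<phi> (real n)) + K * ((1 + (- real n)\<^sup>2) * ?\<phi> (- real n))" by (intro add_mono b)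
      also have "\<dots> = 2 * K * ((1 + (real n)\<^sup>2) * ?\<phi> (real n))" by (simp add: std_normal_density_def)
      finally show "norm (F (real n) - F (- real n)) \<le> 2 * K * ((1 + (real n)\<^sup>2) * ?\<phi> (real n))" .
    qed
    have "(\<lambda>n. (1 + (real n)\<^sup>2) * ?\<phi> (real n)) \<longlonglongrightarrow> 0"
      unfolding std_normal_density_def by real_asymp
    from tendsto_mult_right_zero[OF this, of "2 * K"]
    show "(\<lambda>n. 2 * K * ((1 + (real n)\<^sup>2) * ?\<phi> (real n))) \<longlonglongrightarrow> 0" .
  qed
  ultimately have "(LINT y|lborel. f y) = 0" using LIMSEQ_unique by auto
  then have "(LINT y|lborel. ?\<phi> y *\<^sub>R g' y) = (LINT y|lborel. ?\<phi> y *\<^sub>R (y *\<^sub>R g y))"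
    unfolding f_def using i1 i2 by simp
  then show ?thesis by (simp add: std_normal_integral_eq)
qed

text \<open>The joint characteristic function stands in for a density, so that singular
  \<open>S\<close> are covered. Semidefiniteness of \<open>S\<close> is a consequence, see
  \<open>S_psd\<close>.\<close>

locale gaussian_family = prob_space M for M :: "'a measure" +
  fixes I :: "'i set" and Y :: "'i \<Rightarrow> 'a \<Rightarrow> real" and S :: "'i \<Rightarrow> 'i \<Rightarrow> real"
  assumes fin: "finite I" and Y_meas: "\<And>k. k \<in> I \<Longrightarrow> Y k \<in> borel_measurable M"
    and S_sym: "\<And>k l. S k l = S l k"
    and cf: "\<And>v. (LINT \<omega>|M. cis (\<Sum>k\<in>I. v k * Y k \<omega>)) = of_real (exp (- (\<Sum>k\<in>I. \<Sum>l\<in>I. v k * v l * S k l) / 2))"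
begin

text \<open>A characteristic function has modulus at most 1, which fixes the sign of the
  exponent.\<close>

lemma S_psd: "(\<Sum>k\<in>I. \<Sum>l\<in>I. v k * v l * S k l) \<ge> 0"
proof -
  note Y_meas [measurable]
  have "norm (LINT \<omega>|M. cis (\<Sum>k\<in>I. v k * Y k \<omega>)) \<le> (LINT \<omega>|M. norm (cis (\<Sum>k\<in>I. v k * Y k \<omega>)))"
    by (rule integral_norm_bound)
  also have "\<dots> = 1" by (simp add: prob_space)
  finally show ?thesis unfolding cf by simp
qed

text \<open>\<open>S_psd\<close> for a vector supported on two coordinates; it plays the part of the
  Cauchy-Schwarz inequality in \<open>S_zero\<close>.\<close>

lemma S_quad_delta:
  assumes "k \<in> I" "m \<in> I" "k \<noteq> m"
  shows "x\<^sup>2 * S k k + 2 * x * y * S k m + y\<^sup>2 * S m m \<ge> 0"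
proof -
  have e: "(\<Sum>l\<in>I. (if l = k then x else if l = m then y else 0) * f l) = x * f k + y * f m" for f :: "'i \<Rightarrow> real"
  proof -
    have "(\<Sum>l\<in>I. (if l = k then x else if l = m then y else 0) * f l)
      = (\<Sum>l\<in>I. (if l = k then x * f l else 0) + (if l = m then y * f l else 0))"
      using assms by (intro sum.cong) auto
    then show ?thesis using assms fin by (simp add: sum.distrib)
  qed
  have "0 \<le> (\<Sum>a\<in>I. \<Sum>b\<in>I. (if a = k then x else if a = m then y else 0) * (if b = k then x else if b = m then y else 0) * S a b)"
    by (rule S_psd)
  also have "\<dots> = x\<^sup>2 * S k k + 2 * x * y * S k m + y\<^sup>2 * S m m"
    by (simp add: mult.assoc e flip: sum_distrib_left)
       (simp add: algebra_simps power2_eq_square S_sym[of m k])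
  finally show ?thesis .
qed

lemma cf_single: "k \<in> I \<Longrightarrow> (LINT \<omega>|M. cis (u * Y k \<omega>)) = of_real (exp (- (u\<^sup>2 * S k k) / 2))"
  using cf[of "\<lambda>l. if l = k then u else 0"] fin
  by (simp add: if_distrib[where f="\<lambda>x. x * _"] if_distrib[where f="\<lambda>x. _ * x"] power2_eq_square cong: if_cong)

lemma S_diag: assumes "k \<in> I" shows "S k k \<ge> 0"
  using S_psd[of "\<lambda>l. if l = k then 1 else 0"] fin assms
  by (simp add: if_distrib[where f="\<lambda>x. x * _"] if_distrib[where f="\<lambda>x. _ * x"] power2_eq_square cong: if_cong)

text \<open>Both sides have the same characteristic function. Writing the law as that of a scaled
  standard normal includes \<open>S k k = 0\<close> and lets all moments be read off from the
  standard ones.\<close>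

lemma law:
  assumes k: "k \<in> I"
  shows "distr M borel (Y k) = distr std_normal_distribution borel (\<lambda>y. sqrt (S k k) * y)"
proof (rule finite_measure_char_unique)
  note Y_meas[OF k, measurable]
  interpret N: real_distribution std_normal_distribution by (rule real_dist_normal_dist)
  show "finite_measure (distr M borel (Y k))" by (rule finite_measure_distr) simp
  show "finite_measure (distr std_normal_distribution borel (\<lambda>y. sqrt (S k k) * y))" by (rule N.finite_measure_distr) simp
  fix u :: real
  have "(LINT x|distr M borel (Y k). cis (u * x)) = of_real (exp (- (u\<^sup>2 * S k k) / 2))"
    by (subst integral_distr) (auto simp: cf_single[OF k])
  also have "\<dots> = char std_normal_distribution (u * sqrt (S k k))"
    using S_diag[OF k] by (simp add: char_std_normal_distribution power_mult_distrib)
  also have "\<dots> = (LINT x|distr std_normal_distribution borel (\<lambda>y. sqrt (S k k) * y). cis (u * x))"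
    by (subst integral_distr) (auto simp: char_def cis_conv_exp ac_simps)
  finally show "(LINT x|distr M borel (Y k). cis (u * x)) = (LINT x|distr std_normal_distribution borel (\<lambda>y. sqrt (S k k) * y). cis (u * x))" .
qed simp_all

lemma moment_integrable: assumes k: "k \<in> I" shows "integrable M (\<lambda>\<omega>. (Y k \<omega>) ^ n)"
proof -
  note Y_meas[OF k, measurable]
  have "integrable std_normal_distribution (\<lambda>y. sqrt (S k k) ^ n * y ^ n)"
    by (intro integrable_mult_right integrable_std_normal_distribution_moment)
  then have "integrable (distr std_normal_distribution borel (\<lambda>y. sqrt (S k k) * y)) (\<lambda>y. y ^ n)"
    by (subst integrable_distr_eq) (auto simp: power_mult_distrib)
  then show ?thesis unfolding law[OF k, symmetric] by (subst (asm) integrable_distr_eq) auto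
qed

lemma second_moment: assumes k: "k \<in> I" shows "(LINT \<omega>|M. (Y k \<omega>)\<^sup>2) = S k k"
proof -
  note Y_meas[OF k, measurable]
  have "(LINT \<omega>|M. (Y k \<omega>)\<^sup>2) = (LINT y|distr M borel (Y k). y\<^sup>2)" by (subst integral_distr) auto
  also have "\<dots> = (LINT y|std_normal_distribution. S k k * y\<^sup>2)"
    unfolding law[OF k] using S_diag[OF k] by (subst integral_distr) (auto simp: power_mult_distrib)
  also have "\<dots> = S k k"
    using std_normal_distribution_even_moments(1)[of 1] by simp
  finally show ?thesis .
qed

lemma product_integrable: assumes "k \<in> I" "l \<in> I" shows "integrable M (\<lambda>\<omega>. Y k \<omega> * Y l \<omega>)"
proof (rule Bochner_Integration.integrable_bound)
  show "integrable M (\<lambda>\<omega>. (Y k \<omega>)^2 + (Y l \<omega>)^2)" using assms by (intro Bochner_Integration.integrable_add moment_integrable)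
  show "(\<lambda>\<omega>. Y k \<omega> * Y l \<omega>) \<in> borel_measurable M" using Y_meas assms by auto
  show "AE \<omega> in M. norm (Y k \<omega> * Y l \<omega>) \<le> norm ((Y k \<omega>)^2 + (Y l \<omega>)^2)"
    using abs_mult_le_sum_squares by auto
qed

end

context gaussian_family
begin

lemma AE_zero: assumes k: "k \<in> I" and 0: "S k k = 0" shows "AE \<omega> in M. Y k \<omega> = 0"
proof -
  note Y_meas[OF k, measurable]
  have "AE \<omega> in M. (Y k \<omega>)\<^sup>2 = 0"
    using second_moment[OF k] 0 moment_integrable[OF k, of 2]
    by (subst integral_nonneg_eq_0_iff_AE[symmetric]) auto
  then show ?thesis by simp
qed

lemma S_zero: assumes k: "k \<in> I" "m \<in> I" and 0: "S k k = 0" shows "S k m = 0"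
proof (cases "k = m")
  case False
  show ?thesis
  proof (rule ccontr)
    assume nz: "S k m \<noteq> 0"
    \<comment> \<open>With \<open>S k k = 0\<close> the form is affine in its first argument, and
      this argument makes it equal to -1.\<close>
    have "0 \<le> 2 * (- (S m m + 1) / (2 * S k m)) * S k m + S m m"
      using S_quad_delta[OF k False, of "- (S m m + 1) / (2 * S k m)" 1] 0 by simp
    also have "\<dots> = -1" using nz by (simp add: field_simps)
    finally show False by simp
  qed
qed (use 0 in auto)

text \<open>The residual \<open>Y m \<omega> - S k m / S k k * Y k \<omega>\<close> is uncorrelated
  with \<open>Y k\<close>, so \<open>Y k\<close> may be exchanged for an independent normal of the
  same variance without changing the joint law. Only characteristic functions are compared, so
  independence of the residual never has to be formulated.\<close>

lemma regression_law:
  assumes k: "k \<in> I" and s: "S k k > 0"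
  defines "W \<equiv> \<lambda>m (\<omega>, y). Y m \<omega> - S k m / S k k * Y k \<omega> + y * (S k m / sqrt (S k k))"
  shows "distr M (PiM I (\<lambda>_. borel)) (\<lambda>x. \<lambda>k\<in>I. Y k x)
       = distr (M \<Otimes>\<^sub>M std_normal_distribution) (PiM I (\<lambda>_. borel)) (\<lambda>x. \<lambda>m\<in>I. W m x)"
proof (rule joint_char_unique[OF fin])
  interpret N: real_distribution std_normal_distribution by (rule real_dist_normal_dist)
  interpret P: pair_prob_space M std_normal_distribution ..
  note Y_meas [measurable]
  note Y_meas[OF k, measurable]
  show "finite_measure M" by (rule finite_measure_axioms)
  show "finite_measure (M \<Otimes>\<^sub>M std_normal_distribution)" by (rule P.finite_measure_axioms)
  show [measurable]: "W m \<in> borel_measurable (M \<Otimes>\<^sub>M std_normal_distribution)" if [simp]: "m \<in> I" for m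
    unfolding W_def by measurable
  fix v :: "'i \<Rightarrow> real"
  let ?s = "S k k"
  define b where "b = (\<Sum>m\<in>I. v m * S k m)"
  \<comment> \<open>The subtracted regression terms are all multiples of \<open>Y k\<close> and are
    absorbed into its weight. This lowers the quadratic form by b^2 / S k k (\<open>quad\<close>),
    exactly the variance that the independent normal adds back (\<open>nb\<close>).\<close>
  define v' where "v' m = v m - (if m = k then b / ?s else 0)" for m
  have v'sum: "(\<Sum>m\<in>I. v' m * f m) = (\<Sum>m\<in>I. v m * f m) - b / ?s * f k" for f
  proof -
    have "(\<Sum>m\<in>I. v' m * f m) = (\<Sum>m\<in>I. v m * f m - (if m = k then b / ?s * f m else 0))"
      by (intro sum.cong) (auto simp: v'_def left_diff_distrib)
    then show ?thesis using k fin by (simp add: sum_subtractf)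
  qed
  have split: "(\<Sum>m\<in>I. v m * W m (\<omega>, y)) = (\<Sum>m\<in>I. v' m * Y m \<omega>) + y * (b / sqrt ?s)" for \<omega> y
  proof -
    have "(\<Sum>m\<in>I. v m * W m (\<omega>, y)) = (\<Sum>m\<in>I. v m * Y m \<omega>) - (\<Sum>m\<in>I. v m * S k m * (Y k \<omega> / ?s)) + (\<Sum>m\<in>I. v m * S k m * (y / sqrt ?s))"
      unfolding W_def sum_subtractf[symmetric] sum.distrib[symmetric] by (intro sum.cong) (auto simp: algebra_simps)
    also have "\<dots> = (\<Sum>m\<in>I. v m * Y m \<omega>) - b * (Y k \<omega> / ?s) + b * (y / sqrt ?s)"
      unfolding b_def sum_distrib_right ..
    also have "\<dots> = (\<Sum>m\<in>I. v' m * Y m \<omega>) + y * (b / sqrt ?s)"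
      by (simp add: v'sum)
    finally show ?thesis .
  qed
  have quad: "(\<Sum>m\<in>I. \<Sum>l\<in>I. v' m * v' l * S m l) = (\<Sum>m\<in>I. \<Sum>l\<in>I. v m * v l * S m l) - b\<^sup>2 / ?s"
  proof -
    have "(\<Sum>m\<in>I. \<Sum>l\<in>I. v' m * v' l * S m l) = (\<Sum>m\<in>I. v' m * (\<Sum>l\<in>I. v' l * S m l))"
      by (simp add: sum_distrib_left mult.assoc)
    also have "\<dots> = (\<Sum>m\<in>I. v' m * ((\<Sum>l\<in>I. v l * S m l) - b / ?s * S m k))" by (simp only: v'sum)
    also have "\<dots> = (\<Sum>m\<in>I. v m * ((\<Sum>l\<in>I. v l * S m l) - b / ?s * S m k)) - b / ?s * ((\<Sum>l\<in>I. v l * S k l) - b / ?s * S k k)"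
      by (rule v'sum)
    also have "(\<Sum>l\<in>I. v l * S k l) = b" by (simp add: b_def)
    also have "b - b / ?s * S k k = 0" using s by simp
    also have "(\<Sum>m\<in>I. v m * ((\<Sum>l\<in>I. v l * S m l) - b / ?s * S m k)) = (\<Sum>m\<in>I. \<Sum>l\<in>I. v m * v l * S m l) - b / ?s * b"
    proof -
      have b': "(\<Sum>m\<in>I. v m * S m k) = b" unfolding b_def by (intro sum.cong) (simp_all add: S_sym)
      have "(\<Sum>m\<in>I. v m * ((\<Sum>l\<in>I. v l * S m l) - b / ?s * S m k)) = (\<Sum>m\<in>I. v m * (\<Sum>l\<in>I. v l * S m l)) - b / ?s * (\<Sum>m\<in>I. v m * S m k)"
        unfolding sum_distrib_left[of "b / ?s"] sum_subtractf[symmetric] by (intro sum.cong) (auto simp: algebra_simps)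
      then show ?thesis unfolding b' by (simp add: sum_distrib_left mult.assoc)
    qed
    finally show ?thesis by (simp add: power2_eq_square)
  qed
  have nb: "(LINT y|std_normal_distribution. cis (y * (b / sqrt ?s))) = of_real (exp (- (b\<^sup>2 / ?s) / 2))"
  proof -
    have "(LINT y|std_normal_distribution. cis (y * (b / sqrt ?s))) = char std_normal_distribution (b / sqrt ?s)"
      by (simp add: char_def cis_conv_exp ac_simps)
    then show ?thesis using s by (simp add: char_std_normal_distribution power_divide)
  qed
  have "(LINT x|(M \<Otimes>\<^sub>M std_normal_distribution). cis (\<Sum>m\<in>I. v m * W m x))
      = (LINT \<omega>|M. LINT y|std_normal_distribution. cis (\<Sum>m\<in>I. v m * W m (\<omega>, y)))"
    using integrable_cis[of "M \<Otimes>\<^sub>M std_normal_distribution" "\<lambda>x. \<Sum>m\<in>I. v m * W m x"] P.finite_measure_axioms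
    by (subst P.integral_fst') auto
  also have "\<dots> = (LINT \<omega>|M. cis (\<Sum>m\<in>I. v' m * Y m \<omega>) * of_real (exp (- (b\<^sup>2 / ?s) / 2)))"
    unfolding split cis_mult[symmetric] nb[symmetric] by simp
  also have "\<dots> = of_real (exp (- ((\<Sum>m\<in>I. \<Sum>l\<in>I. v m * v l * S m l) - b\<^sup>2 / ?s) / 2)) * of_real (exp (- (b\<^sup>2 / ?s) / 2))"
    by (simp add: cf quad)
  also have "\<dots> = of_real (exp (- (\<Sum>m\<in>I. \<Sum>l\<in>I. v m * v l * S m l) / 2))"
    by (simp add: exp_add[symmetric] of_real_mult[symmetric] diff_divide_distrib del: of_real_mult)
  finally show "(LINT \<omega>|M. cis (\<Sum>k\<in>I. v k * Y k \<omega>)) = (LINT x|(M \<Otimes>\<^sub>M std_normal_distribution). cis (\<Sum>m\<in>I. v m * W m x))"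
    by (simp add: cf)
qed (use Y_meas in auto)

text \<open>After \<open>regression_law\<close> the coordinate \<open>Y k\<close> is a multiple of
  an independent normal y, and every other coordinate is affine in y with slope proportional to
  \<open>S k m\<close>. Stein's identity in y then differentiates \<open>Y l\<close>, which gives
  the term with \<open>S k l\<close>, and the phase, which gives the sum over m. If
  \<open>S k k = 0\<close>, both sides vanish, since the whole row of \<open>S\<close> does.\<close>

lemma integration_by_parts:
  fixes \<kappa> :: "'i \<Rightarrow> real"
  assumes k: "k \<in> I" and l: "l \<in> I"
  defines "E \<equiv> (\<lambda>\<omega>. cis (\<Sum>m\<in>I. \<kappa> m * (Y m \<omega>)\<^sup>2)) :: 'a \<Rightarrow> complex"
  shows "(LINT \<omega>|M. of_real (Y k \<omega> * Y l \<omega>) * E \<omega>)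
     = of_real (S k l) * (LINT \<omega>|M. E \<omega>) + 2 * \<i> * (\<Sum>m\<in>I. of_real (\<kappa> m * S k m) * (LINT \<omega>|M. of_real (Y l \<omega> * Y m \<omega>) * E \<omega>))"
proof (cases "S k k = 0")
  case True
  then have "S k m = 0" if "m \<in> I" for m using S_zero k that by blast
  moreover have "(LINT \<omega>|M. of_real (Y k \<omega> * Y l \<omega>) * E \<omega>) = 0"
    using AE_zero[OF k True] by (intro integral_eq_zero_AE) auto
  ultimately show ?thesis using l by simp
next
  case False
  then have s: "S k k > 0" using S_diag[OF k] by simp
  note Y_meas [measurable]
  note Y_meas[OF k, measurable] Y_meas[OF l, measurable]
  interpret N: real_distribution std_normal_distribution by (rule real_dist_normal_dist)
  interpret P: pair_prob_space M std_normal_distribution ..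
  let ?N = std_normal_distribution
  let ?s = "sqrt (S k k)"
  let ?P = "M \<Otimes>\<^sub>M ?N" and ?B = "PiM I (\<lambda>_. borel :: real measure)"
  define V where "V m \<omega> = Y m \<omega> - S k m / S k k * Y k \<omega>" for m \<omega>
  define W where "W m x = (case x of (\<omega>, y) \<Rightarrow> Y m \<omega> - S k m / S k k * Y k \<omega> + y * (S k m / ?s))" for m x
  have W': "W m (\<omega>, y) = V m \<omega> + y * (S k m / ?s)" for m \<omega> y by (simp add: W_def V_def)
  have [measurable]: "W m \<in> borel_measurable ?P" if [simp]: "m \<in> I" for m
    unfolding W_def by measurable
  have [measurable]: "W k \<in> borel_measurable ?P" "W l \<in> borel_measurable ?P" using k l by auto
  have [measurable]: "(\<lambda>x. \<lambda>k\<in>I. Y k x) \<in> measurable M ?B" "(\<lambda>x. \<lambda>m\<in>I. W m x) \<in> measurable ?P ?B"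
    by (auto intro!: measurable_restrict)
  have reg: "distr M ?B (\<lambda>x. \<lambda>k\<in>I. Y k x) = distr ?P ?B (\<lambda>x. \<lambda>m\<in>I. W m x)"
    using regression_law[OF k s] unfolding W_def by simp
  have transfer: "(LINT \<omega>|M. \<Phi> (\<lambda>k\<in>I. Y k \<omega>)) = (LINT x|?P. \<Phi> (\<lambda>k\<in>I. W k x))"
      "integrable M (\<lambda>\<omega>. \<Phi> (\<lambda>k\<in>I. Y k \<omega>)) = integrable ?P (\<lambda>x. \<Phi> (\<lambda>k\<in>I. W k x))"
    if [measurable]: "\<Phi> \<in> borel_measurable ?B" for \<Phi> :: "('i \<Rightarrow> real) \<Rightarrow> complex"
    using arg_cong[OF reg, of "\<lambda>\<mu>. LINT z|\<mu>. \<Phi> z"] arg_cong[OF reg, of "\<lambda>\<mu>. integrable \<mu> \<Phi>"]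
    by (simp_all add: integral_distr integrable_distr_eq)
  define \<Theta> where "\<Theta> z = cis (\<Sum>m\<in>I. \<kappa> m * (z m)\<^sup>2)" for z
  have [measurable]: "\<Theta> \<in> borel_measurable ?B" "(\<lambda>z. z k) \<in> borel_measurable ?B" "(\<lambda>z. z l) \<in> borel_measurable ?B"
    using k l unfolding \<Theta>_def by measurable
  have nT [simp]: "norm (\<Theta> z) = 1" for z by (simp add: \<Theta>_def)
  have EY: "E \<omega> = \<Theta> (\<lambda>k\<in>I. Y k \<omega>)" for \<omega> unfolding E_def \<Theta>_def by simp
  have Emeas [measurable]: "E \<in> borel_measurable M" unfolding E_def by measurable
  have YYint: "integrable M (\<lambda>\<omega>. of_real (Y a \<omega> * Y b \<omega>) * E \<omega>)" if ab: "a \<in> I" "b \<in> I" for a b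
  proof -
    note Y_meas[OF ab(1), measurable] Y_meas[OF ab(2), measurable]
    show ?thesis by (rule Bochner_Integration.integrable_bound[OF product_integrable[OF ab]])
      (auto simp: norm_mult E_def)
  qed
  \<comment> \<open>The two sides of the claim as expectations of functions of the coordinate
    vector, so that \<open>transfer\<close> moves both to the product space. There the identity
    holds already for the inner integral over y.\<close>
  define \<Phi>1 where "\<Phi>1 z = of_real (z k * z l) * \<Theta> z" for z :: "'i \<Rightarrow> real"
  define \<Phi>2 where "\<Phi>2 z = (of_real (S k l) + 2 * \<i> * (\<Sum>m\<in>I. of_real (\<kappa> m * S k m) * of_real (z l * z m))) * \<Theta> z" for z :: "'i \<Rightarrow> real"
  have [measurable]: "\<Phi>1 \<in> borel_measurable ?B" "\<Phi>2 \<in> borel_measurable ?B" unfolding \<Phi>1_def \<Phi>2_def by measurable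
  have Eint: "integrable M E" unfolding E_def by (rule integrable_cis) (auto intro: finite_measure_axioms)
  have \<Phi>2_Y: "\<Phi>2 (\<lambda>k\<in>I. Y k \<omega>) = of_real (S k l) * E \<omega> + 2 * \<i> * (\<Sum>m\<in>I. of_real (\<kappa> m * S k m) * (of_real (Y l \<omega> * Y m \<omega>) * E \<omega>))" for \<omega>
    unfolding \<Phi>2_def EY using l by (simp add: algebra_simps sum_distrib_left sum_distrib_right)
  have i2M: "integrable M (\<lambda>\<omega>. \<Phi>2 (\<lambda>k\<in>I. Y k \<omega>))"
    unfolding \<Phi>2_Y using YYint l Eint by (intro Bochner_Integration.integrable_add integrable_mult_right integrable_sum) auto
  have i1M: "integrable M (\<lambda>\<omega>. \<Phi>1 (\<lambda>k\<in>I. Y k \<omega>))"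
    using YYint[OF k l] k l by (simp add: \<Phi>1_def EY)
  have i1: "integrable ?P (\<lambda>x. \<Phi>1 (\<lambda>k\<in>I. W k x))" and i2: "integrable ?P (\<lambda>x. \<Phi>2 (\<lambda>k\<in>I. W k x))"
    using i1M i2M transfer(2) by auto
  have Wk: "W k (\<omega>, y) = ?s * y" for \<omega> y
    using s by (simp add: W_def field_simps)
  \<comment> \<open>For fixed \<omega>, coordinate \<open>k\<close> is sqrt (S k k) times y. Its y
    is the factor in Stein's identity; its constant stays in \<open>g\<close> and cancels the
    denominators of the slopes.\<close>
  have inner: "(LINT y|?N. \<Phi>1 (\<lambda>k\<in>I. W k (\<omega>, y))) = (LINT y|?N. \<Phi>2 (\<lambda>k\<in>I. W k (\<omega>, y)))" for \<omega>
  proof -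
    define w where "w m y = V m \<omega> + y * (S k m / ?s)" for m y
    define g where "g y = of_real (?s * w l y) * cis (\<Sum>m\<in>I. \<kappa> m * (w m y)\<^sup>2)" for y
    define g' where "g' y = (of_real (S k l) + 2 * \<i> * (\<Sum>m\<in>I. of_real (\<kappa> m * S k m) * of_real (w l y * w m y))) * cis (\<Sum>m\<in>I. \<kappa> m * (w m y)\<^sup>2)" for y
    have dw: "((\<lambda>y. w m y) has_real_derivative (S k m / ?s)) (at y)" for m y
    proof -
      have "((\<lambda>y. v + y * c) has_real_derivative c) (at y)" for v c :: real
        by (auto intro!: derivative_eq_intros)
      then show ?thesis unfolding w_def .
    qed
    have dq: "((\<lambda>y. \<Sum>m\<in>I. \<kappa> m * (w m y)\<^sup>2) has_real_derivative (\<Sum>m\<in>I. \<kappa> m * (2 * w m y * (S k m / ?s)))) (at y)" for y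
      by (intro derivative_eq_intros DERIV_sum) (auto intro!: derivative_eq_intros dw sum.cong)
    have dcis: "((\<lambda>y. cis (\<Sum>m\<in>I. \<kappa> m * (w m y)\<^sup>2)) has_vector_derivative
       (\<Sum>m\<in>I. \<kappa> m * (2 * w m y * (S k m / ?s))) *\<^sub>R (\<i> * cis (\<Sum>m\<in>I. \<kappa> m * (w m y)\<^sup>2))) (at y)" for y
    proof -
      have "(cis has_vector_derivative \<i> * cis x) (at x)" for x
        unfolding cis_conv_exp by (rule has_vector_derivative_iexp[of x UNIV, simplified])
      from vector_diff_chain_at[OF dq[unfolded has_real_derivative_iff_has_vector_derivative] this]
      show ?thesis by (simp add: o_def)
    qed
    have dl: "((\<lambda>y. complex_of_real (?s * w l y)) has_vector_derivative of_real (S k l)) (at y)" for y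
    proof -
      have "((\<lambda>y. ?s * w l y) has_real_derivative ?s * (S k l / ?s)) (at y)" by (intro DERIV_cmult dw)
      then have "((\<lambda>y. ?s * w l y) has_real_derivative S k l) (at y)" using s by simp
      then show ?thesis by (rule has_vector_derivative_of_real)
    qed
    have "(g has_vector_derivative g' y) (at y)" for y
    proof -
      have "(g has_vector_derivative (of_real (?s * w l y) * ((\<Sum>m\<in>I. \<kappa> m * (2 * w m y * (S k m / ?s))) *\<^sub>R (\<i> * cis (\<Sum>m\<in>I. \<kappa> m * (w m y)\<^sup>2)))
         + of_real (S k l) * cis (\<Sum>m\<in>I. \<kappa> m * (w m y)\<^sup>2))) (at y)"
        unfolding g_def by (rule has_vector_derivative_mult[OF dl dcis])
      also have "of_real (?s * w l y) * ((\<Sum>m\<in>I. \<kappa> m * (2 * w m y * (S k m / ?s))) *\<^sub>R (\<i> * cis (\<Sum>m\<in>I. \<kappa> m * (w m y)\<^sup>2)))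
         = 2 * \<i> * of_real (\<Sum>m\<in>I. \<kappa> m * S k m * (w l y * w m y)) * cis (\<Sum>m\<in>I. \<kappa> m * (w m y)\<^sup>2)"
      proof -
        have "?s * w l y * (\<Sum>m\<in>I. \<kappa> m * (2 * w m y * (S k m / ?s))) = 2 * (\<Sum>m\<in>I. \<kappa> m * S k m * (w l y * w m y))"
          using s by (auto simp: sum_distrib_left intro!: sum.cong)
        from arg_cong[OF this, of complex_of_real] show ?thesis
          by (simp only: scaleR_conv_of_real of_real_mult of_real_numeral) (simp add: algebra_simps)
      qed
      finally show ?thesis by (simp add: g'_def algebra_simps)
    qed
    moreover have "continuous_on UNIV g'"
      unfolding g'_def w_def by (intro continuous_intros)
    moreover define B where "B m = \<bar>V m \<omega>\<bar> + \<bar>S k m / ?s\<bar>" for m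
    have wb: "\<bar>w m y\<bar> \<le> B m * max 1 \<bar>y\<bar>" for m y
    proof -
      have "\<bar>w m y\<bar> \<le> \<bar>V m \<omega>\<bar> + \<bar>y\<bar> * \<bar>S k m / ?s\<bar>" unfolding w_def abs_mult[symmetric] by (rule abs_triangle_ineq)
      also have "\<dots> \<le> \<bar>V m \<omega>\<bar> * max 1 \<bar>y\<bar> + max 1 \<bar>y\<bar> * \<bar>S k m / ?s\<bar>"
        by (intro add_mono mult_right_mono) (auto simp: mult_le_cancel_left1)
      finally show ?thesis by (simp add: B_def algebra_simps)
    qed
    have B0: "B m \<ge> 0" for m by (simp add: B_def)
    have mx: "max 1 \<bar>y\<bar> * max 1 \<bar>y\<bar> \<le> 1 + y\<^sup>2" for y :: real
      by (cases "\<bar>y\<bar> \<le> 1") (auto simp: max_def power2_eq_square)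
    have mx1: "max 1 \<bar>y\<bar> \<le> 1 + y\<^sup>2" for y :: real
    proof -
      have "max 1 \<bar>y\<bar> * 1 \<le> max 1 \<bar>y\<bar> * max 1 \<bar>y\<bar>" by (intro mult_left_mono) auto
      then show ?thesis using mx[of y] by linarith
    qed
    have wwb: "\<bar>w l y * w m y\<bar> \<le> B l * B m * (1 + y\<^sup>2)" for m y
    proof -
      have "\<bar>w l y * w m y\<bar> \<le> (B l * max 1 \<bar>y\<bar>) * (B m * max 1 \<bar>y\<bar>)"
        unfolding abs_mult using wb B0 by (intro mult_mono) auto
      also have "\<dots> = B l * B m * (max 1 \<bar>y\<bar> * max 1 \<bar>y\<bar>)" by simp
      also have "\<dots> \<le> B l * B m * (1 + y\<^sup>2)" by (intro mult_left_mono mx) (simp add: B0)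
      finally show ?thesis .
    qed
    \<comment> \<open>The summands bound, in this order, \<open>g\<close>, the constant term of
      \<open>g'\<close> and the quadratic terms of \<open>g'\<close>, so one constant serves both
      growth conditions.\<close>
    define K where "K = ?s * B l + \<bar>S k l\<bar> + 2 * (\<Sum>m\<in>I. \<bar>\<kappa> m * S k m\<bar> * (B l * B m))"
    have K_parts: "?s * B l \<ge> 0" "\<bar>S k l\<bar> \<ge> 0" "(\<Sum>m\<in>I. \<bar>\<kappa> m * S k m\<bar> * (B l * B m)) \<ge> 0"
      using s B0 by (auto intro!: sum_nonneg mult_nonneg_nonneg)
    have "norm (g y) \<le> K * (1 + y\<^sup>2)" for y
    proof -
      have "norm (g y) = ?s * \<bar>w l y\<bar>" unfolding g_def using s by (simp add: norm_mult abs_mult)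
      also have "\<dots> \<le> ?s * (B l * max 1 \<bar>y\<bar>)" using wb s by (intro mult_left_mono) auto
      also have "\<dots> \<le> ?s * (B l * (1 + y\<^sup>2))" using mx1 s B0 by (intro mult_left_mono) auto
      also have "\<dots> \<le> K * (1 + y\<^sup>2)" unfolding mult.assoc[symmetric] using K_parts by (intro mult_right_mono) (auto simp: K_def)
      finally show ?thesis .
    qed
    moreover have "norm (g' y) \<le> K * (1 + y\<^sup>2)" for y
    proof -
      have "norm (g' y) = norm (of_real (S k l) + 2 * \<i> * (\<Sum>m\<in>I. of_real (\<kappa> m * S k m) * of_real (w l y * w m y)))"
        unfolding g'_def norm_mult by simp
      also have "\<dots> \<le> norm (complex_of_real (S k l)) + norm (2 * \<i> * (\<Sum>m\<in>I. of_real (\<kappa> m * S k m) * of_real (w l y * w m y)))"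
        by (rule norm_triangle_ineq)
      also have "\<dots> = \<bar>S k l\<bar> + 2 * norm (\<Sum>m\<in>I. complex_of_real (\<kappa> m * S k m) * of_real (w l y * w m y))"
        by (simp only: norm_mult norm_of_real) simp
      also have "\<dots> \<le> \<bar>S k l\<bar> * (1 + y\<^sup>2) + 2 * (\<Sum>m\<in>I. \<bar>\<kappa> m * S k m\<bar> * (B l * B m * (1 + y\<^sup>2)))"
      proof (intro add_mono mult_left_mono sum_norm_le)
        show "\<bar>S k l\<bar> \<le> \<bar>S k l\<bar> * (1 + y\<^sup>2)" by (simp add: mult_le_cancel_left1)
        fix m
        have "norm (complex_of_real (\<kappa> m * S k m) * of_real (w l y * w m y)) = \<bar>\<kappa> m * S k m\<bar> * \<bar>w l y * w m y\<bar>"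
          by (simp only: norm_mult norm_of_real)
        also have "\<dots> \<le> \<bar>\<kappa> m * S k m\<bar> * (B l * B m * (1 + y\<^sup>2))" by (intro mult_left_mono wwb) auto
        finally show "norm (complex_of_real (\<kappa> m * S k m) * of_real (w l y * w m y)) \<le> \<bar>\<kappa> m * S k m\<bar> * (B l * B m * (1 + y\<^sup>2))" .
      qed auto
      also have "\<dots> = (\<bar>S k l\<bar> + 2 * (\<Sum>m\<in>I. \<bar>\<kappa> m * S k m\<bar> * (B l * B m))) * (1 + y\<^sup>2)"
        by (simp only: distrib_right mult.assoc sum_distrib_right)
      also have "\<dots> \<le> K * (1 + y\<^sup>2)" using K_parts by (intro mult_right_mono) (auto simp: K_def)
      finally show ?thesis .
    qed
    ultimately have "(LINT y|?N. y *\<^sub>R g y) = (LINT y|?N. g' y)"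
      by (rule std_normal_integration_by_parts)
    moreover have "\<Phi>1 (\<lambda>k\<in>I. W k (\<omega>, y)) = y *\<^sub>R g y" for y
    proof -
      have "(\<lambda>k\<in>I. W k (\<omega>, y)) k = ?s * y" using k Wk by simp
      moreover have "(\<lambda>k\<in>I. W k (\<omega>, y)) l = w l y" using l by (simp add: W' w_def)
      moreover have "\<Theta> (\<lambda>k\<in>I. W k (\<omega>, y)) = cis (\<Sum>m\<in>I. \<kappa> m * (w m y)\<^sup>2)" unfolding \<Theta>_def
        by (intro arg_cong[where f=cis] sum.cong) (auto simp: W' w_def)
      ultimately show ?thesis unfolding \<Phi>1_def g_def by (simp add: scaleR_conv_of_real)
    qed
    moreover have "\<Phi>2 (\<lambda>k\<in>I. W k (\<omega>, y)) = g' y" for y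
    proof -
      have "(\<lambda>k\<in>I. W k (\<omega>, y)) m = w m y" if "m \<in> I" for m using that by (simp add: W' w_def)
      moreover have "\<Theta> (\<lambda>k\<in>I. W k (\<omega>, y)) = cis (\<Sum>m\<in>I. \<kappa> m * (w m y)\<^sup>2)" unfolding \<Theta>_def
        by (intro arg_cong[where f=cis] sum.cong) (auto simp: W' w_def)
      ultimately show ?thesis unfolding \<Phi>2_def g'_def using l by simp
    qed
    ultimately show ?thesis by simp
  qed
  have "(LINT \<omega>|M. of_real (Y k \<omega> * Y l \<omega>) * E \<omega>) = (LINT \<omega>|M. \<Phi>1 (\<lambda>k\<in>I. Y k \<omega>))"
    using k l by (simp add: \<Phi>1_def EY)
  also have "\<dots> = (LINT x|?P. \<Phi>1 (\<lambda>k\<in>I. W k x))" by (rule transfer) simp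
  also have "\<dots> = (LINT \<omega>|M. LINT y|?N. \<Phi>1 (\<lambda>k\<in>I. W k (\<omega>, y)))" using P.integral_fst'[OF i1] by simp
  also have "\<dots> = (LINT \<omega>|M. LINT y|?N. \<Phi>2 (\<lambda>k\<in>I. W k (\<omega>, y)))" by (simp only: inner)
  also have "\<dots> = (LINT x|?P. \<Phi>2 (\<lambda>k\<in>I. W k x))" using P.integral_fst'[OF i2] by simp
  also have "\<dots> = (LINT \<omega>|M. \<Phi>2 (\<lambda>k\<in>I. Y k \<omega>))" by (rule transfer[symmetric]) simp
  also have "\<dots> = of_real (S k l) * (LINT \<omega>|M. E \<omega>) + 2 * \<i> * (\<Sum>m\<in>I. of_real (\<kappa> m * S k m) * (LINT \<omega>|M. of_real (Y l \<omega> * Y m \<omega>) * E \<omega>))"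
    unfolding \<Phi>2_Y using YYint l Eint
    by (subst Bochner_Integration.integral_add)
       (auto intro!: integrable_mult_right integrable_sum simp: integral_sum simp del: of_real_mult)
  finally show ?thesis .
qed

end

subsection \<open>Characteristic functions of quadratic forms\<close>

lemma norm_integral_le_integral:
  fixes f :: "'a \<Rightarrow> 'b::{banach, second_countable_topology}"
  assumes "integrable M f" "integrable M g" "\<And>x. x \<in> space M \<Longrightarrow> norm (f x) \<le> g x"
  shows "norm (LINT x|M. f x) \<le> (LINT x|M. g x)"
  using assms by (intro order_trans[OF integral_norm_bound] integral_mono) auto

text \<open>A quadratic remainder leaves an error of at most K |h| in the difference quotient. The
  form is suited to characteristic functions, where the remainder is estimated under the integral
  for every increment at once.\<close>

lemma has_vector_derivative_from_square_bound:
  fixes f :: "real \<Rightarrow> 'b::real_normed_vector"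
  assumes "\<And>h. norm (f (t + h) - f t - h *\<^sub>R f') \<le> K * h\<^sup>2"
  shows "(f has_vector_derivative f') (at t)"
  unfolding has_vector_derivative_def has_derivative_at
proof (rule conjI[OF bounded_linear_scaleR_left], rule Lim_null_comparison)
  show "\<forall>\<^sub>F h in at 0. norm (norm (f (t + h) - f t - h *\<^sub>R f') / norm h) \<le> K * \<bar>h\<bar>"
    unfolding eventually_at_filter
  proof (rule always_eventually, intro allI impI)
    fix h :: real assume "h \<noteq> 0"
    show "norm (norm (f (t + h) - f t - h *\<^sub>R f') / norm h) \<le> K * \<bar>h\<bar>"
    proof -
      have "h\<^sup>2 = \<bar>h\<bar> * \<bar>h\<bar>" by (simp add: power2_eq_square)
      then have "norm (f (t + h) - f t - h *\<^sub>R f') \<le> (K * \<bar>h\<bar>) * \<bar>h\<bar>" using assms[of h] by (simp only: mult.assoc)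
      then have "norm (f (t + h) - f t - h *\<^sub>R f') / \<bar>h\<bar> \<le> K * \<bar>h\<bar>"
        using \<open>h \<noteq> 0\<close> by (subst pos_divide_le_eq) auto
      then show ?thesis by simp
    qed
  qed
  show "((\<lambda>h. K * \<bar>h\<bar>) \<longlongrightarrow> 0) (at 0)"
    by (auto intro!: tendsto_eq_intros)
qed

lemma cis_second_order: "norm (cis x - 1 - \<i> * of_real x) \<le> x\<^sup>2 / 2"
proof -
  have "{..1::nat} = {0, 1}" by auto
  then show ?thesis using iexp_approx1[of x 1] unfolding Suc_1 by (simp add: cis_conv_exp diff_diff_eq)
qed

text \<open>Pointwise the second-order remainder of the exponential is at most h^2 T^2 / 2, and the
  second moment of \<open>T\<close> makes this an integrable quadratic bound.\<close>

lemma (in prob_space) cf_has_vector_derivative: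
  assumes [measurable]: "T \<in> borel_measurable M" and T1: "integrable M T" and T2: "integrable M (\<lambda>\<omega>. (T \<omega>)\<^sup>2)"
  shows "((\<lambda>t. LINT \<omega>|M. cis (t * T \<omega>)) has_vector_derivative \<i> * (LINT \<omega>|M. of_real (T \<omega>) * cis (t * T \<omega>))) (at t)"
proof (rule has_vector_derivative_from_square_bound)
  fix h :: real
  have i1: "integrable M (\<lambda>\<omega>. cis (s * T \<omega>))" for s by (rule integrable_cis[OF finite_measure_axioms]) simp
  have i2: "integrable M (\<lambda>\<omega>. of_real (T \<omega>) * cis (t * T \<omega>))"
    by (rule Bochner_Integration.integrable_bound[OF T1]) (auto simp: norm_mult)
  have "(LINT \<omega>|M. cis ((t + h) * T \<omega>)) - (LINT \<omega>|M. cis (t * T \<omega>)) - h *\<^sub>R (\<i> * (LINT \<omega>|M. of_real (T \<omega>) * cis (t * T \<omega>)))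
    = (LINT \<omega>|M. cis ((t + h) * T \<omega>) - cis (t * T \<omega>) - h *\<^sub>R (\<i> * (of_real (T \<omega>) * cis (t * T \<omega>))))"
    using i1 i2 by (simp add: scaleR_conv_of_real)
  also have "norm \<dots> \<le> (LINT \<omega>|M. h\<^sup>2 * (T \<omega>)\<^sup>2 / 2)"
  proof (rule norm_integral_le_integral)
    fix \<omega>
    have "cis ((t + h) * T \<omega>) - cis (t * T \<omega>) - h *\<^sub>R (\<i> * (of_real (T \<omega>) * cis (t * T \<omega>)))
      = cis (t * T \<omega>) * (cis (h * T \<omega>) - 1 - \<i> * of_real (h * T \<omega>))"
      by (simp add: cis_mult[symmetric] distrib_right scaleR_conv_of_real algebra_simps)
    then show "norm (cis ((t + h) * T \<omega>) - cis (t * T \<omega>) - h *\<^sub>R (\<i> * (of_real (T \<omega>) * cis (t * T \<omega>)))) \<le> h\<^sup>2 * (T \<omega>)\<^sup>2 / 2"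
      using cis_second_order[of "h * T \<omega>"] by (simp add: norm_mult power_mult_distrib)
  qed (use i1 i2 T2 in auto)
  also have "\<dots> = (LINT \<omega>|M. (T \<omega>)\<^sup>2) / 2 * h\<^sup>2" by simp
  finally show "norm ((LINT \<omega>|M. cis ((t + h) * T \<omega>)) - (LINT \<omega>|M. cis (t * T \<omega>)) - h *\<^sub>R (\<i> * (LINT \<omega>|M. of_real (T \<omega>) * cis (t * T \<omega>)))) \<le> (LINT \<omega>|M. (T \<omega>)\<^sup>2) / 2 * h\<^sup>2" .
qed

text \<open>A Gronwall-type comparison with the solution of \<open>\<phi>' = - v t \<phi>\<close>.\<close>

lemma gaussian_cf_comparison:
  fixes \<phi> \<phi>' :: "real \<Rightarrow> complex"
  assumes d: "\<And>s. (\<phi> has_vector_derivative \<phi>' s) (at s)"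
    and b: "\<And>s. norm (\<phi>' s + of_real (v * s) * \<phi> s) \<le> K * s\<^sup>2"
    and 0: "\<phi> 0 = 1"
  shows "norm (\<phi> t - of_real (exp (- v * t\<^sup>2 / 2))) \<le> K * \<bar>t\<bar>^3 * exp (\<bar>v\<bar> * t\<^sup>2)"
proof -
  have K: "K \<ge> 0" using order_trans[OF norm_ge_zero b[of 1]] by simp
  \<comment> \<open>Integrating factor: for an exact solution of the differential equation
    \<open>F\<close> is constant, and in general its derivative is the defect times the
    factor.\<close>
  define F where "F s = exp (v * s\<^sup>2 / 2) *\<^sub>R \<phi> s" for s
  have dF: "(F has_vector_derivative exp (v * s\<^sup>2 / 2) *\<^sub>R (\<phi>' s + of_real (v * s) * \<phi> s)) (at s)" for s
  proof -
    have "((\<lambda>s. exp (v * s\<^sup>2 / 2)) has_real_derivative exp (v * s\<^sup>2 / 2) * (v * s)) (at s)"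
      by (auto intro!: derivative_eq_intros)
    from has_vector_derivative_scaleR[OF this d] show ?thesis
      unfolding F_def by (rule has_vector_derivative_eq_rhs) (simp add: scaleR_conv_of_real algebra_simps)
  qed
  \<comment> \<open>Mean value inequality on a symmetric interval, which treats both signs of
    \<open>t\<close> together. Dividing the integrating factor out again at the end doubles the
    exponent in the bound.\<close>
  have FB0: "norm (F t - F 0) \<le> (exp (\<bar>v\<bar> * t\<^sup>2 / 2) * (K * t\<^sup>2)) * norm (t - 0)"
  proof (rule differentiable_bound[of "{- \<bar>t\<bar>..\<bar>t\<bar>}" F])
    fix s assume s: "s \<in> {- \<bar>t\<bar>..\<bar>t\<bar>}"
    then have s2: "s\<^sup>2 \<le> t\<^sup>2" by (auto simp: abs_le_square_iff[symmetric])
    show "(F has_derivative (\<lambda>h. h *\<^sub>R (exp (v * s\<^sup>2 / 2) *\<^sub>R (\<phi>' s + of_real (v * s) * \<phi> s)))) (at s within {- \<bar>t\<bar>..\<bar>t\<bar>})"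
      using dF[of s] unfolding has_vector_derivative_def by (rule has_derivative_at_withinI)
    have "v * s\<^sup>2 \<le> \<bar>v\<bar> * t\<^sup>2" using s2 by (intro mult_mono) auto
    then have "exp (v * s\<^sup>2 / 2) * norm (\<phi>' s + of_real (v * s) * \<phi> s) \<le> exp (\<bar>v\<bar> * t\<^sup>2 / 2) * (K * t\<^sup>2)"
      using s2 K by (intro mult_mono order_trans[OF b] mult_left_mono) auto
    then have nX: "norm (exp (v * s\<^sup>2 / 2) *\<^sub>R (\<phi>' s + of_real (v * s) * \<phi> s)) \<le> exp (\<bar>v\<bar> * t\<^sup>2 / 2) * (K * t\<^sup>2)" by simp
    show "onorm (\<lambda>h. h *\<^sub>R (exp (v * s\<^sup>2 / 2) *\<^sub>R (\<phi>' s + of_real (v * s) * \<phi> s))) \<le> exp (\<bar>v\<bar> * t\<^sup>2 / 2) * (K * t\<^sup>2)"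
    proof (rule onorm_le)
      fix h :: real
      have "norm (h *\<^sub>R (exp (v * s\<^sup>2 / 2) *\<^sub>R (\<phi>' s + of_real (v * s) * \<phi> s))) = norm h * norm (exp (v * s\<^sup>2 / 2) *\<^sub>R (\<phi>' s + of_real (v * s) * \<phi> s))"
        by (simp only: norm_scaleR real_norm_def)
      also have "\<dots> \<le> norm h * (exp (\<bar>v\<bar> * t\<^sup>2 / 2) * (K * t\<^sup>2))" by (intro mult_left_mono nX) simp
      finally show "norm (h *\<^sub>R (exp (v * s\<^sup>2 / 2) *\<^sub>R (\<phi>' s + of_real (v * s) * \<phi> s))) \<le> exp (\<bar>v\<bar> * t\<^sup>2 / 2) * (K * t\<^sup>2) * norm h" by (simp only: mult.commute)
    qed
  qed (auto simp: convex_real_interval)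
  have FB: "norm (F t - 1) \<le> K * \<bar>t\<bar>^3 * exp (\<bar>v\<bar> * t\<^sup>2 / 2)"
  proof -
    have "(exp (\<bar>v\<bar> * t\<^sup>2 / 2) * (K * t\<^sup>2)) * norm (t - 0) = K * \<bar>t\<bar>^3 * exp (\<bar>v\<bar> * t\<^sup>2 / 2)"
    proof -
      have "t\<^sup>2 * \<bar>t\<bar> = \<bar>t\<bar>^3" by (simp add: power3_eq_cube power2_eq_square)
      then show ?thesis by (simp add: mult.assoc mult.left_commute[of "exp _"] mult.commute[of "exp _"])
    qed
    moreover have "F 0 = 1" using 0 by (simp add: F_def)
    ultimately show ?thesis using FB0 by metis
  qed
  have "\<phi> t - of_real (exp (- v * t\<^sup>2 / 2)) = exp (- v * t\<^sup>2 / 2) *\<^sub>R (F t - 1)"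
    unfolding F_def by (simp add: scaleR_right_diff_distrib exp_add[symmetric]) (simp add: scaleR_conv_of_real)
  then have "norm (\<phi> t - of_real (exp (- v * t\<^sup>2 / 2))) = exp (- v * t\<^sup>2 / 2) * norm (F t - 1)" by simp
  also have "\<dots> \<le> exp (\<bar>v\<bar> * t\<^sup>2 / 2) * (K * \<bar>t\<bar>^3 * exp (\<bar>v\<bar> * t\<^sup>2 / 2))"
  proof (intro mult_mono FB)
    have "- v * t\<^sup>2 \<le> \<bar>v\<bar> * t\<^sup>2" by (intro mult_right_mono) auto
    then show "exp (- v * t\<^sup>2 / 2) \<le> exp (\<bar>v\<bar> * t\<^sup>2 / 2)" by simp
  qed (use K in auto)
  also have "\<dots> = K * \<bar>t\<bar>^3 * (exp (\<bar>v\<bar> * t\<^sup>2 / 2) * exp (\<bar>v\<bar> * t\<^sup>2 / 2))" by simp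
  also have "exp (\<bar>v\<bar> * t\<^sup>2 / 2) * exp (\<bar>v\<bar> * t\<^sup>2 / 2) = exp (\<bar>v\<bar> * t\<^sup>2)" by (simp flip: exp_add)
  finally show ?thesis .
qed

context gaussian_family
begin

text \<open>From 0 \<le> S \<le> C follows S^2 \<le> C^2 in the sense of forms, without eigenvalues:
  \<open>S_psd\<close> is tested on x - A x / C, where A is the operator with matrix
  \<open>S\<close>. The mixed terms give -2 |A x|^2 / C, and the upper bound at A x returns only |A
  x|^2 / C.\<close>

lemma operator_bound:
  assumes ub: "\<And>x. (\<Sum>k\<in>I. \<Sum>l\<in>I. x k * x l * S k l) \<le> C * (\<Sum>k\<in>I. (x k)\<^sup>2)" and C: "C > 0"
  shows "(\<Sum>k\<in>I. (\<Sum>m\<in>I. S k m * x m)\<^sup>2) \<le> C\<^sup>2 * (\<Sum>k\<in>I. (x k)\<^sup>2)"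
proof -
  define A where "A x k = (\<Sum>m\<in>I. S k m * x m)" for x k
  define s where "s = 1 / C"
  have Q: "(\<Sum>k\<in>I. \<Sum>l\<in>I. x k * x l * S k l) = (\<Sum>k\<in>I. x k * A x k)" for x
    by (simp add: A_def sum_distrib_left ac_simps)
  have A_lin: "A (\<lambda>k. x k - s * A x k) k = A x k - s * A (A x) k" for k
    by (simp add: A_def sum_distrib_left sum_subtractf right_diff_distrib ac_simps)
  have adj: "(\<Sum>k\<in>I. x k * A y k) = (\<Sum>k\<in>I. A x k * y k)" for x y
  proof -
    have "(\<Sum>k\<in>I. x k * A y k) = (\<Sum>k\<in>I. \<Sum>m\<in>I. x k * S k m * y m)" by (simp add: A_def sum_distrib_left ac_simps)
    also have "\<dots> = (\<Sum>m\<in>I. \<Sum>k\<in>I. x k * S k m * y m)" by (rule sum.swap)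
    also have "\<dots> = (\<Sum>m\<in>I. A x m * y m)"
      unfolding A_def sum_distrib_right by (intro sum.cong refl) (simp add: S_sym)
    finally show ?thesis .
  qed
  have "0 \<le> (\<Sum>k\<in>I. (x k - s * A x k) * A (\<lambda>k. x k - s * A x k) k)"
    unfolding Q[symmetric] by (rule S_psd)
  also have "\<dots> = (\<Sum>k\<in>I. x k * A x k) - s * (\<Sum>k\<in>I. x k * A (A x) k) - s * (\<Sum>k\<in>I. A x k * A x k) + s\<^sup>2 * (\<Sum>k\<in>I. A x k * A (A x) k)"
    unfolding A_lin sum_distrib_left sum_subtractf[symmetric] sum.distrib[symmetric]
    by (intro sum.cong refl) (simp add: algebra_simps power2_eq_square)
  also have "(\<Sum>k\<in>I. x k * A (A x) k) = (\<Sum>k\<in>I. (A x k)\<^sup>2)" by (simp add: adj power2_eq_square)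
  also have "(\<Sum>k\<in>I. A x k * A x k) = (\<Sum>k\<in>I. (A x k)\<^sup>2)" by (simp add: power2_eq_square)
  also have "(\<Sum>k\<in>I. x k * A x k) \<le> C * (\<Sum>k\<in>I. (x k)\<^sup>2)" using ub Q by simp
  also have "s\<^sup>2 * (\<Sum>k\<in>I. A x k * A (A x) k) \<le> s\<^sup>2 * (C * (\<Sum>k\<in>I. (A x k)\<^sup>2))"
    using ub[of "A x"] Q by (intro mult_left_mono) auto
  also have "s\<^sup>2 * (C * (\<Sum>k\<in>I. (A x k)\<^sup>2)) = s * (\<Sum>k\<in>I. (A x k)\<^sup>2)"
    using C by (simp add: s_def power2_eq_square)
  finally have "s * (\<Sum>k\<in>I. (A x k)\<^sup>2) \<le> C * (\<Sum>k\<in>I. (x k)\<^sup>2)" by simp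
  then have "C * (s * (\<Sum>k\<in>I. (A x k)\<^sup>2)) \<le> C * (C * (\<Sum>k\<in>I. (x k)\<^sup>2))" using C by (intro mult_left_mono) auto
  then show ?thesis using C by (simp add: s_def A_def power2_eq_square mult.assoc)
qed

text \<open>The first integration by parts cancels the centring and produces second moments under
  the phase; the second one extracts from these the variance term v. What is left is not integrated
  further but estimated, at the price of the operator norm squared times the trace.
  \<open>gaussian_cf_comparison\<close> then integrates the differential inequality.\<close>

theorem quadratic_form_cf_bound:
  fixes \<epsilon> :: "'i \<Rightarrow> real" and \<rho> C t :: real
  assumes ub: "\<And>x. (\<Sum>k\<in>I. \<Sum>l\<in>I. x k * x l * S k l) \<le> C * (\<Sum>k\<in>I. (x k)\<^sup>2)" and C: "C > 0"
    and eps: "\<And>k. k \<in> I \<Longrightarrow> \<bar>\<epsilon> k\<bar> \<le> 1"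
  defines "T \<equiv> (\<lambda>\<omega>. \<rho> * (\<Sum>k\<in>I. \<epsilon> k * ((Y k \<omega>)\<^sup>2 - S k k))) :: 'a \<Rightarrow> real"
    and "v \<equiv> 2 * \<rho>\<^sup>2 * (\<Sum>k\<in>I. \<Sum>l\<in>I. \<epsilon> k * \<epsilon> l * (S k l)\<^sup>2)"
  shows "norm ((LINT \<omega>|M. cis (t * T \<omega>)) - of_real (exp (- v * t\<^sup>2 / 2)))
           \<le> 4 * \<bar>\<rho>\<bar>^3 * C\<^sup>2 * (\<Sum>k\<in>I. S k k) * \<bar>t\<bar>^3 * exp (\<bar>v\<bar> * t\<^sup>2)"
proof (rule gaussian_cf_comparison)
  note Y_meas [measurable]
  have [measurable]: "T \<in> borel_measurable M" unfolding T_def by measurable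
  have Yint: "integrable M (\<lambda>\<omega>. (Y k \<omega>)\<^sup>2)" if "k \<in> I" for k using moment_integrable[OF that, of 2] .
  have T1: "integrable M T" unfolding T_def by (intro integrable_mult_right Bochner_Integration.integrable_sum Bochner_Integration.integrable_diff Yint) auto
  have T2: "integrable M (\<lambda>\<omega>. (T \<omega>)\<^sup>2)"
  proof -
    have p: "integrable M (\<lambda>\<omega>. ((Y k \<omega>)\<^sup>2 - S k k) * ((Y l \<omega>)\<^sup>2 - S l l))" if kl: "k \<in> I" "l \<in> I" for k l
    proof (rule Bochner_Integration.integrable_bound)
      note Y_meas[OF kl(1), measurable] Y_meas[OF kl(2), measurable]
      have 4: "integrable M (\<lambda>\<omega>. ((Y k \<omega>)\<^sup>2 - S k k)\<^sup>2)" if k: "k \<in> I" for k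
      proof -
        have "(\<lambda>\<omega>. ((Y k \<omega>)\<^sup>2 - S k k)\<^sup>2) = (\<lambda>\<omega>. (Y k \<omega>)^4 - 2 * S k k * (Y k \<omega>)^2 + (S k k)\<^sup>2)"
          by (auto simp: power2_diff power_mult[symmetric])
        then show ?thesis using moment_integrable[OF k, of 4] Yint[OF k] by simp
      qed
      show "integrable M (\<lambda>\<omega>. ((Y k \<omega>)\<^sup>2 - S k k)\<^sup>2 + ((Y l \<omega>)\<^sup>2 - S l l)\<^sup>2)" using 4 kl by simp
      show "AE \<omega> in M. norm (((Y k \<omega>)\<^sup>2 - S k k) * ((Y l \<omega>)\<^sup>2 - S l l)) \<le> norm (((Y k \<omega>)\<^sup>2 - S k k)\<^sup>2 + ((Y l \<omega>)\<^sup>2 - S l l)\<^sup>2)"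
        using abs_mult_le_sum_squares by auto
      show "(\<lambda>\<omega>. ((Y k \<omega>)\<^sup>2 - S k k) * ((Y l \<omega>)\<^sup>2 - S l l)) \<in> borel_measurable M" by measurable
    qed
    have "(\<lambda>\<omega>. (T \<omega>)\<^sup>2) = (\<lambda>\<omega>. \<rho>\<^sup>2 * (\<Sum>k\<in>I. \<Sum>l\<in>I. \<epsilon> k * \<epsilon> l * (((Y k \<omega>)\<^sup>2 - S k k) * ((Y l \<omega>)\<^sup>2 - S l l))))"
      unfolding T_def power_mult_distrib by (subst power2_eq_square[of "sum _ _"]) (simp add: sum_product ac_simps)
    then show ?thesis by (simp only:) (intro integrable_mult_right Bochner_Integration.integrable_sum p)
  qed
  fix s :: real
  show "((\<lambda>t. LINT \<omega>|M. cis (t * T \<omega>)) has_vector_derivative \<i> * (LINT \<omega>|M. of_real (T \<omega>) * cis (s * T \<omega>))) (at s)"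
    by (rule cf_has_vector_derivative[OF _ T1 T2]) simp
  define e where "e \<omega> = cis (s * T \<omega>)" for \<omega>
  define \<phi> where "\<phi> = (LINT \<omega>|M. e \<omega>)"
  define J where "J k l = (LINT \<omega>|M. of_real (Y k \<omega> * Y l \<omega>) * e \<omega>)" for k l
  have [measurable]: "e \<in> borel_measurable M" unfolding e_def by measurable
  have ne [simp]: "norm (e \<omega>) = 1" for \<omega> by (simp add: e_def)
  have eint: "integrable M e" unfolding e_def by (rule integrable_cis[OF finite_measure_axioms]) simp
  have YYint: "integrable M (\<lambda>\<omega>. of_real (Y a \<omega> * Y b \<omega>) * e \<omega>)" if ab: "a \<in> I" "b \<in> I" for a b
  proof -
    note Y_meas[OF ab(1), measurable] Y_meas[OF ab(2), measurable]
    show ?thesis by (rule Bochner_Integration.integrable_bound[OF product_integrable[OF ab]])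
      (auto simp: norm_mult)
  qed
  have ibp: "J k l = of_real (S k l) * \<phi> + 2 * \<i> * of_real (s * \<rho>) * (\<Sum>m\<in>I. of_real (\<epsilon> m * S k m) * J l m)"
    if kl: "k \<in> I" "l \<in> I" for k l
  proof -
    \<comment> \<open>The centring of the squares contributes only a constant unimodular factor, so
      \<open>integration_by_parts\<close> can be used with the uncentred phase.\<close>
    define c0 where "c0 = cis (- s * \<rho> * (\<Sum>m\<in>I. \<epsilon> m * S m m))"
    have e_eq: "e \<omega> = c0 * cis (\<Sum>m\<in>I. (s * \<rho> * \<epsilon> m) * (Y m \<omega>)\<^sup>2)" for \<omega>
      unfolding e_def c0_def cis_mult T_def
      by (intro arg_cong[where f=cis]) (simp add: sum_distrib_left right_diff_distrib sum_subtractf sum_negf ac_simps)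
    have cJ: "c0 * (LINT \<omega>|M. of_real (Y a \<omega> * Y b \<omega>) * cis (\<Sum>m\<in>I. (s * \<rho> * \<epsilon> m) * (Y m \<omega>)\<^sup>2)) = J a b" for a b
      unfolding J_def e_eq by (subst integral_mult_right_zero[symmetric]) (simp only: ac_simps)
    have "J k l = c0 * (LINT \<omega>|M. of_real (Y k \<omega> * Y l \<omega>) * cis (\<Sum>m\<in>I. (s * \<rho> * \<epsilon> m) * (Y m \<omega>)\<^sup>2))"
      by (rule cJ[symmetric])
    also have "\<dots> = of_real (S k l) * (c0 * (LINT \<omega>|M. cis (\<Sum>m\<in>I. (s * \<rho> * \<epsilon> m) * (Y m \<omega>)\<^sup>2)))
        + 2 * \<i> * of_real (s * \<rho>) * (\<Sum>m\<in>I. of_real (\<epsilon> m * S k m) * (c0 * (LINT \<omega>|M. of_real (Y l \<omega> * Y m \<omega>) * cis (\<Sum>m\<in>I. (s * \<rho> * \<epsilon> m) * (Y m \<omega>)\<^sup>2))))"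
      unfolding integration_by_parts[OF kl] by (simp add: algebra_simps sum_distrib_left)
    also have "c0 * (LINT \<omega>|M. cis (\<Sum>m\<in>I. (s * \<rho> * \<epsilon> m) * (Y m \<omega>)\<^sup>2)) = \<phi>"
      unfolding \<phi>_def e_eq by simp
    finally show ?thesis unfolding cJ .
  qed
  \<comment> \<open>The remainder after the second integration by parts: two factors of
    \<open>S\<close> contracted with the second moments \<open>J\<close> under the phase.\<close>
  define R where "R = (\<Sum>k\<in>I. \<Sum>m\<in>I. \<Sum>n\<in>I. of_real (\<epsilon> k * \<epsilon> m * \<epsilon> n * S k m * S k n) * J m n)"
  have ET: "(LINT \<omega>|M. of_real (T \<omega>) * e \<omega>) = of_real \<rho> * (\<Sum>k\<in>I. of_real (\<epsilon> k) * (J k k - of_real (S k k) * \<phi>))"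
  proof -
    have "(\<lambda>\<omega>. of_real (T \<omega>) * e \<omega>) = (\<lambda>\<omega>. of_real \<rho> * (\<Sum>k\<in>I. of_real (\<epsilon> k) * (of_real (Y k \<omega> * Y k \<omega>) * e \<omega> - of_real (S k k) * e \<omega>)))"
      by (auto simp: T_def power2_eq_square sum_distrib_left sum_distrib_right algebra_simps)
    then show ?thesis using YYint eint
      by (simp add: Bochner_Integration.integral_sum J_def \<phi>_def del: of_real_mult)
  qed
  have "\<i> * (LINT \<omega>|M. of_real (T \<omega>) * e \<omega>) + of_real (v * s) * \<phi> = - 4 * \<i> * of_real (s\<^sup>2 * \<rho>^3) * R"
  proof -
    have "(\<Sum>k\<in>I. of_real (\<epsilon> k) * (J k k - of_real (S k k) * \<phi>))
       = (\<Sum>k\<in>I. of_real (\<epsilon> k) * (2 * \<i> * of_real (s * \<rho>) * (\<Sum>m\<in>I. of_real (\<epsilon> m * S k m) * J k m)))"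
      by (intro sum.cong refl) (subst ibp, auto)
    also have "\<dots> = 2 * \<i> * of_real (s * \<rho>) * (\<Sum>k\<in>I. \<Sum>m\<in>I. of_real (\<epsilon> k * \<epsilon> m * S k m) * J k m)"
      by (simp add: sum_distrib_left ac_simps)
    also have "(\<Sum>k\<in>I. \<Sum>m\<in>I. of_real (\<epsilon> k * \<epsilon> m * S k m) * J k m)
       = (\<Sum>k\<in>I. \<Sum>m\<in>I. of_real (\<epsilon> k * \<epsilon> m * (S k m)\<^sup>2) * \<phi> + 2 * \<i> * of_real (s * \<rho>) * (\<Sum>n\<in>I. of_real (\<epsilon> k * \<epsilon> m * \<epsilon> n * S k m * S k n) * J m n))"
      by (intro sum.cong refl) (subst ibp, simp_all add: sum_distrib_left algebra_simps power2_eq_square)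
    also have "\<dots> = of_real (\<Sum>k\<in>I. \<Sum>m\<in>I. \<epsilon> k * \<epsilon> m * (S k m)\<^sup>2) * \<phi> + 2 * \<i> * of_real (s * \<rho>) * R"
      unfolding R_def by (simp add: sum.distrib sum_distrib_left sum_distrib_right)
    finally have "(\<Sum>k\<in>I. of_real (\<epsilon> k) * (J k k - of_real (S k k) * \<phi>)) = 2 * \<i> * of_real (s * \<rho>) * (of_real (\<Sum>k\<in>I. \<Sum>m\<in>I. \<epsilon> k * \<epsilon> m * (S k m)\<^sup>2) * \<phi> + 2 * \<i> * of_real (s * \<rho>) * R)" .
    then have "(LINT \<omega>|M. of_real (T \<omega>) * e \<omega>) = of_real \<rho> * (2 * \<i> * of_real (s * \<rho>) * (of_real (\<Sum>k\<in>I. \<Sum>m\<in>I. \<epsilon> k * \<epsilon> m * (S k m)\<^sup>2) * \<phi> + 2 * \<i> * of_real (s * \<rho>) * R))"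
      unfolding ET by simp
    moreover define D where "D = (\<Sum>k\<in>I. \<Sum>m\<in>I. \<epsilon> k * \<epsilon> m * (S k m)\<^sup>2)"
    moreover have "\<i> * (of_real \<rho> * (2 * \<i> * of_real (s * \<rho>) * (of_real D * \<phi> + 2 * \<i> * of_real (s * \<rho>) * R))) + of_real (2 * \<rho>\<^sup>2 * D * s) * \<phi> = - 4 * \<i> * of_real (s\<^sup>2 * \<rho>^3) * R"
      by (simp add: algebra_simps power2_eq_square power3_eq_cube)
    ultimately show ?thesis unfolding v_def by simp
  qed
  moreover have "norm R \<le> C\<^sup>2 * (\<Sum>k\<in>I. S k k)"
  proof -
    \<comment> \<open>The triple sum is a signed sum of squares of the coordinates of S (\<epsilon>
      Y). Hence \<open>operator_bound\<close> controls it pointwise by C^2 |Y|^2, whose expectation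
      is C^2 times the trace.\<close>
    define G where "G \<omega> = (\<Sum>k\<in>I. \<epsilon> k * (\<Sum>m\<in>I. S k m * (\<epsilon> m * Y m \<omega>))\<^sup>2)" for \<omega>
    have "R = (LINT \<omega>|M. (\<Sum>k\<in>I. \<Sum>m\<in>I. \<Sum>n\<in>I. of_real (\<epsilon> k * \<epsilon> m * \<epsilon> n * S k m * S k n) * (of_real (Y m \<omega> * Y n \<omega>) * e \<omega>)))"
      unfolding R_def J_def using YYint by (simp add: Bochner_Integration.integral_sum del: of_real_mult)
    also have "\<dots> = (LINT \<omega>|M. of_real (G \<omega>) * e \<omega>)"
    proof (rule Bochner_Integration.integral_cong[OF refl])
      fix \<omega>
      have "G \<omega> = (\<Sum>k\<in>I. \<Sum>m\<in>I. \<Sum>n\<in>I. (\<epsilon> k * \<epsilon> m * \<epsilon> n * S k m * S k n) * (Y m \<omega> * Y n \<omega>))"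
        unfolding G_def power2_eq_square sum_product sum_distrib_left by (intro sum.cong refl) (simp add: sum_distrib_left ac_simps)
      then show "(\<Sum>k\<in>I. \<Sum>m\<in>I. \<Sum>n\<in>I. of_real (\<epsilon> k * \<epsilon> m * \<epsilon> n * S k m * S k n) * (of_real (Y m \<omega> * Y n \<omega>) * e \<omega>)) = of_real (G \<omega>) * e \<omega>"
        by (simp add: sum_distrib_left ac_simps)
    qed
    also have "norm \<dots> \<le> (LINT \<omega>|M. C\<^sup>2 * (\<Sum>k\<in>I. (Y k \<omega>)\<^sup>2))"
    proof (rule norm_integral_le_integral)
      have gi: "integrable M (\<lambda>\<omega>. C\<^sup>2 * (\<Sum>k\<in>I. (Y k \<omega>)\<^sup>2))" by (intro integrable_mult_right Bochner_Integration.integrable_sum Yint)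
      have bnd: "norm (of_real (G \<omega>) * e \<omega>) \<le> C\<^sup>2 * (\<Sum>k\<in>I. (Y k \<omega>)\<^sup>2)" for \<omega>
      proof -
        have "norm (of_real (G \<omega>) * e \<omega>) = \<bar>G \<omega>\<bar>" by (simp add: norm_mult)
        also have "\<dots> \<le> (\<Sum>k\<in>I. \<bar>\<epsilon> k * (\<Sum>m\<in>I. S k m * (\<epsilon> m * Y m \<omega>))\<^sup>2\<bar>)" unfolding G_def by (rule sum_abs)
        also have "\<dots> \<le> (\<Sum>k\<in>I. (\<Sum>m\<in>I. S k m * (\<epsilon> m * Y m \<omega>))\<^sup>2)"
          using eps by (intro sum_mono) (auto simp: abs_mult intro!: mult_left_le_one_le)
        also have "\<dots> \<le> C\<^sup>2 * (\<Sum>k\<in>I. (\<epsilon> k * Y k \<omega>)\<^sup>2)" by (rule operator_bound[OF ub C])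
        also have "\<dots> \<le> C\<^sup>2 * (\<Sum>k\<in>I. (Y k \<omega>)\<^sup>2)"
          using eps by (intro mult_left_mono sum_mono) (auto simp: power_mult_distrib abs_square_le_1 intro!: mult_left_le_one_le)
        finally show ?thesis .
      qed
      show "integrable M (\<lambda>\<omega>. C\<^sup>2 * (\<Sum>k\<in>I. (Y k \<omega>)\<^sup>2))" by fact
      show "integrable M (\<lambda>\<omega>. of_real (G \<omega>) * e \<omega>)"
      proof (rule Bochner_Integration.integrable_bound[OF gi])
        show "(\<lambda>\<omega>. of_real (G \<omega>) * e \<omega>) \<in> borel_measurable M" unfolding G_def by measurable
        show "AE \<omega> in M. norm (of_real (G \<omega>) * e \<omega>) \<le> norm (C\<^sup>2 * (\<Sum>k\<in>I. (Y k \<omega>)\<^sup>2))"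
          using bnd by (intro AE_I2) (metis abs_ge_self order_trans real_norm_def)
      qed
      show "norm (of_real (G \<omega>) * e \<omega>) \<le> C\<^sup>2 * (\<Sum>k\<in>I. (Y k \<omega>)\<^sup>2)" for \<omega> by (rule bnd)
    qed
    finally have bnd: "norm R \<le> (LINT \<omega>|M. C\<^sup>2 * (\<Sum>k\<in>I. (Y k \<omega>)\<^sup>2))" .
    also have "\<dots> = C\<^sup>2 * (\<Sum>k\<in>I. S k k)" using Yint by (simp add: Bochner_Integration.integral_sum second_moment)
    finally show ?thesis .
  qed
  ultimately have "norm (\<i> * (LINT \<omega>|M. of_real (T \<omega>) * e \<omega>) + of_real (v * s) * \<phi>) \<le> 4 * \<bar>s\<^sup>2 * \<rho>^3\<bar> * (C\<^sup>2 * (\<Sum>k\<in>I. S k k))"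
    by (simp only: norm_mult norm_of_real) (simp add: mult_left_mono)
  then show "norm (\<i> * (LINT \<omega>|M. of_real (T \<omega>) * cis (s * T \<omega>)) + of_real (v * s) * (LINT \<omega>|M. cis (s * T \<omega>))) \<le> 4 * \<bar>\<rho>\<bar>^3 * C\<^sup>2 * (\<Sum>k\<in>I. S k k) * s\<^sup>2"
    unfolding \<phi>_def e_def by (simp add: abs_mult power_abs ac_simps)
qed (simp add: prob_space)

end

subsection \<open>Linear functionals of a stationary Gaussian process\<close>

lemma isCont_cis_real: "isCont cis x"
proof -
  have "continuous_on UNIV (\<lambda>x. cis x)" by (intro continuous_intros)
  then show ?thesis by (simp add: continuous_on_eq_continuous_at)
qed

lemma cis_diff_bound: "norm (cis x - cis y) \<le> \<bar>x - y\<bar>"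
proof -
  have "norm (cis x - cis y) = norm (cis y * (cis (x - y) - 1))"
    by (simp add: cis_mult right_diff_distrib)
  also have "\<dots> = norm (iexp (x - y) - 1)" by (simp add: norm_mult cis_conv_exp)
  also have "\<dots> \<le> \<bar>x - y\<bar>" using iexp_approx1[of "x - y" 0] by simp
  finally show ?thesis .
qed

text \<open>Zero mean turns the degenerate branch of \<open>real_gaussian_rv\<close> into a variable
  that vanishes almost surely, and centres the other branch, where scaling reduces to the standard
  normal.\<close>

lemma (in prob_space) centred_gaussian_rv_cf:
  assumes g: "real_gaussian_rv M Z" and mean: "expectation Z = 0"
  shows "integrable M (\<lambda>\<omega>. (Z \<omega>)\<^sup>2)"
    and "(LINT \<omega>|M. cis (u * Z \<omega>)) = of_real (exp (- (u\<^sup>2 * (LINT \<omega>|M. (Z \<omega>)\<^sup>2)) / 2))"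
proof -
  have [measurable]: "Z \<in> borel_measurable M" using g by (simp add: real_gaussian_rv_def)
  obtain \<mu> \<sigma> where *: "(\<sigma> = 0 \<and> (AE \<omega> in M. Z \<omega> = \<mu>)) \<or> (\<sigma> > 0 \<and> distributed M lborel Z (normal_density \<mu> \<sigma>))"
    using g unfolding real_gaussian_rv_def by blast
  have "integrable M (\<lambda>\<omega>. (Z \<omega>)\<^sup>2) \<and> (LINT \<omega>|M. cis (u * Z \<omega>)) = of_real (exp (- (u\<^sup>2 * (LINT \<omega>|M. (Z \<omega>)\<^sup>2)) / 2))"
    using *
  proof (elim disjE conjE)
    assume ae: "AE \<omega> in M. Z \<omega> = \<mu>"
    have "expectation Z = (LINT \<omega>|M. \<mu>)" using ae by (intro integral_cong_AE) auto
    then have "\<mu> = 0" using mean by (simp add: prob_space)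
    then have ae: "AE \<omega> in M. Z \<omega> = 0" using ae by simp
    have "integrable M (\<lambda>\<omega>. (Z \<omega>)\<^sup>2) \<longleftrightarrow> integrable M (\<lambda>\<omega>. 0 :: real)" using ae by (intro integrable_cong_AE) auto
    moreover have "(LINT \<omega>|M. (Z \<omega>)\<^sup>2) = 0" using ae by (intro integral_eq_zero_AE) auto
    moreover have "(LINT \<omega>|M. cis (u * Z \<omega>)) = (LINT \<omega>|M. 1)" using ae by (intro integral_cong_AE) auto
    ultimately show ?thesis by (simp add: prob_space)
  next
    assume s: "\<sigma> > 0" and D: "distributed M lborel Z (normal_density \<mu> \<sigma>)"
    have "\<mu> = 0" using normal_distributed_expectation[OF s D] mean by simp
    with D have D: "distributed M lborel Z (normal_density 0 \<sigma>)" by simp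
    have var: "(LINT \<omega>|M. (Z \<omega>)\<^sup>2) = \<sigma>\<^sup>2" using normal_distributed_variance[OF s D] mean by simp
    have "integrable M (\<lambda>\<omega>. (Z \<omega>)\<^sup>2)"
      using integrable_normal_moment[of \<sigma> 0 2] s by (subst distributed_integrable[OF D, symmetric]) auto
    moreover have "(LINT \<omega>|M. cis (u * Z \<omega>)) = of_real (exp (- (u\<^sup>2 * \<sigma>\<^sup>2) / 2))"
    proof -
      have "distributed M lborel (\<lambda>x. (Z x - 0) / \<sigma>) std_normal_density"
        using D normal_standard_normal_convert[OF s, of Z 0] by simp
      then have eq: "distr M lborel (\<lambda>x. Z x / \<sigma>) = std_normal_distribution" by (simp add: distributed_def)
      have "(LINT \<omega>|M. cis (u * Z \<omega>)) = (LINT x|distr M lborel (\<lambda>x. Z x / \<sigma>). cis (u * \<sigma> * x))"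
        using s by (subst integral_distr) auto
      also have "\<dots> = char std_normal_distribution (u * \<sigma>)" unfolding eq char_def by (simp add: cis_conv_exp)
      finally show ?thesis by (simp add: char_std_normal_distribution power_mult_distrib)
    qed
    ultimately show ?thesis using var by simp
  qed
  then show "integrable M (\<lambda>\<omega>. (Z \<omega>)\<^sup>2)"
    and "(LINT \<omega>|M. cis (u * Z \<omega>)) = of_real (exp (- (u\<^sup>2 * (LINT \<omega>|M. (Z \<omega>)\<^sup>2)) / 2))" by auto
qed

lemma fourier_tr_integrable:
  assumes "integrable lborel w"
  shows "integrable lborel (\<lambda>t. cis (- u * t) * complex_of_real (w t))"
  by (rule Bochner_Integration.integrable_bound[OF assms]) (use assms in \<open>auto simp: norm_mult\<close>)

lemma fourier_tr_measurable:
  assumes "integrable lborel w"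
  shows "fourier_tr w \<in> borel_measurable borel"
proof -
  have [measurable]: "w \<in> borel_measurable borel" using assms by auto
  show ?thesis unfolding fourier_tr_def by measurable
qed

lemma norm_fourier_tr_le:
  assumes "integrable lborel w"
  shows "norm (fourier_tr w u) \<le> (LINT t|lborel. \<bar>w t\<bar>)"
  unfolding fourier_tr_def
  using fourier_tr_integrable[OF assms] assms by (intro norm_integral_le_integral) (auto simp: norm_mult)

locale spectral_gaussian_process = prob_space M for M :: "'a measure" +
  fixes X :: "real \<Rightarrow> 'a \<Rightarrow> real" and f :: "real \<Rightarrow> real"
  assumes X_meas: "(\<lambda>(t, \<omega>). X t \<omega>) \<in> borel_measurable (lborel \<Otimes>\<^sub>M M)"
    and X_gauss: "gaussian_process M X"
    and X_mean: "\<And>t. integrable M (X t) \<and> expectation (X t) = 0"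
    and X_cov: "\<And>t s. complex_of_real (expectation (\<lambda>\<omega>. X t \<omega> * X s \<omega>)) = (LINT u|lborel. cis (u * (t - s)) * complex_of_real (f u))"
    and X_msc: "\<And>t. ((\<lambda>s. expectation (\<lambda>\<omega>. (X s \<omega> - X t \<omega>)\<^sup>2)) \<longlongrightarrow> 0) (at t)"
    and f_int: "integrable lborel f" and f_nonneg: "\<And>u. f u \<ge> 0"
begin

lemma X_rv [measurable]: "X t \<in> borel_measurable M"
  using measurable_Pair2[OF X_meas, of t] by simp

lemma X_joint [measurable (raw)]:
  assumes "g \<in> measurable N lborel" "k \<in> measurable N M"
  shows "(\<lambda>x. X (g x) (k x)) \<in> borel_measurable N"
  using measurable_compose[OF measurable_Pair[OF assms] X_meas] by simp

lemma combination_gaussian: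
  assumes "finite T"
  shows "real_gaussian_rv M (\<lambda>\<omega>. \<Sum>t\<in>T. c t * X t \<omega>)"
proof -
  obtain ts where ts: "set ts = T" "distinct ts" using finite_distinct_list[OF assms] by blast
  have "(\<Sum>i<length ts. map c ts ! i * X (ts ! i) \<omega>) = (\<Sum>t\<in>T. c t * X t \<omega>)" for \<omega>
  proof -
    have "(\<Sum>i<length ts. map c ts ! i * X (ts ! i) \<omega>) = (\<Sum>i<length ts. map (\<lambda>t. c t * X t \<omega>) ts ! i)"
      by (intro sum.cong) auto
    also have "\<dots> = sum_list (map (\<lambda>t. c t * X t \<omega>) ts)" by (simp add: sum_list_sum_nth atLeast0LessThan)
    also have "\<dots> = (\<Sum>t\<in>T. c t * X t \<omega>)" using ts by (simp add: sum_list_distinct_conv_sum_set)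
    finally show ?thesis .
  qed
  then show ?thesis using X_gauss[unfolded gaussian_process_def, rule_format, of "map c ts" ts] by simp
qed

lemma X_sq: "integrable M (\<lambda>\<omega>. (X t \<omega>)\<^sup>2)"
  using centred_gaussian_rv_cf(1)[OF combination_gaussian[of "{t}" "\<lambda>_. 1"]] X_mean by simp

lemma X_prod: "integrable M (\<lambda>\<omega>. X t \<omega> * X s \<omega>)"
proof (rule Bochner_Integration.integrable_bound)
  show "integrable M (\<lambda>\<omega>. (X t \<omega>)^2 + (X s \<omega>)^2)" by (intro Bochner_Integration.integrable_add X_sq)
  show "AE \<omega> in M. norm (X t \<omega> * X s \<omega>) \<le> norm ((X t \<omega>)^2 + (X s \<omega>)^2)"
    using abs_mult_le_sum_squares by auto
qed simp

text \<open>Expanding the square and inserting \<open>X_cov\<close> term by term gives the variance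
  as a spectral integral, and the variance determines a centred Gaussian law. In this form the
  variance is stable under the limit in \<open>linear_functional_cf\<close>.\<close>

lemma combination_cf:
  assumes T: "finite T"
  shows "(LINT \<omega>|M. cis (\<Sum>t\<in>T. c t * X t \<omega>))
    = of_real (exp (- (LINT u|lborel. f u * (norm (\<Sum>t\<in>T. cis (- u * t) * of_real (c t)))\<^sup>2) / 2))"
proof -
  have [measurable]: "f \<in> borel_measurable borel" using f_int by auto
  have mean: "expectation (\<lambda>\<omega>. \<Sum>t\<in>T. c t * X t \<omega>) = 0"
    using X_mean by (simp add: Bochner_Integration.integral_sum)
  have ci: "integrable lborel (\<lambda>u. cis (u * (t - s)) * complex_of_real (f u))" for t s
    by (rule Bochner_Integration.integrable_bound[OF f_int]) (auto simp: norm_mult)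
  have sq: "of_real ((norm (\<Sum>t\<in>T. cis (- u * t) * of_real (c t)))\<^sup>2) = (\<Sum>t\<in>T. \<Sum>s\<in>T. of_real (c t * c s) * cis (u * (t - s)))" for u
  proof -
    have "of_real ((norm (\<Sum>t\<in>T. cis (- u * t) * of_real (c t)))\<^sup>2)
      = cnj (\<Sum>t\<in>T. cis (- u * t) * of_real (c t)) * (\<Sum>t\<in>T. cis (- u * t) * of_real (c t))"
      unfolding complex_norm_square by (rule mult.commute)
    also have "\<dots> = (\<Sum>t\<in>T. \<Sum>s\<in>T. (cnj (cis (- u * t)) * of_real (c t)) * (cis (- u * s) * of_real (c s)))"
      by (simp add: sum_product)
    also have "\<dots> = (\<Sum>t\<in>T. \<Sum>s\<in>T. of_real (c t * c s) * cis (u * (t - s)))"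
    proof (intro sum.cong refl)
      fix t s
      have "cis (u * (t - s)) = cnj (cis (- u * t)) * cis (- u * s)"
        by (simp add: cis_cnj cis_mult right_diff_distrib)
      then show "(cnj (cis (- u * t)) * of_real (c t)) * (cis (- u * s) * of_real (c s)) = of_real (c t * c s) * cis (u * (t - s))"
        by simp
    qed
    finally show ?thesis .
  qed
  have "complex_of_real (LINT \<omega>|M. (\<Sum>t\<in>T. c t * X t \<omega>)\<^sup>2) = of_real (\<Sum>t\<in>T. \<Sum>s\<in>T. c t * c s * expectation (\<lambda>\<omega>. X t \<omega> * X s \<omega>))"
  proof -
    have "(LINT \<omega>|M. (\<Sum>t\<in>T. c t * X t \<omega>)\<^sup>2) = (LINT \<omega>|M. (\<Sum>t\<in>T. \<Sum>s\<in>T. (c t * c s) * (X t \<omega> * X s \<omega>)))"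
      by (simp add: power2_eq_square sum_product ac_simps)
    also have "\<dots> = (\<Sum>t\<in>T. \<Sum>s\<in>T. c t * c s * expectation (\<lambda>\<omega>. X t \<omega> * X s \<omega>))"
      using X_prod by (simp add: Bochner_Integration.integral_sum)
    finally show ?thesis by simp
  qed
  also have "\<dots> = (\<Sum>t\<in>T. \<Sum>s\<in>T. of_real (c t * c s) * (LINT u|lborel. cis (u * (t - s)) * complex_of_real (f u)))"
    by (simp add: X_cov)
  also have "\<dots> = (LINT u|lborel. (\<Sum>t\<in>T. \<Sum>s\<in>T. of_real (c t * c s) * (cis (u * (t - s)) * complex_of_real (f u))))"
    using ci by (simp add: Bochner_Integration.integral_sum)
  also have "\<dots> = (LINT u|lborel. complex_of_real (f u * (norm (\<Sum>t\<in>T. cis (- u * t) * of_real (c t)))\<^sup>2))"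
    unfolding of_real_mult[of "f _"] sq by (intro Bochner_Integration.integral_cong refl) (simp add: sum_distrib_left ac_simps)
  also have "\<dots> = of_real (LINT u|lborel. f u * (norm (\<Sum>t\<in>T. cis (- u * t) * of_real (c t)))\<^sup>2)"
    by (rule integral_complex_of_real)
  finally have "(LINT \<omega>|M. (\<Sum>t\<in>T. c t * X t \<omega>)\<^sup>2) = (LINT u|lborel. f u * (norm (\<Sum>t\<in>T. cis (- u * t) * of_real (c t)))\<^sup>2)"
    unfolding of_real_eq_iff .
  then show ?thesis using centred_gaussian_rv_cf(2)[OF combination_gaussian[OF T, of c] mean, of 1] by simp
qed

text \<open>The variance of |Z| is nonnegative.\<close>

lemma abs_mean_le: assumes [measurable]: "Z \<in> borel_measurable M" and Z: "integrable M (\<lambda>\<omega>. (Z \<omega>)\<^sup>2)"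
  shows "integrable M Z" "(LINT \<omega>|M. \<bar>Z \<omega>\<bar>) \<le> sqrt (LINT \<omega>|M. (Z \<omega>)\<^sup>2)"
proof -
  show i: "integrable M Z"
  proof (rule Bochner_Integration.integrable_bound)
    show "integrable M (\<lambda>\<omega>. 1 + (Z \<omega>)\<^sup>2)" using Z by simp
    have "\<bar>x\<bar> \<le> 1 + x\<^sup>2" for x :: real
      using zero_le_power2[of "\<bar>x\<bar> - 1"] by (simp add: power2_diff)
    then show "AE \<omega> in M. norm (Z \<omega>) \<le> norm (1 + (Z \<omega>)\<^sup>2)" by auto
  qed simp
  have "0 \<le> variance (\<lambda>\<omega>. \<bar>Z \<omega>\<bar>)" by (rule variance_positive)
  also have "\<dots> = expectation (\<lambda>\<omega>. \<bar>Z \<omega>\<bar>\<^sup>2) - (expectation (\<lambda>\<omega>. \<bar>Z \<omega>\<bar>))\<^sup>2"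
    using i Z by (intro variance_eq) auto
  finally show "(LINT \<omega>|M. \<bar>Z \<omega>\<bar>) \<le> sqrt (LINT \<omega>|M. (Z \<omega>)\<^sup>2)"
    by (intro real_le_rsqrt) simp
qed

text \<open>The standard deviation common to all \<open>X t\<close>; it bounds their first absolute
  moments uniformly in time.\<close>

definition r0 :: real where "r0 = sqrt (LINT u|lborel. f u)"

lemma X_abs: "integrable M (\<lambda>\<omega>. \<bar>X t \<omega>\<bar>)" "(LINT \<omega>|M. \<bar>X t \<omega>\<bar>) \<le> r0"
proof -
  have "complex_of_real (expectation (\<lambda>\<omega>. X t \<omega> * X t \<omega>)) = of_real (LINT u|lborel. f u)"
    unfolding X_cov by (simp)
  then have "expectation (\<lambda>\<omega>. (X t \<omega>)\<^sup>2) = (LINT u|lborel. f u)"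
    unfolding of_real_eq_iff by (simp add: power2_eq_square)
  then show "(LINT \<omega>|M. \<bar>X t \<omega>\<bar>) \<le> r0" using abs_mean_le(2)[OF _ X_sq[of t]] by (simp add: r0_def)
  show "integrable M (\<lambda>\<omega>. \<bar>X t \<omega>\<bar>)" using abs_mean_le(1)[OF _ X_sq[of t]] by simp
qed

sublocale LP: pair_sigma_finite lborel M ..

text \<open>Since the first absolute moments are at most \<open>r0\<close>, Fubini's condition
  reduces to integrability of \<open>w\<close>. The free time change \<open>g\<close> serves both
  the process and its sampled versions.\<close>

lemma kernel_integrable:
  assumes w: "integrable lborel w" and g [measurable]: "g \<in> borel_measurable borel"
  shows "integrable (lborel \<Otimes>\<^sub>M M) (\<lambda>(t, \<omega>). w t * X (g t) \<omega>)"
proof (rule LP.Fubini_integrable)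
  have [measurable]: "w \<in> borel_measurable borel" using w by auto
  show "(\<lambda>(t, \<omega>). w t * X (g t) \<omega>) \<in> borel_measurable (lborel \<Otimes>\<^sub>M M)" by measurable
  show "AE x in lborel. integrable M (\<lambda>y. case (x, y) of (t, \<omega>) \<Rightarrow> w t * X (g t) \<omega>)"
    using X_mean by auto
  show "integrable lborel (\<lambda>x. LINT y|M. norm (case (x, y) of (t, \<omega>) \<Rightarrow> w t * X (g t) \<omega>))"
  proof (rule Bochner_Integration.integrable_bound)
    show "integrable lborel (\<lambda>t. r0 * w t)" using w by simp
    show "AE t in lborel. norm (LINT y|M. norm (case (t, y) of (t, \<omega>) \<Rightarrow> w t * X (g t) \<omega>)) \<le> norm (r0 * w t)"
    proof (rule AE_I2)
      fix t
      have r0: "r0 \<ge> 0" unfolding r0_def using f_nonneg by (auto intro!: integral_nonneg_AE)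
      have "(LINT y|M. norm (case (t, y) of (t, \<omega>) \<Rightarrow> w t * X (g t) \<omega>)) = \<bar>w t\<bar> * (LINT \<omega>|M. \<bar>X (g t) \<omega>\<bar>)"
        by (simp add: abs_mult)
      moreover have "\<dots> \<le> \<bar>w t\<bar> * r0" by (intro mult_left_mono X_abs) auto
      ultimately show "norm (LINT y|M. norm (case (t, y) of (t, \<omega>) \<Rightarrow> w t * X (g t) \<omega>)) \<le> norm (r0 * w t)"
        using r0 by (simp add: abs_mult mult.commute)
    qed
  qed measurable
qed

lemma kernel_AE:
  assumes w: "integrable lborel w"
  shows "AE \<omega> in M. integrable lborel (\<lambda>t. w t * X t \<omega>)"
  using LP.AE_integrable_snd[OF kernel_integrable[OF w, of "\<lambda>t. t"]] by simp

lemma kernel_measurable: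
  assumes w: "integrable lborel w"
  shows "(\<lambda>\<omega>. LINT t|lborel. w t * X t \<omega>) \<in> borel_measurable M"
proof -
  have [measurable]: "w \<in> borel_measurable borel" using w by auto
  show ?thesis by measurable
qed

text \<open>Sampling the process at times F i t, where the simple functions \<open>F i\<close>
  converge to the identity, turns the functional into a finite combination covered by
  \<open>combination_cf\<close>. Mean-square continuity gives convergence in mean of the
  functionals, and dominated convergence handles the spectral integrals.\<close>

theorem linear_functional_cf:
  assumes w: "integrable lborel w"
  shows "(LINT \<omega>|M. cis (LINT t|lborel. w t * X t \<omega>))
     = of_real (exp (- (LINT u|lborel. f u * (norm (fourier_tr w u))\<^sup>2) / 2))"
proof -
  have [measurable]: "w \<in> borel_measurable borel" "f \<in> borel_measurable borel" using w f_int by auto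
  obtain F :: "nat \<Rightarrow> real \<Rightarrow> real" where F: "\<And>i. simple_function lborel (F i)" "\<And>t. (\<lambda>i. F i t) \<longlonglongrightarrow> t"
    using borel_measurable_implies_sequence_metric[of "\<lambda>t::real. t" lborel 0] by auto
  have [measurable]: "F i \<in> borel_measurable borel" for i
    using borel_measurable_simple_function[OF F(1)] by simp
  have fin: "finite (range (F i))" for i using simple_functionD(1)[OF F(1), of i] by simp
  define c where "c i s = (LINT t|lborel. w t * indicator (F i -` {s}) t)" for i s
  have ind [measurable]: "F i -` {s} \<in> sets borel" for i s
    using measurable_sets[of "F i" borel borel "{s}"] by simp
  have wi: "integrable lborel (\<lambda>t. w t * indicator (F i -` {s}) t)" for i s
    by (rule integrable_real_mult_indicator[OF _ w, unfolded mult.commute[of _ "w _"]]) simp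
  have simple_sum: "(\<Sum>s\<in>range (F i). indicator (F i -` {s}) t *\<^sub>R G s) = G (F i t)" for i t and G :: "real \<Rightarrow> 'z::real_vector"
  proof -
    have "(\<Sum>s\<in>range (F i). indicator (F i -` {s}) t *\<^sub>R G s) = (\<Sum>s\<in>range (F i). if s = F i t then G s else 0)"
      by (intro sum.cong) (auto simp: indicator_def)
    then show ?thesis using fin by simp
  qed
  define L where "L \<omega> = (LINT t|lborel. w t * X t \<omega>)" for \<omega>
  define Ln where "Ln i \<omega> = (\<Sum>s\<in>range (F i). c i s * X s \<omega>)" for i \<omega>
  have [measurable]: "L \<in> borel_measurable M" "Ln i \<in> borel_measurable M" for i
    unfolding L_def Ln_def using kernel_measurable[OF w] by auto
  have Ln_int: "integrable lborel (\<lambda>t. w t * X (F i t) \<omega>)" "Ln i \<omega> = (LINT t|lborel. w t * X (F i t) \<omega>)" for i \<omega>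
  proof -
    have e: "w t * X (F i t) \<omega> = (\<Sum>s\<in>range (F i). (w t * indicator (F i -` {s}) t) * X s \<omega>)" for t
      using simple_sum[of i t "\<lambda>s. w t * X s \<omega>"] by (simp add: ac_simps)
    show "integrable lborel (\<lambda>t. w t * X (F i t) \<omega>)" unfolding e using wi by simp
    show "Ln i \<omega> = (LINT t|lborel. w t * X (F i t) \<omega>)" unfolding e Ln_def c_def using wi by (simp add: Bochner_Integration.integral_sum)
  qed
  \<comment> \<open>At s = t the expectation is 0, so the punctured limit in \<open>X_msc\<close>
    amounts to continuity. This matters because \<open>F i t\<close> may be equal to
    \<open>t\<close>.\<close>
  have msc: "(\<lambda>i. LINT \<omega>|M. \<bar>X t \<omega> - X (F i t) \<omega>\<bar>) \<longlonglongrightarrow> 0" for t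
  proof (rule tendsto_sandwich[where f="\<lambda>_. 0"])
    have "isCont (\<lambda>s. expectation (\<lambda>\<omega>. (X s \<omega> - X t \<omega>)\<^sup>2)) t" unfolding isCont_def using X_msc by simp
    from isCont_tendsto_compose[OF this F(2)[of t]]
    have "(\<lambda>i. expectation (\<lambda>\<omega>. (X (F i t) \<omega> - X t \<omega>)\<^sup>2)) \<longlonglongrightarrow> 0" by simp
    then have "(\<lambda>i. expectation (\<lambda>\<omega>. (X t \<omega> - X (F i t) \<omega>)\<^sup>2)) \<longlonglongrightarrow> 0" by (simp add: power2_commute)
    from tendsto_real_sqrt[OF this] show "(\<lambda>i. sqrt (expectation (\<lambda>\<omega>. (X t \<omega> - X (F i t) \<omega>)\<^sup>2))) \<longlonglongrightarrow> 0" by simp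
    have "integrable M (\<lambda>\<omega>. (X t \<omega> - X s \<omega>)\<^sup>2)" for s
      using X_sq[of t] X_sq[of s] X_prod[of t s] by (simp add: power2_diff mult.assoc)
    then show "\<forall>\<^sub>F i in sequentially. (LINT \<omega>|M. \<bar>X t \<omega> - X (F i t) \<omega>\<bar>) \<le> sqrt (expectation (\<lambda>\<omega>. (X t \<omega> - X (F i t) \<omega>)\<^sup>2))"
      by (intro always_eventually allI abs_mean_le(2)) auto
  qed auto
  have diff_int: "integrable (lborel \<Otimes>\<^sub>M M) (\<lambda>(t, \<omega>). w t * (X t \<omega> - X (F i t) \<omega>))" for i
    using Bochner_Integration.integrable_diff[OF kernel_integrable[OF w, of "\<lambda>t. t"] kernel_integrable[OF w, of "F i"]]
    by (simp add: case_prod_unfold right_diff_distrib)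
  \<comment> \<open>By Fubini the distance of the functionals is at most the integral of |w| against
    the distance of process and samples, which has the dominating function 2 r0 |w|.\<close>
  have L1: "(\<lambda>i. LINT \<omega>|M. \<bar>L \<omega> - Ln i \<omega>\<bar>) \<longlonglongrightarrow> 0"
  proof (rule tendsto_sandwich[where f="\<lambda>_. 0"])
    have "(\<lambda>i. LINT t|lborel. \<bar>w t\<bar> * (LINT \<omega>|M. \<bar>X t \<omega> - X (F i t) \<omega>\<bar>)) \<longlonglongrightarrow> (LINT t|(lborel :: real measure). 0)"
    proof (rule integral_dominated_convergence[where w="\<lambda>t. 2 * r0 * \<bar>w t\<bar>"])
      show "integrable lborel (\<lambda>t. 2 * r0 * \<bar>w t\<bar>)" using w by simp
      show "AE t in lborel. (\<lambda>i. \<bar>w t\<bar> * (LINT \<omega>|M. \<bar>X t \<omega> - X (F i t) \<omega>\<bar>)) \<longlonglongrightarrow> 0"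
        by (intro AE_I2 tendsto_mult_right_zero msc)
      show "AE t in lborel. norm (\<bar>w t\<bar> * (LINT \<omega>|M. \<bar>X t \<omega> - X (F i t) \<omega>\<bar>)) \<le> 2 * r0 * \<bar>w t\<bar>" for i
      proof (rule AE_I2)
        fix t
        have "(LINT \<omega>|M. \<bar>X t \<omega> - X (F i t) \<omega>\<bar>) \<le> (LINT \<omega>|M. \<bar>X t \<omega>\<bar> + \<bar>X (F i t) \<omega>\<bar>)"
          using X_mean X_abs by (intro integral_mono) auto
        also have "\<dots> \<le> r0 + r0" using X_abs(1) X_abs(2)[of t] X_abs(2)[of "F i t"] by simp
        finally have "\<bar>w t\<bar> * (LINT \<omega>|M. \<bar>X t \<omega> - X (F i t) \<omega>\<bar>) \<le> \<bar>w t\<bar> * (r0 + r0)" by (intro mult_left_mono) auto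
        moreover have "(LINT \<omega>|M. \<bar>X t \<omega> - X (F i t) \<omega>\<bar>) \<ge> 0" by simp
        ultimately show "norm (\<bar>w t\<bar> * (LINT \<omega>|M. \<bar>X t \<omega> - X (F i t) \<omega>\<bar>)) \<le> 2 * r0 * \<bar>w t\<bar>"
          by (simp add: abs_mult algebra_simps)
      qed
    qed measurable
    then show "(\<lambda>i. LINT t|lborel. \<bar>w t\<bar> * (LINT \<omega>|M. \<bar>X t \<omega> - X (F i t) \<omega>\<bar>)) \<longlonglongrightarrow> 0" by simp
    show "\<forall>\<^sub>F i in sequentially. (LINT \<omega>|M. \<bar>L \<omega> - Ln i \<omega>\<bar>) \<le> (LINT t|lborel. \<bar>w t\<bar> * (LINT \<omega>|M. \<bar>X t \<omega> - X (F i t) \<omega>\<bar>))"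
    proof (intro always_eventually allI)
      fix i
      have ni: "integrable (lborel \<Otimes>\<^sub>M M) (\<lambda>(t, \<omega>). \<bar>w t * (X t \<omega> - X (F i t) \<omega>)\<bar>)"
        using integrable_norm[OF diff_int[of i]] by (simp add: case_prod_unfold)
      have "(LINT \<omega>|M. \<bar>L \<omega> - Ln i \<omega>\<bar>) = (LINT \<omega>|M. \<bar>LINT t|lborel. w t * (X t \<omega> - X (F i t) \<omega>)\<bar>)"
      proof (rule integral_cong_AE)
        show "AE \<omega> in M. \<bar>L \<omega> - Ln i \<omega>\<bar> = \<bar>LINT t|lborel. w t * (X t \<omega> - X (F i t) \<omega>)\<bar>"
          using kernel_AE[OF w]
        proof eventually_elim
          case (elim \<omega>)
          then show ?case using Ln_int[of i \<omega>] by (simp add: L_def right_diff_distrib)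
        qed
      qed measurable
      also have "\<dots> \<le> (LINT \<omega>|M. LINT t|lborel. \<bar>w t * (X t \<omega> - X (F i t) \<omega>)\<bar>)"
      proof (rule integral_mono)
        show "integrable M (\<lambda>\<omega>. \<bar>LINT t|lborel. w t * (X t \<omega> - X (F i t) \<omega>)\<bar>)"
          using LP.integrable_snd[OF diff_int[of i]] by simp
        show "integrable M (\<lambda>\<omega>. LINT t|lborel. \<bar>w t * (X t \<omega> - X (F i t) \<omega>)\<bar>)"
          using LP.integrable_snd[OF ni] by simp
        show "\<bar>LINT t|lborel. w t * (X t \<omega> - X (F i t) \<omega>)\<bar> \<le> (LINT t|lborel. \<bar>w t * (X t \<omega> - X (F i t) \<omega>)\<bar>)" for \<omega>
          by (rule integral_abs_bound)
      qed
      also have "\<dots> = (LINT t|lborel. LINT \<omega>|M. \<bar>w t * (X t \<omega> - X (F i t) \<omega>)\<bar>)"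
        by (rule LP.Fubini_integral[OF ni])
      also have "\<dots> = (LINT t|lborel. \<bar>w t\<bar> * (LINT \<omega>|M. \<bar>X t \<omega> - X (F i t) \<omega>\<bar>))"
        by (simp add: abs_mult)
      finally show "(LINT \<omega>|M. \<bar>L \<omega> - Ln i \<omega>\<bar>) \<le> (LINT t|lborel. \<bar>w t\<bar> * (LINT \<omega>|M. \<bar>X t \<omega> - X (F i t) \<omega>\<bar>))" .
    qed
  qed auto
  have LLn_int: "integrable M (\<lambda>\<omega>. L \<omega> - Ln i \<omega>)" for i
  proof -
    have "integrable M L" unfolding L_def using LP.integrable_snd[OF kernel_integrable[OF w, of "\<lambda>t. t"]] by simp
    moreover have "integrable M (Ln i)" unfolding Ln_def using X_mean by simp
    ultimately show ?thesis by simp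
  qed
  have "(\<lambda>i. (LINT \<omega>|M. cis (Ln i \<omega>)) - (LINT \<omega>|M. cis (L \<omega>))) \<longlonglongrightarrow> 0"
  proof (rule Lim_null_comparison[OF _ L1], intro always_eventually allI)
    fix i
    have ii: "integrable M (\<lambda>\<omega>. cis (Ln i \<omega>))" "integrable M (\<lambda>\<omega>. cis (L \<omega>))"
      by (auto intro!: integrable_cis finite_measure_axioms)
    then have "(LINT \<omega>|M. cis (Ln i \<omega>)) - (LINT \<omega>|M. cis (L \<omega>)) = (LINT \<omega>|M. cis (Ln i \<omega>) - cis (L \<omega>))" by simp
    also have "norm \<dots> \<le> (LINT \<omega>|M. \<bar>L \<omega> - Ln i \<omega>\<bar>)"
    proof (rule norm_integral_le_integral)
      show "norm (cis (Ln i \<omega>) - cis (L \<omega>)) \<le> \<bar>L \<omega> - Ln i \<omega>\<bar>" for \<omega>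
        using cis_diff_bound[of "Ln i \<omega>" "L \<omega>"] by (simp add: abs_minus_commute)
    qed (use ii LLn_int in auto)
    finally show "norm ((LINT \<omega>|M. cis (Ln i \<omega>)) - (LINT \<omega>|M. cis (L \<omega>))) \<le> (LINT \<omega>|M. \<bar>L \<omega> - Ln i \<omega>\<bar>)" .
  qed
  then have lim1: "(\<lambda>i. LINT \<omega>|M. cis (Ln i \<omega>)) \<longlonglongrightarrow> (LINT \<omega>|M. cis (L \<omega>))" by (simp add: LIM_zero_iff)
  have trig: "(\<Sum>s\<in>range (F i). cis (- u * s) * of_real (c i s)) = (LINT t|lborel. cis (- u * F i t) * complex_of_real (w t))" for i u
  proof -
    have e: "cis (- u * F i t) * complex_of_real (w t) = (\<Sum>s\<in>range (F i). cis (- u * s) * complex_of_real (w t * indicator (F i -` {s}) t))" for t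
      using simple_sum[of i t "\<lambda>s. cis (- u * s) * complex_of_real (w t)"] by (simp add: scaleR_conv_of_real ac_simps)
    show ?thesis unfolding e c_def using wi
      by (subst Bochner_Integration.integral_sum) (auto simp del: of_real_mult simp: integral_complex_of_real)
  qed
  have trig_lim: "(\<lambda>i. LINT t|lborel. cis (- u * F i t) * complex_of_real (w t)) \<longlonglongrightarrow> fourier_tr w u" for u
    unfolding fourier_tr_def
  proof (rule integral_dominated_convergence[where w="\<lambda>t. \<bar>w t\<bar>"])
    show "AE t in lborel. (\<lambda>i. cis (- u * F i t) * complex_of_real (w t)) \<longlonglongrightarrow> cis (- u * t) * complex_of_real (w t)"
      by (intro AE_I2 tendsto_mult tendsto_const isCont_tendsto_compose[OF isCont_cis_real] F(2))
  qed (use w in \<open>auto simp: norm_mult\<close>)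
  have trig_bound: "norm (LINT t|lborel. cis (- u * F i t) * complex_of_real (w t)) \<le> (LINT t|lborel. \<bar>w t\<bar>)" for u i
  proof (rule norm_integral_le_integral)
    show "integrable lborel (\<lambda>t. cis (- u * F i t) * complex_of_real (w t))"
      by (rule Bochner_Integration.integrable_bound[OF w]) (auto simp: norm_mult)
  qed (use w in \<open>auto simp: norm_mult\<close>)
  have "(\<lambda>i. LINT u|lborel. f u * (norm (LINT t|lborel. cis (- u * F i t) * complex_of_real (w t)))\<^sup>2)
     \<longlonglongrightarrow> (LINT u|lborel. f u * (norm (fourier_tr w u))\<^sup>2)"
  proof (rule integral_dominated_convergence[where w="\<lambda>u. f u * (LINT t|lborel. \<bar>w t\<bar>)\<^sup>2"])
    show "(\<lambda>u. f u * (norm (fourier_tr w u))\<^sup>2) \<in> borel_measurable lborel" using fourier_tr_measurable[OF w] by measurable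
    show "AE u in lborel. (\<lambda>i. f u * (norm (LINT t|lborel. cis (- u * F i t) * complex_of_real (w t)))\<^sup>2) \<longlonglongrightarrow> f u * (norm (fourier_tr w u))\<^sup>2"
      by (intro AE_I2 tendsto_intros trig_lim)
    show "AE u in lborel. norm (f u * (norm (LINT t|lborel. cis (- u * F i t) * complex_of_real (w t)))\<^sup>2) \<le> f u * (LINT t|lborel. \<bar>w t\<bar>)\<^sup>2" for i
      using f_nonneg trig_bound by (intro AE_I2) (auto simp: abs_mult intro!: mult_left_mono power_mono)
  qed (use f_int in \<open>auto\<close>)
  then have "(\<lambda>i. LINT \<omega>|M. cis (Ln i \<omega>)) \<longlonglongrightarrow> of_real (exp (- (LINT u|lborel. f u * (norm (fourier_tr w u))\<^sup>2) / 2))"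
    unfolding Ln_def combination_cf[OF fin] trig by (intro tendsto_intros) auto
  from LIMSEQ_unique[OF lim1 this] show ?thesis unfolding L_def .
qed

text \<open>A weighted sum of functionals is the functional of the weighted sum of kernels, so
  \<open>linear_functional_cf\<close> gives every joint characteristic function. The rearrangement
  holds only almost surely, because paths are integrable against a kernel only almost
  surely.\<close>

lemma gaussian_family_functionals:
  assumes fin: "finite I" and w: "\<And>k. k \<in> I \<Longrightarrow> integrable lborel (w k)"
  shows "gaussian_family M I (\<lambda>k \<omega>. LINT t|lborel. w k t * X t \<omega>)
     (\<lambda>k l. LINT u|lborel. f u * Re (fourier_tr (w k) u * cnj (fourier_tr (w l) u)))"
proof (unfold_locales)
  show "(LINT u|lborel. f u * Re (fourier_tr (w k) u * cnj (fourier_tr (w l) u)))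
     = (LINT u|lborel. f u * Re (fourier_tr (w l) u * cnj (fourier_tr (w k) u)))" for k l
    by (intro Bochner_Integration.integral_cong refl) simp
  show "(\<lambda>\<omega>. LINT t|lborel. w k t * X t \<omega>) \<in> borel_measurable M" if "k \<in> I" for k
    using w[OF that] by (rule kernel_measurable)
  fix v :: "'b \<Rightarrow> real"
  have [measurable]: "f \<in> borel_measurable borel" using f_int by auto
  have wv: "integrable lborel (\<lambda>t. \<Sum>k\<in>I. v k * w k t)" using w by simp
  have "(LINT \<omega>|M. cis (\<Sum>k\<in>I. v k * (LINT t|lborel. w k t * X t \<omega>)))
     = (LINT \<omega>|M. cis (LINT t|lborel. (\<Sum>k\<in>I. v k * w k t) * X t \<omega>))"
  proof (rule integral_cong_AE)
    have "AE \<omega> in M. \<forall>k\<in>I. integrable lborel (\<lambda>t. w k t * X t \<omega>)"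
      using fin kernel_AE[OF w] by (simp add: AE_ball_countable countable_finite)
    then show "AE \<omega> in M. cis (\<Sum>k\<in>I. v k * (LINT t|lborel. w k t * X t \<omega>)) = cis (LINT t|lborel. (\<Sum>k\<in>I. v k * w k t) * X t \<omega>)"
    proof eventually_elim
      case (elim \<omega>)
      have "(LINT t|lborel. (\<Sum>k\<in>I. v k * w k t) * X t \<omega>) = (LINT t|lborel. (\<Sum>k\<in>I. v k * (w k t * X t \<omega>)))"
        by (simp add: sum_distrib_right mult.assoc)
      also have "\<dots> = (\<Sum>k\<in>I. v k * (LINT t|lborel. w k t * X t \<omega>))"
        using elim by (subst Bochner_Integration.integral_sum) auto
      finally show ?case by simp
    qed
    show "(\<lambda>\<omega>. cis (\<Sum>k\<in>I. v k * (LINT t|lborel. w k t * X t \<omega>))) \<in> borel_measurable M"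
      using kernel_measurable[OF w] by measurable
    show "(\<lambda>\<omega>. cis (LINT t|lborel. (\<Sum>k\<in>I. v k * w k t) * X t \<omega>)) \<in> borel_measurable M"
      using kernel_measurable[OF wv] by measurable
  qed
  also have "\<dots> = of_real (exp (- (LINT u|lborel. f u * (norm (fourier_tr (\<lambda>t. \<Sum>k\<in>I. v k * w k t) u))\<^sup>2) / 2))"
    by (rule linear_functional_cf[OF wv])
  also have "(LINT u|lborel. f u * (norm (fourier_tr (\<lambda>t. \<Sum>k\<in>I. v k * w k t) u))\<^sup>2)
     = (LINT u|lborel. (\<Sum>k\<in>I. \<Sum>l\<in>I. v k * v l * (f u * Re (fourier_tr (w k) u * cnj (fourier_tr (w l) u)))))"
  proof (intro Bochner_Integration.integral_cong refl)
    fix u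
    have ft: "fourier_tr (\<lambda>t. \<Sum>k\<in>I. v k * w k t) u = (\<Sum>k\<in>I. of_real (v k) * fourier_tr (w k) u)"
    proof -
      have "fourier_tr (\<lambda>t. \<Sum>k\<in>I. v k * w k t) u = (LINT t|lborel. (\<Sum>k\<in>I. of_real (v k) * (cis (- u * t) * complex_of_real (w k t))))"
        unfolding fourier_tr_def by (intro Bochner_Integration.integral_cong refl) (simp add: sum_distrib_left ac_simps)
      also have "\<dots> = (\<Sum>k\<in>I. of_real (v k) * fourier_tr (w k) u)"
        unfolding fourier_tr_def using fourier_tr_integrable[OF w]
        by (subst Bochner_Integration.integral_sum) auto
      finally show ?thesis .
    qed
    have "(norm (fourier_tr (\<lambda>t. \<Sum>k\<in>I. v k * w k t) u))\<^sup>2 = Re (fourier_tr (\<lambda>t. \<Sum>k\<in>I. v k * w k t) u * cnj (fourier_tr (\<lambda>t. \<Sum>k\<in>I. v k * w k t) u))"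
      unfolding complex_norm_square[symmetric] by simp
    also have "\<dots> = Re (\<Sum>k\<in>I. \<Sum>l\<in>I. of_real (v k * v l) * (fourier_tr (w k) u * cnj (fourier_tr (w l) u)))"
      unfolding ft by (simp add: sum_product ac_simps)
    also have "\<dots> = (\<Sum>k\<in>I. \<Sum>l\<in>I. v k * v l * Re (fourier_tr (w k) u * cnj (fourier_tr (w l) u)))"
    proof -
      have "Re (of_real a * z) = a * Re z" for a z by simp
      then show ?thesis by (simp only: Re_sum)
    qed
    finally show "f u * (norm (fourier_tr (\<lambda>t. \<Sum>k\<in>I. v k * w k t) u))\<^sup>2 = (\<Sum>k\<in>I. \<Sum>l\<in>I. v k * v l * (f u * Re (fourier_tr (w k) u * cnj (fourier_tr (w l) u))))"
      by (simp add: sum_distrib_left ac_simps)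
  qed
  also have "\<dots> = (\<Sum>k\<in>I. \<Sum>l\<in>I. v k * v l * (LINT u|lborel. f u * Re (fourier_tr (w k) u * cnj (fourier_tr (w l) u))))"
  proof -
    have "integrable lborel (\<lambda>u. f u * Re (fourier_tr (w k) u * cnj (fourier_tr (w l) u)))" if kl: "k \<in> I" "l \<in> I" for k l
    proof (rule Bochner_Integration.integrable_bound)
      have [measurable]: "cnj \<in> borel_measurable borel" by (intro borel_measurable_continuous_onI continuous_intros)
      note fourier_tr_measurable[OF w[OF kl(1)], measurable] fourier_tr_measurable[OF w[OF kl(2)], measurable]
      show "(\<lambda>u. f u * Re (fourier_tr (w k) u * cnj (fourier_tr (w l) u))) \<in> borel_measurable lborel" by measurable
      let ?K = "(LINT t|lborel. \<bar>w k t\<bar>) * (LINT t|lborel. \<bar>w l t\<bar>)"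
      show "integrable lborel (\<lambda>u. f u * ?K)" using f_int by simp
      have "\<bar>Re (fourier_tr (w k) u * cnj (fourier_tr (w l) u))\<bar> \<le> ?K" for u
      proof -
        have "\<bar>Re (fourier_tr (w k) u * cnj (fourier_tr (w l) u))\<bar> \<le> norm (fourier_tr (w k) u) * norm (fourier_tr (w l) u)"
          using abs_Re_le_cmod[of "fourier_tr (w k) u * cnj (fourier_tr (w l) u)"] by (simp add: norm_mult)
        also have "\<dots> \<le> ?K" using kl by (intro mult_mono norm_fourier_tr_le w) auto
        finally show ?thesis .
      qed
      then show "AE u in lborel. norm (f u * Re (fourier_tr (w k) u * cnj (fourier_tr (w l) u))) \<le> norm (f u * ?K)"
        unfolding real_norm_def abs_mult[of "f _"] by (intro AE_I2 mult_left_mono order_trans[OF _ abs_ge_self]) (auto simp: f_nonneg)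
    qed
    then show ?thesis by (simp add: Bochner_Integration.integral_sum)
  qed
  finally show "(LINT \<omega>|M. cis (\<Sum>k\<in>I. v k * (LINT t|lborel. w k t * X t \<omega>)))
    = of_real (exp (- (\<Sum>k\<in>I. \<Sum>l\<in>I. v k * v l * (LINT u|lborel. f u * Re (fourier_tr (w k) u * cnj (fourier_tr (w l) u)))) / 2))" .
qed (rule fin)

end

subsection \<open>Toeplitz forms on the circle\<close>

text \<open>Lebesgue measure on the circle with total mass 2 pi, not normalised: Fourier
  coefficients carry no prefactor, and powers of 2 pi appear in the limits instead.\<close>

definition circ :: "real measure" where "circ = density lborel (indicator {-pi..pi})"

lemma sets_circ [measurable_cong, simp]: "sets circ = sets borel" by (simp add: circ_def)
lemma space_circ [simp]: "space circ = UNIV" by (simp add: circ_def)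

lemma circ_alt: "circ = density lborel (\<lambda>x. ennreal (indicator {-pi..pi} x))"
  unfolding circ_def by (intro arg_cong[where f="density lborel"] ext) (auto simp: indicator_def)

lemma circ_integral:
  fixes f :: "real \<Rightarrow> 'b::{banach, second_countable_topology}"
  assumes "f \<in> borel_measurable borel"
  shows "(LINT x|circ. f x) = (LINT x|lborel. indicator {-pi..pi} x *\<^sub>R f x)"
  unfolding circ_alt using assms by (subst integral_density) auto

lemma emeasure_circ: "emeasure circ UNIV = ennreal (2 * pi)"
  unfolding circ_def by (subst emeasure_density) (auto simp: algebra_simps)

interpretation circ: finite_measure circ
  by (rule finite_measureI) (simp add: emeasure_circ)

lemma measure_circ: "measure circ UNIV = 2 * pi"
  by (simp add: measure_def emeasure_circ)

text \<open>The endpoints are null. They have to be avoided in \<open>toeplitz_limit\<close>: there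
  the Fejer mass splits between both ends of the interval and pointwise convergence can
  fail.\<close>

lemma AE_circ_interior: assumes "\<And>x. - pi < x \<Longrightarrow> x < pi \<Longrightarrow> P x" shows "AE x in circ. P x"
proof -
  have "AE x in lborel. x \<noteq> pi" "AE x in lborel. x \<noteq> - pi" by (auto intro: AE_lborel_singleton)
  then have "AE x in lborel. 0 < (indicator {-pi..pi} x :: ennreal) \<longrightarrow> P x"
    by eventually_elim (auto simp: indicator_def intro!: assms split: if_splits)
  then show ?thesis unfolding circ_def by (subst AE_density) auto
qed

lemma AE_circ: assumes "\<And>x. x \<in> {-pi..pi} \<Longrightarrow> P x" shows "AE x in circ. P x"
  by (rule AE_circ_interior) (auto intro: assms)

lemma circ_integral_cos:
  fixes n :: int
  shows "(LINT x|circ. cos (of_int n * (\<theta> - x))) = (if n = 0 then 2 * pi else 0)"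
proof (cases "n = 0")
  case True then show ?thesis by (simp add: measure_circ)
next
  case False
  have "(LINT x|circ. cos (of_int n * (\<theta> - x))) = (LINT x|lborel. indicator {-pi..pi} x *\<^sub>R cos (of_int n * (\<theta> - x)))"
    by (rule circ_integral) simp
  also have "\<dots> = - sin (of_int n * (\<theta> - pi)) / of_int n - - sin (of_int n * (\<theta> - - pi)) / of_int n"
  proof (rule integral_FTC_Icc)
    show "((\<lambda>x. - sin (of_int n * (\<theta> - x)) / of_int n) has_vector_derivative cos (of_int n * (\<theta> - x))) (at x within {-pi..pi})" for x
      unfolding has_real_derivative_iff_has_vector_derivative[symmetric]
      using False by (auto intro!: derivative_eq_intros)
    show "continuous_on {-pi..pi} (\<lambda>x. cos (of_int n * (\<theta> - x)))" by (intro continuous_intros)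
  qed simp
  also have "sin (of_int n * (\<theta> - - pi)) = sin (of_int n * (\<theta> - pi))"
  proof -
    have "of_int n * (\<theta> - - pi) = of_int n * (\<theta> - pi) + of_int n * (2 * pi)" by (simp add: algebra_simps)
    then show ?thesis by (simp add: sin_add mult.commute[of "of_int n" "2 * pi"] sin_int_2pin cos_int_2pin)
  qed
  finally show ?thesis using False by simp
qed

text \<open>The Fejer kernel, without division by 2 pi. The double sum matches the index set of the
  Toeplitz sums; \<open>fejer_alt\<close> gives the usual squared modulus.\<close>

definition fejer :: "nat \<Rightarrow> real \<Rightarrow> real" where
  "fejer N x = (\<Sum>k\<in>{1..N}. \<Sum>l\<in>{1..N}. cos (of_int (int k - int l) * x)) / real N"

lemma trig_poly_norm_sq:
  "(norm (\<Sum>k\<in>{1..N::nat}. of_real (x k) * cis (real k * \<theta>)))\<^sup>2 = (\<Sum>k\<in>{1..N}. \<Sum>l\<in>{1..N}. x k * x l * cos (of_int (int k - int l) * \<theta>))"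
proof -
  have "(norm (\<Sum>k\<in>{1..N}. of_real (x k) * cis (real k * \<theta>)))\<^sup>2
     = Re ((\<Sum>k\<in>{1..N}. of_real (x k) * cis (real k * \<theta>)) * cnj (\<Sum>k\<in>{1..N}. of_real (x k) * cis (real k * \<theta>)))"
    unfolding complex_norm_square[symmetric] by simp
  also have "\<dots> = (\<Sum>k\<in>{1..N}. \<Sum>l\<in>{1..N}. Re ((of_real (x k) * cis (real k * \<theta>)) * (of_real (x l) * cnj (cis (real l * \<theta>)))))"
    by (simp only: cnj_sum complex_cnj_mult complex_cnj_complex_of_real sum_product Re_sum)
  also have "\<dots> = (\<Sum>k\<in>{1..N}. \<Sum>l\<in>{1..N}. x k * x l * cos (of_int (int k - int l) * \<theta>))"
  proof (intro sum.cong refl)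
    fix k l :: nat
    have "cos (of_int (int k - int l) * \<theta>) = cos (real k * \<theta>) * cos (real l * \<theta>) + sin (real k * \<theta>) * sin (real l * \<theta>)"
      by (simp add: left_diff_distrib cos_diff)
    then show "Re ((of_real (x k) * cis (real k * \<theta>)) * (of_real (x l) * cnj (cis (real l * \<theta>)))) = x k * x l * cos (of_int (int k - int l) * \<theta>)"
      by (simp add: algebra_simps)
  qed
  finally show ?thesis .
qed

lemma fejer_alt: "fejer N x = (norm (\<Sum>k\<in>{1..N}. cis (real k * x)))\<^sup>2 / real N"
  unfolding fejer_def using trig_poly_norm_sq[where N=N and x="\<lambda>_. 1" and \<theta>=x] by simp

lemma fejer_nonneg: "fejer N x \<ge> 0" by (simp add: fejer_alt)

lemma fejer_measurable [measurable]: "fejer N \<in> borel_measurable borel"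
  unfolding fejer_def by measurable

lemma fejer_integrable: "integrable circ (\<lambda>x. fejer N (\<theta> - x))"
proof (rule circ.integrable_const_bound)
  show "AE x in circ. norm (fejer N (\<theta> - x)) \<le> (real N)\<^sup>2 / real N"
  proof (rule AE_I2)
    fix x
    have "norm (\<Sum>k\<in>{1..N}. cis (real k * (\<theta> - x))) \<le> (\<Sum>k\<in>{1..N}. 1)" by (rule sum_norm_le) simp
    then show "norm (fejer N (\<theta> - x)) \<le> (real N)\<^sup>2 / real N"
      unfolding fejer_alt by (auto intro!: divide_right_mono power_mono)
  qed
qed measurable

lemma fejer_mass:
  assumes "N > 0"
  shows "(LINT x|circ. fejer N (\<theta> - x)) = 2 * pi"
proof -
  have i: "integrable circ (\<lambda>x. cos (of_int n * (\<theta> - x)))" for n :: int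
    by (rule circ.integrable_const_bound[of _ 1]) auto
  have "(LINT x|circ. fejer N (\<theta> - x)) = (\<Sum>k\<in>{1..N}. \<Sum>l\<in>{1..N}. (LINT x|circ. cos (of_int (int k - int l) * (\<theta> - x)))) / real N"
    unfolding fejer_def using i by (simp add: Bochner_Integration.integral_sum del: of_int_diff)
  also have "\<dots> = (\<Sum>k\<in>{1..N}. \<Sum>l\<in>{1..N}. if l = k then 2 * pi else 0) / real N"
    unfolding circ_integral_cos by (intro arg_cong[where f="\<lambda>x. x / real N"] sum.cong refl) auto
  also have "\<dots> = 2 * pi" using assms by simp
  finally show ?thesis .
qed

text \<open>The geometric sum is at most 2 / |1 - z| with |1 - z|^2 = 2 - 2 cos x. The upper
  restriction on |x| is there because differences of two points of the interval reach up to 2 pi,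
  where the periodic kernel peaks again.\<close>

lemma fejer_tail:
  assumes d: "0 < \<delta>" "\<delta> \<le> pi" and x: "\<delta> \<le> \<bar>x\<bar>" "\<bar>x\<bar> \<le> 2 * pi - \<delta>" and N: "N > 0"
  shows "fejer N x \<le> 2 / ((1 - cos \<delta>) * real N)"
proof -
  have "cos x = cos \<bar>x\<bar>" by (simp add: abs_if)
  also have "\<dots> \<le> cos \<delta>"
  proof (cases "\<bar>x\<bar> \<le> pi")
    case True then show ?thesis using d x by (intro cos_monotone_0_pi_le) auto
  next
    case False
    have "cos \<bar>x\<bar> = cos (2 * pi - \<bar>x\<bar>)" by (simp add: cos_diff)
    also have "\<dots> \<le> cos \<delta>" using False d x by (intro cos_monotone_0_pi_le) auto
    finally show ?thesis .
  qed
  finally have cx: "cos x \<le> cos \<delta>" .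
  have cd: "cos \<delta> < 1" using cos_monotone_0_pi[of 0 \<delta>] d by simp
  define z where "z = cis x"
  have nz: "(norm (1 - z))\<^sup>2 = 2 - 2 * cos x"
  proof -
    have "(norm (1 - z))\<^sup>2 = (1 - cos x)\<^sup>2 + (sin x)\<^sup>2" unfolding z_def by (simp add: cmod_power2)
    also have "\<dots> = 2 - 2 * cos x" using sin_cos_squared_add[of x] by (simp add: power2_diff)
    finally show ?thesis .
  qed
  have "(1 - z) * (\<Sum>k\<in>{1..N}. cis (real k * x)) = z - z ^ Suc N"
  proof -
    have "(\<Sum>k\<in>{1..N}. cis (real k * x)) = (\<Sum>k\<in>{1..N}. z ^ k)" unfolding z_def by (intro sum.cong refl Complex.DeMoivre[symmetric])
    also have "(1 - z) * (\<Sum>k\<in>{1..n}. z ^ k) = z - z ^ Suc n" for n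
    proof (induction n)
      case (Suc n)
      have "(1 - z) * (\<Sum>k\<in>{1..Suc n}. z ^ k) = (1 - z) * (\<Sum>k\<in>{1..n}. z ^ k) + (1 - z) * z ^ Suc n"
        by (simp add: distrib_left)
      also have "\<dots> = z - z ^ Suc n + (1 - z) * z ^ Suc n" by (simp only: Suc)
      also have "\<dots> = z - z ^ Suc (Suc n)" by (simp add: algebra_simps)
      finally show ?case .
    qed simp
    finally show ?thesis .
  qed
  then have "norm (1 - z) * norm (\<Sum>k\<in>{1..N}. cis (real k * x)) = norm (z - z ^ Suc N)" by (metis norm_mult)
  also have "\<dots> \<le> norm z + norm (z ^ Suc N)" by (rule norm_triangle_ineq4)
  also have "\<dots> = 2" by (simp add: z_def norm_power norm_mult)
  finally have "(norm (1 - z) * norm (\<Sum>k\<in>{1..N}. cis (real k * x)))\<^sup>2 \<le> 2\<^sup>2" by (intro power_mono) auto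
  then have "(2 - 2 * cos x) * (norm (\<Sum>k\<in>{1..N}. cis (real k * x)))\<^sup>2 \<le> 4" by (simp add: power_mult_distrib nz)
  moreover have "(2 - 2 * cos \<delta>) * (norm (\<Sum>k\<in>{1..N}. cis (real k * x)))\<^sup>2 \<le> (2 - 2 * cos x) * (norm (\<Sum>k\<in>{1..N}. cis (real k * x)))\<^sup>2"
    using cx by (intro mult_right_mono) auto
  ultimately have "(1 - cos \<delta>) * (norm (\<Sum>k\<in>{1..N}. cis (real k * x)))\<^sup>2 \<le> 2" by (simp add: algebra_simps)
  then have "(norm (\<Sum>k\<in>{1..N}. cis (real k * x)))\<^sup>2 \<le> 2 / (1 - cos \<delta>)" using cd by (simp add: field_simps)
  then have "(norm (\<Sum>k\<in>{1..N}. cis (real k * x)))\<^sup>2 / real N \<le> 2 / (1 - cos \<delta>) / real N" by (intro divide_right_mono) auto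
  then show ?thesis by (simp add: fejer_alt)
qed

text \<open>The squared modulus of the n-th Fourier coefficient is the double integral of
  F(\<theta>) F(x) cos (n (\<theta> - x)). Averaging over n = k - l assembles the Fejer
  kernel.\<close>

lemma toeplitz_quadratic_mean:
  assumes [measurable]: "F \<in> borel_measurable borel" and B: "\<And>x. \<bar>F x\<bar> \<le> B"
  shows "(\<Sum>k\<in>{1..N}. \<Sum>l\<in>{1..N}. (norm (LINT x|circ. of_real (F x) * cis (of_int (int k - int l) * x)))\<^sup>2) / real N
     = (LINT \<theta>|circ. F \<theta> * (LINT x|circ. F x * fejer N (\<theta> - x)))"
proof -
  have ii: "integrable circ (\<lambda>x. F x * g x)" if [measurable]: "g \<in> borel_measurable borel" and "\<And>x. \<bar>g x\<bar> \<le> C" for g C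
  proof (rule circ.integrable_const_bound[of _ "B * C"])
    have "\<bar>F x * g x\<bar> \<le> B * C" for x unfolding abs_mult using B that order_trans[OF abs_ge_zero B[of 0]] by (intro mult_mono) auto
    then show "AE x in circ. norm (F x * g x) \<le> B * C" by auto
  qed measurable
  have ic: "integrable circ (\<lambda>x. F x * cos (n * x))" "integrable circ (\<lambda>x. F x * sin (n * x))"
       "integrable circ (\<lambda>x. F x * cos (n * (\<theta> - x)))" for n \<theta>
    by (rule ii[of _ 1]; simp)+
  have sq: "(norm (LINT x|circ. of_real (F x) * cis (n * x)))\<^sup>2 = (LINT \<theta>|circ. F \<theta> * (LINT x|circ. F x * cos (n * (\<theta> - x))))" for n
  proof -
    define a where "a = (LINT x|circ. F x * cos (n * x))"
    define b where "b = (LINT x|circ. F x * sin (n * x))"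
    have "(LINT x|circ. of_real (F x) * cis (n * x)) = (LINT x|circ. of_real (F x * cos (n * x)) + \<i> * of_real (F x * sin (n * x)))"
      by (intro Bochner_Integration.integral_cong refl) (simp add: complex_eq_iff)
    also have "\<dots> = of_real a + \<i> * of_real b"
      unfolding a_def b_def using ic[of n] by (simp del: of_real_mult)
    finally have "(norm (LINT x|circ. of_real (F x) * cis (n * x)))\<^sup>2 = a * a + b * b"
      by (simp only: cmod_power2) (simp add: power2_eq_square)
    also have "\<dots> = (LINT \<theta>|circ. (F \<theta> * cos (n * \<theta>)) * a + (F \<theta> * sin (n * \<theta>)) * b)"
      using ic[of n] by (simp add: a_def b_def)
    also have "\<dots> = (LINT \<theta>|circ. F \<theta> * (LINT x|circ. F x * cos (n * (\<theta> - x))))"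
    proof (intro Bochner_Integration.integral_cong refl)
      fix \<theta>
      have "(LINT x|circ. F x * cos (n * (\<theta> - x))) = (LINT x|circ. cos (n * \<theta>) * (F x * cos (n * x)) + sin (n * \<theta>) * (F x * sin (n * x)))"
        by (intro Bochner_Integration.integral_cong refl) (simp add: right_diff_distrib cos_diff algebra_simps)
      also have "\<dots> = cos (n * \<theta>) * a + sin (n * \<theta>) * b"
        using ic[of n] by (simp add: a_def b_def)
      finally show "(F \<theta> * cos (n * \<theta>)) * a + (F \<theta> * sin (n * \<theta>)) * b = F \<theta> * (LINT x|circ. F x * cos (n * (\<theta> - x)))"
        by (simp add: algebra_simps)
    qed
    finally show ?thesis .
  qed
  have ob: "integrable circ (\<lambda>\<theta>. F \<theta> * (LINT x|circ. F x * cos (n * (\<theta> - x))))" for n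
  proof (rule ii[of _ "LINT x|circ. \<bar>F x\<bar>"])
    show "\<bar>LINT x|circ. F x * cos (n * (\<theta> - x))\<bar> \<le> (LINT x|circ. \<bar>F x\<bar>)" for \<theta>
      unfolding real_norm_def[symmetric]
    proof (rule norm_integral_le_integral)
      show "norm (F x * cos (n * (\<theta> - x))) \<le> norm (F x)" for x
        unfolding norm_mult by (intro mult_left_le) auto
    qed (use ic(3)[of n \<theta>] ii[of "\<lambda>_. 1" 1] in auto)
  qed measurable
  have "(LINT \<theta>|circ. F \<theta> * (LINT x|circ. F x * fejer N (\<theta> - x)))
    = (LINT \<theta>|circ. (\<Sum>k\<in>{1..N}. \<Sum>l\<in>{1..N}. F \<theta> * (LINT x|circ. F x * cos (of_int (int k - int l) * (\<theta> - x)))) / real N)"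
  proof (intro Bochner_Integration.integral_cong refl)
    fix \<theta>
    have "(LINT x|circ. F x * fejer N (\<theta> - x)) = (LINT x|circ. (\<Sum>k\<in>{1..N}. \<Sum>l\<in>{1..N}. F x * cos (of_int (int k - int l) * (\<theta> - x))) / real N)"
      unfolding fejer_def by (intro Bochner_Integration.integral_cong refl) (simp add: sum_distrib_left)
    also have "\<dots> = (\<Sum>k\<in>{1..N}. \<Sum>l\<in>{1..N}. (LINT x|circ. F x * cos (of_int (int k - int l) * (\<theta> - x)))) / real N"
      using ic(3) by (simp add: Bochner_Integration.integral_sum del: of_int_diff)
    finally show "F \<theta> * (LINT x|circ. F x * fejer N (\<theta> - x)) = (\<Sum>k\<in>{1..N}. \<Sum>l\<in>{1..N}. F \<theta> * (LINT x|circ. F x * cos (of_int (int k - int l) * (\<theta> - x)))) / real N"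
      by (simp add: sum_distrib_left)
  qed
  also have "\<dots> = (\<Sum>k\<in>{1..N}. \<Sum>l\<in>{1..N}. (LINT \<theta>|circ. F \<theta> * (LINT x|circ. F x * cos (of_int (int k - int l) * (\<theta> - x))))) / real N"
    using ob by (simp add: Bochner_Integration.integral_sum del: of_int_diff)
  finally show ?thesis unfolding sq by simp
qed

text \<open>The Fejer kernel is an approximate identity of mass 2 pi. Uniform convergence of the
  symbols allows them to vary together with the order; pointwise convergence at interior points and
  dominated convergence then finish the argument.\<close>

theorem toeplitz_limit:
  fixes F :: "nat \<Rightarrow> real \<Rightarrow> real" and G :: "real \<Rightarrow> real" and N :: "nat \<Rightarrow> nat"
  assumes [measurable]: "\<And>j. F j \<in> borel_measurable borel" and G_meas [measurable]: "G \<in> borel_measurable borel"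
    and FB: "\<And>j x. \<bar>F j x\<bar> \<le> B" and GB: "\<And>x. \<bar>G x\<bar> \<le> B"
    and unif: "uniform_limit {-pi..pi} F G sequentially"
    and G_cont: "continuous_on {-pi..pi} G"
    and N: "filterlim N at_top sequentially"
  shows "(\<lambda>j. (\<Sum>k\<in>{1..N j}. \<Sum>l\<in>{1..N j}. (norm (LINT x|circ. of_real (F j x) * cis (of_int (int k - int l) * x)))\<^sup>2) / real (N j))
     \<longlonglongrightarrow> 2 * pi * (LINT x|circ. (G x)\<^sup>2)"
  unfolding toeplitz_quadratic_mean[OF assms(1) FB]
proof -
  define u where "u j \<theta> = (LINT x|circ. F j x * fejer (N j) (\<theta> - x))" for j \<theta>
  have B0: "B \<ge> 0" using order_trans[OF abs_ge_zero GB[of 0]] .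
  have N1: "\<forall>\<^sub>F j in sequentially. N j > 0"
  proof -
    have "\<forall>\<^sub>F j in sequentially. 1 \<le> N j" using N unfolding filterlim_at_top by blast
    then show ?thesis by eventually_elim simp
  qed
  have [measurable]: "u j \<in> borel_measurable borel" for j unfolding u_def by measurable
  have Fi: "integrable circ (\<lambda>x. H x * fejer M (\<theta> - x))" if [measurable]: "H \<in> borel_measurable borel" and H: "\<And>x. \<bar>H x\<bar> \<le> C" for H M C \<theta>
  proof (rule Bochner_Integration.integrable_bound)
    show "integrable circ (\<lambda>x. C * fejer M (\<theta> - x))" using fejer_integrable by simp
    show "AE x in circ. norm (H x * fejer M (\<theta> - x)) \<le> norm (C * fejer M (\<theta> - x))"
      using H fejer_nonneg order_trans[OF abs_ge_zero H] by (intro AE_I2) (auto simp: abs_mult intro!: mult_right_mono order_trans[OF H])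
  qed measurable
  have FK: "integrable circ (\<lambda>x. F j x * fejer M (\<theta> - x))" for j M \<theta> by (rule Fi[OF _ FB]) simp
  have ub: "\<bar>u j \<theta>\<bar> \<le> B * (2 * pi)" for j \<theta>
  proof (cases "N j > 0")
    case True
    have "norm (u j \<theta>) \<le> (LINT x|circ. B * fejer (N j) (\<theta> - x))" unfolding u_def
    proof (rule norm_integral_le_integral)
      show "norm (F j x * fejer (N j) (\<theta> - x)) \<le> B * fejer (N j) (\<theta> - x)" for x
        using fejer_nonneg FB by (auto simp: abs_mult intro!: mult_right_mono)
    qed (use FK fejer_integrable in auto)
    then show ?thesis using fejer_mass[OF True, of \<theta>] by simp
  next
    case False
    \<comment> \<open>For \<open>N j = 0\<close> the kernel is an empty sum, hence 0.\<close>
    then show ?thesis using B0 by (simp add: u_def fejer_def)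
  qed
  have lim: "(\<lambda>j. u j \<theta>) \<longlonglongrightarrow> 2 * pi * G \<theta>" if th: "- pi < \<theta>" "\<theta> < pi" for \<theta>
  proof (rule tendstoI)
    fix e :: real assume e: "e > 0"
    \<comment> \<open>Near \<theta> the symbol differs from G \<theta> by at most 2 \<epsilon>, once
      for the symbol and once for continuity of \<open>G\<close>. Times the mass 2 pi this is e /
      2.\<close>
    define \<epsilon> where "\<epsilon> = e / (8 * pi)"
    have eps: "\<epsilon> > 0" using e by (simp add: \<epsilon>_def)
    obtain d where d: "d > 0" "\<And>x. x \<in> {-pi..pi} \<Longrightarrow> dist x \<theta> < d \<Longrightarrow> dist (G x) (G \<theta>) < \<epsilon>"
      using G_cont[unfolded continuous_on_iff, rule_format, of \<theta> \<epsilon>] th eps by force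
    \<comment> \<open>Besides continuity of \<open>G\<close>, the distances of \<theta> to both ends
      enter: they keep |\<theta> - x| below 2 pi - \<delta>, away from the outer peaks of the
      kernel.\<close>
    define \<delta> where "\<delta> = min d (min (pi - \<theta>) (\<theta> + pi))"
    have del: "0 < \<delta>" "\<delta> \<le> pi" "\<delta> \<le> d" using d th by (auto simp: \<delta>_def)
    \<comment> \<open>Bound for the integrand away from \<theta>: the symbols differ by at most 2 B,
      and the other factor is the bound of \<open>fejer_tail\<close>.\<close>
    define Q where "Q j = 2 * B * (2 / ((1 - cos \<delta>) * real (N j)))" for j
    have cd: "cos \<delta> < 1" using cos_monotone_0_pi[of 0 \<delta>] del by simp
    have Qlim: "Q \<longlonglongrightarrow> 0"
    proof -
      have "filterlim (\<lambda>j. real (N j)) at_top sequentially" by (rule filterlim_compose[OF filterlim_real_sequentially N])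
      then have "(\<lambda>j. (4 * B / (1 - cos \<delta>)) / real (N j)) \<longlonglongrightarrow> 0" by (rule real_tendsto_divide_at_top[OF tendsto_const])
      then show ?thesis by (simp add: Q_def[abs_def])
    qed
    have "\<forall>\<^sub>F j in sequentially. Q j < e / (4 * pi)"
      using order_tendstoD(2)[OF Qlim, of "e / (4 * pi)"] e by simp
    moreover have "\<forall>\<^sub>F j in sequentially. \<forall>x\<in>{-pi..pi}. dist (F j x) (G x) < \<epsilon>"
      using unif eps by (auto simp: uniform_limit_iff)
    ultimately show "\<forall>\<^sub>F j in sequentially. dist (u j \<theta>) (2 * pi * G \<theta>) < e"
      using N1
    proof eventually_elim
      case (elim j)
      let ?K = "\<lambda>x. fejer (N j) (\<theta> - x)"
      have KI: "integrable circ ?K" by (rule fejer_integrable)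
      have "u j \<theta> - 2 * pi * G \<theta> = (LINT x|circ. F j x * ?K x - G \<theta> * ?K x)"
        using FK[of j "N j" \<theta>] KI fejer_mass[OF elim(3), of \<theta>] by (simp add: u_def)
      also have "\<bar>\<dots>\<bar> \<le> (LINT x|circ. 2 * \<epsilon> * ?K x + Q j)"
      proof (subst real_norm_def[symmetric], rule order_trans[OF integral_norm_bound], rule integral_mono_AE)
        show "integrable circ (\<lambda>x. norm (F j x * ?K x - G \<theta> * ?K x))" using FK[of j "N j" \<theta>] KI by simp
        show "integrable circ (\<lambda>x. 2 * \<epsilon> * ?K x + Q j)" using KI by simp
        show "AE x in circ. norm (F j x * ?K x - G \<theta> * ?K x) \<le> 2 * \<epsilon> * ?K x + Q j"
        proof (rule AE_circ)
          fix x assume x: "x \<in> {-pi..pi}"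
          have Q0: "Q j \<ge> 0" using B0 cd by (simp add: Q_def)
          have e1: "norm (F j x * ?K x - G \<theta> * ?K x) = \<bar>F j x - G \<theta>\<bar> * ?K x"
            using fejer_nonneg by (simp add: left_diff_distrib[symmetric] abs_mult)
          show "norm (F j x * ?K x - G \<theta> * ?K x) \<le> 2 * \<epsilon> * ?K x + Q j"
          proof (cases "\<bar>\<theta> - x\<bar> < \<delta>")
            case True
            then have "dist (G x) (G \<theta>) < \<epsilon>" using del x by (intro d(2)) (auto simp: dist_real_def abs_minus_commute)
            moreover have "dist (F j x) (G x) < \<epsilon>" using elim(2) x by blast
            ultimately have "\<bar>F j x - G \<theta>\<bar> \<le> 2 * \<epsilon>" by (simp add: dist_real_def)
            then have "\<bar>F j x - G \<theta>\<bar> * ?K x \<le> 2 * \<epsilon> * ?K x" using fejer_nonneg by (intro mult_right_mono) auto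
            then show ?thesis using e1 Q0 by linarith
          next
            case False
            have "\<bar>\<theta> - x\<bar> \<le> 2 * pi - \<delta>" using x th by (auto simp: \<delta>_def)
            then have "?K x \<le> 2 / ((1 - cos \<delta>) * real (N j))" using False del elim(3) by (intro fejer_tail) auto
            moreover have "\<bar>F j x - G \<theta>\<bar> \<le> 2 * B" using FB[of j x] GB[of \<theta>] by linarith
            ultimately have "\<bar>F j x - G \<theta>\<bar> * ?K x \<le> Q j" unfolding Q_def using fejer_nonneg B0 by (intro mult_mono) auto
            moreover have "2 * \<epsilon> * ?K x \<ge> 0" using eps fejer_nonneg by simp
            ultimately show ?thesis using e1 by linarith
          qed
        qed
      qed
      also have "\<dots> = 2 * \<epsilon> * (2 * pi) + Q j * (2 * pi)" using KI fejer_mass[OF elim(3), of \<theta>] by (simp add: measure_circ)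
      also have "\<dots> < e"
      proof -
        have "2 * \<epsilon> * (2 * pi) = e / 2" by (simp add: \<epsilon>_def)
        moreover have "Q j * (2 * pi) < e / (4 * pi) * (2 * pi)" using elim(1) by (intro mult_strict_right_mono) auto
        ultimately show ?thesis by simp
      qed
      finally show ?case by (simp add: dist_real_def)
    qed
  qed
  have "(\<lambda>j. LINT \<theta>|circ. F j \<theta> * u j \<theta>) \<longlonglongrightarrow> (LINT \<theta>|circ. G \<theta> * (2 * pi * G \<theta>))"
  proof (rule integral_dominated_convergence[where w="\<lambda>_. B * (B * (2 * pi))"])
    show "AE x in circ. (\<lambda>j. F j x * u j x) \<longlonglongrightarrow> G x * (2 * pi * G x)"
    proof (rule AE_circ_interior)
      fix x assume x: "- pi < x" "x < pi"
      then have "(\<lambda>j. F j x) \<longlonglongrightarrow> G x" using tendsto_uniform_limitI[OF unif, of x] by simp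
      from tendsto_mult[OF this lim[OF x]] show "(\<lambda>j. F j x * u j x) \<longlonglongrightarrow> G x * (2 * pi * G x)" .
    qed
    show "AE x in circ. norm (F j x * u j x) \<le> B * (B * (2 * pi))" for j
      unfolding real_norm_def abs_mult by (intro AE_I2 mult_mono FB ub) (use B0 in auto)
  qed auto
  also have "(LINT \<theta>|circ. G \<theta> * (2 * pi * G \<theta>)) = 2 * pi * (LINT x|circ. (G x)\<^sup>2)"
    by (subst integral_mult_right_zero[symmetric]) (simp add: power2_eq_square ac_simps)
  finally show "(\<lambda>j. LINT \<theta>|circ. F j \<theta> * (LINT x|circ. F j x * fejer (N j) (\<theta> - x))) \<longlonglongrightarrow> 2 * pi * (LINT x|circ. (G x)\<^sup>2)"
    unfolding u_def .
qed

text \<open>The form is the integral of \<open>F\<close> against the squared modulus of a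
  trigonometric polynomial. Replacing \<open>F\<close> by its upper bound leaves an orthogonality
  computation, and this gives the norm bound for the covariance matrices.\<close>

lemma toeplitz_form_bound:
  assumes [measurable]: "F \<in> borel_measurable borel" and F: "\<And>x. 0 \<le> F x" "\<And>x. F x \<le> B"
  shows "(\<Sum>k\<in>{1..N}. \<Sum>l\<in>{1..N}. x k * x l * (LINT \<theta>|circ. F \<theta> * cos (of_int (int k - int l) * \<theta>))) \<le> 2 * pi * B * (\<Sum>k\<in>{1..N}. (x k)\<^sup>2)"
proof -
  define P where "P \<theta> = (\<Sum>k\<in>{1..N}. \<Sum>l\<in>{1..N}. x k * x l * cos (of_int (int k - int l) * \<theta>))" for \<theta>
  have P0: "P \<theta> \<ge> 0" for \<theta> unfolding P_def trig_poly_norm_sq[symmetric] by simp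
  have ic: "integrable circ (\<lambda>\<theta>. cos (n * \<theta>))" "integrable circ (\<lambda>\<theta>. F \<theta> * cos (n * \<theta>))" for n
  proof -
    show "integrable circ (\<lambda>\<theta>. cos (n * \<theta>))" by (rule circ.integrable_const_bound[of _ 1]) auto
    have "\<bar>F \<theta> * cos (n * \<theta>)\<bar> \<le> B * 1" for \<theta> unfolding abs_mult using F[of \<theta>] by (intro mult_mono) auto
    then show "integrable circ (\<lambda>\<theta>. F \<theta> * cos (n * \<theta>))" by (intro circ.integrable_const_bound[of _ B]) auto
  qed
  have "(\<Sum>k\<in>{1..N}. \<Sum>l\<in>{1..N}. x k * x l * (LINT \<theta>|circ. F \<theta> * cos (of_int (int k - int l) * \<theta>)))
     = (LINT \<theta>|circ. (\<Sum>k\<in>{1..N}. \<Sum>l\<in>{1..N}. x k * x l * (F \<theta> * cos (of_int (int k - int l) * \<theta>))))"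
    using ic by (simp add: Bochner_Integration.integral_sum del: of_int_diff)
  also have "\<dots> \<le> (LINT \<theta>|circ. B * P \<theta>)"
  proof (rule integral_mono)
    show "integrable circ (\<lambda>\<theta>. \<Sum>k\<in>{1..N}. \<Sum>l\<in>{1..N}. x k * x l * (F \<theta> * cos (of_int (int k - int l) * \<theta>)))"
      using ic by (simp del: of_int_diff)
    show "integrable circ (\<lambda>\<theta>. B * P \<theta>)" unfolding P_def using ic by (simp del: of_int_diff)
    fix \<theta>
    have "(\<Sum>k\<in>{1..N}. \<Sum>l\<in>{1..N}. x k * x l * (F \<theta> * cos (of_int (int k - int l) * \<theta>))) = F \<theta> * P \<theta>"
      unfolding P_def by (simp add: sum_distrib_left ac_simps)
    also have "\<dots> \<le> B * P \<theta>" using F P0 by (intro mult_right_mono) auto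
    finally show "(\<Sum>k\<in>{1..N}. \<Sum>l\<in>{1..N}. x k * x l * (F \<theta> * cos (of_int (int k - int l) * \<theta>))) \<le> B * P \<theta>" .
  qed
  also have "\<dots> = B * (\<Sum>k\<in>{1..N}. \<Sum>l\<in>{1..N}. x k * x l * (LINT \<theta>|circ. cos (of_int (int k - int l) * \<theta>)))"
    unfolding P_def using ic by (simp add: Bochner_Integration.integral_sum del: of_int_diff)
  also have "(\<Sum>k\<in>{1..N}. \<Sum>l\<in>{1..N}. x k * x l * (LINT \<theta>|circ. cos (of_int (int k - int l) * \<theta>))) = (\<Sum>k\<in>{1..N}. \<Sum>l\<in>{1..N}. if l = k then 2 * pi * (x k)\<^sup>2 else 0)"
  proof (intro sum.cong refl)
    fix k l
    have "(LINT \<theta>|circ. cos (of_int (int k - int l) * \<theta>)) = (LINT \<theta>|circ. cos (of_int (int k - int l) * (0 - \<theta>)))"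
      by (intro Bochner_Integration.integral_cong refl) simp
    then show "x k * x l * (LINT \<theta>|circ. cos (of_int (int k - int l) * \<theta>)) = (if l = k then 2 * pi * (x k)\<^sup>2 else 0)"
      unfolding circ_integral_cos by (auto simp: power2_eq_square)
  qed
  also have "B * \<dots> = 2 * pi * B * (\<Sum>k\<in>{1..N}. (x k)\<^sup>2)" by (simp add: sum_distrib_left ac_simps)
  finally show ?thesis .
qed

text \<open>The line is cut into cells of length 2 pi, and each cell is translated to the central
  one, where \<phi> looks the same by periodicity. The support condition leaves only the cells with
  |n| \<le> p.\<close>

lemma periodization:
  fixes q :: "real \<Rightarrow> real" and \<phi> :: "real \<Rightarrow> real" and p :: int
  assumes [measurable]: "q \<in> borel_measurable borel" "\<phi> \<in> borel_measurable borel"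
    and int: "integrable lborel (\<lambda>x. q x * \<phi> x)"
    and supp: "\<And>x. q x \<noteq> 0 \<Longrightarrow> \<bar>x\<bar> < (2 * of_int p + 1) * pi"
    and per: "\<And>x n. \<phi> (x + 2 * pi * of_int n) = \<phi> x"
  shows "(LINT x|lborel. q x * \<phi> x) = (LINT x|circ. (\<Sum>n\<in>{-p..p}. q (x + 2 * pi * of_int n)) * \<phi> x)"
proof -
  \<comment> \<open>Half-open cells partition the line, so that the cell of a point is given by a
    floor; only the null endpoint separates cell 0 from the interval of \<open>circ\<close>.\<close>
  define A where "A n = {(2 * of_int n - 1) * pi..<(2 * of_int n + 1) * pi}" for n :: int
  have A: "x \<in> A n \<longleftrightarrow> n = \<lfloor>(x + pi) / (2 * pi)\<rfloor>" for x n
  proof -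
    have "x \<in> A n \<longleftrightarrow> of_int n * (2 * pi) \<le> x + pi \<and> x + pi < (of_int n + 1) * (2 * pi)"
      unfolding A_def by (auto simp: algebra_simps)
    also have "\<dots> \<longleftrightarrow> of_int n \<le> (x + pi) / (2 * pi) \<and> (x + pi) / (2 * pi) < of_int n + 1"
      by (simp add: pos_le_divide_eq pos_divide_less_eq)
    finally show ?thesis by (auto simp: floor_eq_iff eq_commute[of n])
  qed
  have pw: "q x * \<phi> x = (\<Sum>n\<in>{-p..p}. indicator (A n) x * (q x * \<phi> x))" for x
  proof (cases "q x = 0")
    case False
    let ?m = "\<lfloor>(x + pi) / (2 * pi)\<rfloor>"
    have x: "- (2 * of_int p + 1) * pi < x" "x < (2 * of_int p + 1) * pi" using supp[OF False] unfolding mult_minus_left by linarith+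
    have "(2 * of_int ?m - 1) * pi \<le> x" "x < (2 * of_int ?m + 1) * pi" using A[of x ?m] by (auto simp: A_def)
    then have "(2 * of_int ?m - 1) * pi < (2 * of_int p + 1) * pi" "- (2 * of_int p + 1) * pi < (2 * of_int ?m + 1) * pi" using x by linarith+
    then have "2 * real_of_int ?m - 1 < 2 * of_int p + 1" "- (2 * real_of_int p + 1) < 2 * of_int ?m + 1"
      using pi_gt_zero by (auto simp only: mult_less_cancel_right_pos)
    then have "?m \<in> {-p..p}" by auto
    moreover have "(\<Sum>n\<in>{-p..p}. indicator (A n) x * (q x * \<phi> x)) = (\<Sum>n\<in>{-p..p}. if n = ?m then q x * \<phi> x else 0)"
      by (intro sum.cong) (auto simp: indicator_def A)
    ultimately show ?thesis by simp
  qed auto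
  have [measurable]: "A n \<in> sets borel" for n by (simp add: A_def)
  have inti: "integrable lborel (\<lambda>x. indicator (A n) x * (q x * \<phi> x))" for n
    using integrable_mult_indicator[OF _ int, of "A n"] by simp
  have sh: "(\<lambda>x. indicator (A n) (2 * pi * of_int n + 1 * x) * (q (2 * pi * of_int n + 1 * x) * \<phi> (2 * pi * of_int n + 1 * x))) = (\<lambda>x. indicator (A 0) x * (q (x + 2 * pi * of_int n) * \<phi> x))" for n
  proof
    fix x
    have "indicator (A n) (2 * pi * of_int n + x) = (indicator (A 0) x :: real)"
      by (auto simp: indicator_def A_def algebra_simps)
    then show "indicator (A n) (2 * pi * of_int n + 1 * x) * (q (2 * pi * of_int n + 1 * x) * \<phi> (2 * pi * of_int n + 1 * x)) = indicator (A 0) x * (q (x + 2 * pi * of_int n) * \<phi> x)"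
      using per[of x n] by (simp add: add.commute)
  qed
  have shift: "(LINT x|lborel. indicator (A n) x * (q x * \<phi> x)) = (LINT x|lborel. indicator (A 0) x * (q (x + 2 * pi * of_int n) * \<phi> x))" for n
    using lborel_integral_real_affine[of 1 "\<lambda>x. indicator (A n) x * (q x * \<phi> x)" "2 * pi * of_int n"] unfolding sh by simp
  have shift_int: "integrable lborel (\<lambda>x. indicator (A 0) x * (q (x + 2 * pi * of_int n) * \<phi> x))" for n
    using lborel_integrable_real_affine[OF inti[of n], of 1 "2 * pi * of_int n"] unfolding sh by simp
  have "(LINT x|lborel. q x * \<phi> x) = (LINT x|lborel. (\<Sum>n\<in>{-p..p}. indicator (A n) x * (q x * \<phi> x)))"
    by (intro Bochner_Integration.integral_cong refl pw)
  also have "\<dots> = (\<Sum>n\<in>{-p..p}. LINT x|lborel. indicator (A 0) x * (q (x + 2 * pi * of_int n) * \<phi> x))"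
    by (subst Bochner_Integration.integral_sum) (auto simp: inti shift)
  also have "\<dots> = (LINT x|lborel. (\<Sum>n\<in>{-p..p}. indicator (A 0) x * (q (x + 2 * pi * of_int n) * \<phi> x)))"
    by (subst Bochner_Integration.integral_sum) (auto simp: shift_int)
  also have "\<dots> = (LINT x|lborel. indicator {-pi..pi} x *\<^sub>R ((\<Sum>n\<in>{-p..p}. q (x + 2 * pi * of_int n)) * \<phi> x))"
  proof (rule integral_cong_AE)
    have "AE x in lborel. x \<noteq> pi" by (rule AE_lborel_singleton)
    then show "AE x in lborel. (\<Sum>n\<in>{-p..p}. indicator (A 0) x * (q (x + 2 * pi * of_int n) * \<phi> x)) = indicator {-pi..pi} x *\<^sub>R ((\<Sum>n\<in>{-p..p}. q (x + 2 * pi * of_int n)) * \<phi> x)"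
      by eventually_elim (auto simp: indicator_def A_def sum_distrib_right)
  qed measurable
  also have "\<dots> = (LINT x|circ. (\<Sum>n\<in>{-p..p}. q (x + 2 * pi * of_int n)) * \<phi> x)"
    by (rule circ_integral[symmetric]) measurable
  finally show ?thesis .
qed

subsection \<open>The spectral density\<close>

text \<open>Translation and reflection bring both sides of the singularity at \<open>c\<close> to
  the power function on [0, K], where K = L + |c| covers the interval seen from
  \<open>c\<close>.\<close>

lemma integrable_abs_powr_local:
  assumes a: "a > (-1::real)" and L: "L \<ge> 0"
  shows "integrable lborel (\<lambda>x. indicator {-L..L} x * \<bar>x - c\<bar> powr a)"
proof -
  have half: "integrable lborel (\<lambda>x. indicator {0..K} x * x powr a)" if K: "K \<ge> 0" for K :: real
  proof -
    have "((\<lambda>x. x powr a) has_integral (K powr (a+1) / (a+1))) {0..K}" by (rule has_integral_powr_from_0[OF a K])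
    then have "((\<lambda>x. if x \<in> {0..K} then x powr a else 0) has_integral (K powr (a+1) / (a+1))) UNIV"
      by (simp only: has_integral_restrict_UNIV)
    moreover have "(\<lambda>x. if x \<in> {0..K} then x powr a else 0) = (\<lambda>x. indicator {0..K} x * x powr a)" by (auto simp: indicator_def)
    ultimately have "((\<lambda>x. indicator {0..K} x * x powr a) has_integral (K powr (a+1) / (a+1))) UNIV" by simp
    from nn_integral_has_integral_lborel[OF _ _ this]
    have "(\<integral>\<^sup>+x. ennreal (indicator {0..K} x * x powr a) \<partial>lborel) = ennreal (K powr (a+1) / (a+1))" by simp
    then show ?thesis by (intro integrableI_nn_integral_finite) auto
  qed
  define K where "K = L + \<bar>c\<bar>"
  have K: "K \<ge> 0" using L by (simp add: K_def)
  have p: "integrable lborel (\<lambda>x. indicator {0..K} (- c + 1 * x) * (- c + 1 * x) powr a)"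
    by (rule lborel_integrable_real_affine[OF half[OF K], of 1 "-c"]) simp
  have m: "integrable lborel (\<lambda>x. indicator {0..K} (c + (-1) * x) * (c + (-1) * x) powr a)"
    by (rule lborel_integrable_real_affine[OF half[OF K], of "-1" c]) simp
  show ?thesis
  proof (rule Bochner_Integration.integrable_bound[OF Bochner_Integration.integrable_add[OF p m]])
    show "AE x in lborel. norm (indicator {-L..L} x * \<bar>x - c\<bar> powr a) \<le> norm (indicator {0..K} (- c + 1 * x) * (- c + 1 * x) powr a + indicator {0..K} (c + (-1) * x) * (c + (-1) * x) powr a)"
    proof (rule AE_I2)
      fix x :: real
      have "norm (indicator {-L..L} x * \<bar>x - c\<bar> powr a) \<le> indicator {0..K} (- c + 1 * x) * (- c + 1 * x) powr a + indicator {0..K} (c + (-1) * x) * (c + (-1) * x) powr a"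
      proof (cases "x \<in> {-L..L}")
        case True
        show ?thesis
        proof (cases "x \<ge> c")
          case xc: True
          then have "- c + 1 * x \<in> {0..K}" using True by (auto simp: K_def)
          then show ?thesis using True xc by (simp add: indicator_def)
        next
          case False
          then have "c + (-1) * x \<in> {0..K}" using True by (auto simp: K_def)
          then show ?thesis using True False by (simp add: indicator_def)
        qed
      qed (auto simp: indicator_def)
      then show "norm (indicator {-L..L} x * \<bar>x - c\<bar> powr a) \<le> norm (indicator {0..K} (- c + 1 * x) * (- c + 1 * x) powr a + indicator {0..K} (c + (-1) * x) * (c + (-1) * x) powr a)"
        by (rule order_trans) (simp add: abs_ge_self)
    qed
  qed measurable
qed

lemma spec_dens_nonneg: "h u \<ge> 0 \<Longrightarrow> spec_dens h s0 \<alpha> u \<ge> 0"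
  by (simp add: spec_dens_def)

text \<open>For |u| \<le> 2 s0 only one of the factors u - s0, u + s0 can be small, and its exponent
  -2 \<alpha> > -1 is integrable; the other factor is at least s0 in modulus. Beyond, the
  denominator grows like |u|^(4 \<alpha>), and \<open>h_int\<close> applies with \<epsilon> = 4
  \<alpha>.\<close>

lemma spec_dens_integrable:
  assumes s0: "s0 > 1" and alpha: "0 < \<alpha>" "\<alpha> < 1/2"
    and h_cont: "continuous_on UNIV h" and h_nonneg: "\<And>u. h u \<ge> 0" and h_bdd: "bounded (range h)"
    and h_int: "\<And>\<epsilon>. \<epsilon> > 0 \<Longrightarrow> integrable lborel (\<lambda>u. h u * (1 + \<bar>u\<bar>) powr (- \<epsilon>))"
  shows "integrable lborel (spec_dens h s0 \<alpha>)"
proof -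
  have [measurable]: "h \<in> borel_measurable borel" using h_cont by (rule borel_measurable_continuous_onI)
  obtain K where K: "\<And>u. h u \<le> K" using h_bdd by (auto simp: bounded_iff) (metis abs_le_D1)
  have K0: "K \<ge> 0" using K[of 0] h_nonneg[of 0] by simp
  define g1 where "g1 u = K * s0 powr (- 2 * \<alpha>) * (indicator {- (2 * s0)..2 * s0} u * \<bar>u - s0\<bar> powr (- 2 * \<alpha>))" for u
  define g2 where "g2 u = K * s0 powr (- 2 * \<alpha>) * (indicator {- (2 * s0)..2 * s0} u * \<bar>u - (- s0)\<bar> powr (- 2 * \<alpha>))" for u
  \<comment> \<open>The constant 3/16: for |u| > 2 s0 one has u^2 - s0^2 \<ge> 3/4 u^2, and (1 +
    |u|)^2 \<le> 4 u^2 because |u| \<ge> 1.\<close>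
  define g3 where "g3 u = (3 / 16) powr (- 2 * \<alpha>) * (h u * (1 + \<bar>u\<bar>) powr (- (4 * \<alpha>)))" for u
  have i: "integrable lborel (\<lambda>u. g1 u + g2 u + g3 u)"
    unfolding g1_def g2_def g3_def using alpha s0
    by (intro Bochner_Integration.integrable_add integrable_mult_right integrable_abs_powr_local h_int) auto
  show ?thesis
  proof (rule Bochner_Integration.integrable_bound[OF i])
    show "spec_dens h s0 \<alpha> \<in> borel_measurable lborel" unfolding spec_dens_def[abs_def] by measurable
    show "AE u in lborel. norm (spec_dens h s0 \<alpha> u) \<le> norm (g1 u + g2 u + g3 u)"
    proof (rule AE_I2)
      fix u
      have g0: "g1 u \<ge> 0" "g2 u \<ge> 0" "g3 u \<ge> 0" using K0 h_nonneg by (auto simp: g1_def g2_def g3_def)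
      have fac: "\<bar>u\<^sup>2 - s0\<^sup>2\<bar> = \<bar>u - s0\<bar> * \<bar>u + s0\<bar>" by (simp add: abs_mult[symmetric] power2_eq_square algebra_simps)
      have "spec_dens h s0 \<alpha> u \<le> g1 u + g2 u + g3 u"
      proof (cases "\<bar>u\<bar> \<le> 2 * s0")
        case True
        then have ind: "indicator {- (2 * s0)..2 * s0} u = (1::real)" by (auto simp: indicator_def)
        have "spec_dens h s0 \<alpha> u = h u * (\<bar>u - s0\<bar> powr (- 2 * \<alpha>) * \<bar>u + s0\<bar> powr (- 2 * \<alpha>))"
          unfolding spec_dens_def fac by (simp add: powr_mult powr_minus_divide)
        also have "\<dots> \<le> K * (\<bar>u - s0\<bar> powr (- 2 * \<alpha>) * \<bar>u + s0\<bar> powr (- 2 * \<alpha>))"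
          using K by (intro mult_right_mono) auto
        also have "\<dots> \<le> g1 u + g2 u"
        proof (cases "u \<ge> 0")
          case u: True
          then have "\<bar>u + s0\<bar> powr (- 2 * \<alpha>) \<le> s0 powr (- 2 * \<alpha>)" using s0 alpha by (intro powr_mono2') auto
          then have "K * (\<bar>u - s0\<bar> powr (- 2 * \<alpha>) * \<bar>u + s0\<bar> powr (- 2 * \<alpha>)) \<le> K * (\<bar>u - s0\<bar> powr (- 2 * \<alpha>) * s0 powr (- 2 * \<alpha>))"
            using K0 by (intro mult_left_mono) auto
          also have "\<dots> = g1 u" by (simp add: g1_def ind)
          finally show ?thesis using g0 by linarith
        next
          case u: False
          then have "\<bar>u - s0\<bar> powr (- 2 * \<alpha>) \<le> s0 powr (- 2 * \<alpha>)" using s0 alpha by (intro powr_mono2') auto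
          then have "K * (\<bar>u - s0\<bar> powr (- 2 * \<alpha>) * \<bar>u + s0\<bar> powr (- 2 * \<alpha>)) \<le> K * (s0 powr (- 2 * \<alpha>) * \<bar>u + s0\<bar> powr (- 2 * \<alpha>))"
            using K0 by (intro mult_left_mono mult_right_mono) auto
          also have "\<dots> = g2 u" by (simp add: g2_def ind)
          finally show ?thesis using g0 by linarith
        qed
        finally show ?thesis using g0 by linarith
      next
        case False
        have u1: "\<bar>u\<bar> > 2 * s0" "\<bar>u\<bar> \<ge> 1" using False s0 by auto
        have "(2 * s0)\<^sup>2 \<le> \<bar>u\<bar>\<^sup>2" using u1 s0 by (intro power_mono) auto
        then have a1: "s0\<^sup>2 \<le> u\<^sup>2 / 4" by (simp add: power2_eq_square)
        have "(1 + \<bar>u\<bar>)\<^sup>2 \<le> (2 * \<bar>u\<bar>)\<^sup>2" using u1 by (intro power_mono) auto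
        then have a2: "(1 + \<bar>u\<bar>)\<^sup>2 \<le> 4 * u\<^sup>2" by (simp add: power_mult_distrib)
        have low: "3 / 16 * (1 + \<bar>u\<bar>)\<^sup>2 \<le> \<bar>u\<^sup>2 - s0\<^sup>2\<bar>" using a1 a2 by linarith
        have "spec_dens h s0 \<alpha> u = h u * \<bar>u\<^sup>2 - s0\<^sup>2\<bar> powr (- 2 * \<alpha>)" by (simp add: spec_dens_def powr_minus_divide)
        also have "\<dots> \<le> h u * (3 / 16 * (1 + \<bar>u\<bar>)\<^sup>2) powr (- 2 * \<alpha>)"
          using low alpha h_nonneg by (intro mult_left_mono powr_mono2') (auto intro!: mult_pos_pos zero_less_power)
        also have "\<dots> = g3 u"
        proof -
          have "((1 + \<bar>u\<bar>)\<^sup>2) powr (- 2 * \<alpha>) = (1 + \<bar>u\<bar>) powr (- (4 * \<alpha>))"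
            by (simp add: powr_powr flip: powr_numeral)
          moreover have "(3 / 16 * (1 + \<bar>u\<bar>)\<^sup>2) powr (- 2 * \<alpha>) = (3 / 16) powr (- 2 * \<alpha>) * ((1 + \<bar>u\<bar>)\<^sup>2) powr (- 2 * \<alpha>)"
            by (rule powr_mult)
          ultimately show ?thesis by (simp only: g3_def mult.left_commute)
        qed
        finally show ?thesis using g0 by linarith
      qed
      then show "norm (spec_dens h s0 \<alpha> u) \<le> norm (g1 u + g2 u + g3 u)"
        using spec_dens_nonneg[of h u s0 \<alpha>, OF h_nonneg] by simp
    qed
  qed
qed

text \<open>In the Maclaurin formula of order 4 the middle terms vanish, and the fourth derivative
  in the remainder is bounded on [-1, 1] by continuity.\<close>

lemma h_expansion:
  fixes h :: "real \<Rightarrow> real"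
  assumes h_diff: "\<And>i x. i < 4 \<Longrightarrow> (deriv ^^ i) h differentiable (at x)"
    and h_C4: "continuous_on UNIV ((deriv ^^ 4) h)"
    and h_deriv0: "\<And>i. 1 \<le> i \<Longrightarrow> i \<le> 4 \<Longrightarrow> (deriv ^^ i) h 0 = 0"
    and h_0: "h 0 = 1"
  shows "\<exists>K. \<forall>u. \<bar>u\<bar> \<le> 1 \<longrightarrow> \<bar>h u - 1\<bar> \<le> K * u ^ 4"
proof -
  have "compact ((deriv ^^ 4) h ` {-1..1})"
    by (intro compact_continuous_image continuous_on_subset[OF h_C4]) auto
  then have "bounded ((deriv ^^ 4) h ` {-1..1})" by (rule compact_imp_bounded)
  then obtain B where B: "\<And>t. t \<in> {-1..1} \<Longrightarrow> \<bar>(deriv ^^ 4) h t\<bar> \<le> B"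
    unfolding bounded_iff by (metis imageI real_norm_def)
  show ?thesis
  proof (intro exI[of _ "B / 24"] allI impI)
    fix u :: real assume u: "\<bar>u\<bar> \<le> 1"
    have "\<exists>t. \<bar>t\<bar> \<le> \<bar>u\<bar> \<and> h u = (\<Sum>m<4. (deriv ^^ m) h 0 / fact m * u ^ m) + (deriv ^^ 4) h t / fact 4 * u ^ 4"
    proof (rule Maclaurin_bi_le)
      show "\<forall>m t. m < 4 \<and> \<bar>t\<bar> \<le> \<bar>u\<bar> \<longrightarrow> ((deriv ^^ m) h has_real_derivative (deriv ^^ Suc m) h t) (at t)"
        using h_diff by (simp add: DERIV_deriv_iff_real_differentiable)
    qed simp
    then obtain t where t: "\<bar>t\<bar> \<le> \<bar>u\<bar>" and eq: "h u = (\<Sum>m<4. (deriv ^^ m) h 0 / fact m * u ^ m) + (deriv ^^ 4) h t / fact 4 * u ^ 4" by blast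
    have "(\<Sum>m<4. (deriv ^^ m) h 0 / fact m * u ^ m) = (\<Sum>m\<in>{0}. (deriv ^^ m) h 0 / fact m * u ^ m)"
      using h_deriv0 by (intro sum.mono_neutral_right) auto
    then have "h u - 1 = (deriv ^^ 4) h t / 24 * u ^ 4" using eq h_0 by (simp add: fact_numeral)
    then have "\<bar>h u - 1\<bar> = \<bar>(deriv ^^ 4) h t / 24 * u ^ 4\<bar>" by (rule arg_cong)
    also have "\<dots> = \<bar>(deriv ^^ 4) h t\<bar> / 24 * u ^ 4" by (simp add: abs_mult)
    also have "\<dots> \<le> B / 24 * u ^ 4"
    proof -
      have "t \<in> {-1..1}" using t u unfolding atLeastAtMost_iff by linarith
      then show ?thesis by (intro mult_right_mono divide_right_mono B) auto
    qed
    finally show "\<bar>h u - 1\<bar> \<le> B / 24 * u ^ 4" .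
  qed
qed

text \<open>Taylor expansion to second order in the variable x = u^2, which turns a quadratic
  remainder into u^4. Since |t| \<le> 1/4 and s0 > 1, the base s0^2 - t in the remainder stays above
  1/2.\<close>

lemma powr_expansion:
  fixes s0 \<alpha> :: real
  assumes s0: "s0 > 1" and alpha: "0 < \<alpha>"
  shows "\<exists>K. \<forall>u. \<bar>u\<bar> \<le> 1/2 \<longrightarrow> \<bar>(s0\<^sup>2 - u\<^sup>2) powr (- 2 * \<alpha>) - s0 powr (- 4 * \<alpha>) - 2 * \<alpha> * s0 powr (- 4 * \<alpha> - 2) * u\<^sup>2\<bar> \<le> K * u ^ 4"
proof -
  define D where "D m x = (if m = 0 then (s0\<^sup>2 - x) powr (- 2 * \<alpha>) else if m = (1::nat) then 2 * \<alpha> * (s0\<^sup>2 - x) powr (- 2 * \<alpha> - 1)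
     else 2 * \<alpha> * (2 * \<alpha> + 1) * (s0\<^sup>2 - x) powr (- 2 * \<alpha> - 2))" for m x
  have ss: "s0\<^sup>2 > 1" using s0 one_less_power[of s0 2] by simp
  have e1: "(s0\<^sup>2) powr y = s0 powr (2 * y)" for y using s0 by (simp add: powr_powr flip: powr_numeral)
  show ?thesis
  proof (intro exI[of _ "\<alpha> * (2 * \<alpha> + 1) * (1/2) powr (- 2 * \<alpha> - 2)"] allI impI)
    fix u :: real assume u: "\<bar>u\<bar> \<le> 1/2"
    have u2: "u\<^sup>2 \<le> 1/4" using abs_le_square_iff[of u "1/2"] u by (simp add: power2_eq_square)
    have "\<exists>t. \<bar>t\<bar> \<le> \<bar>u\<^sup>2\<bar> \<and> (s0\<^sup>2 - u\<^sup>2) powr (- 2 * \<alpha>) = (\<Sum>m<2. D m 0 / fact m * (u\<^sup>2) ^ m) + D 2 t / fact 2 * (u\<^sup>2) ^ 2"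
    proof (rule Maclaurin_bi_le[where f="\<lambda>x. (s0\<^sup>2 - x) powr (- 2 * \<alpha>)"])
      show "D 0 = (\<lambda>x. (s0\<^sup>2 - x) powr (- 2 * \<alpha>))" by (auto simp: D_def)
      show "\<forall>m t. m < 2 \<and> \<bar>t\<bar> \<le> \<bar>u\<^sup>2\<bar> \<longrightarrow> (D m has_real_derivative D (Suc m) t) (at t)"
      proof (intro allI impI, elim conjE)
        fix m :: nat and t assume m: "m < 2" and t: "\<bar>t\<bar> \<le> \<bar>u\<^sup>2\<bar>"
        have pos: "s0\<^sup>2 - t > 0" using t u2 ss by auto
        have d: "((\<lambda>x. k * (s0\<^sup>2 - x) powr p) has_real_derivative (k * - p * (s0\<^sup>2 - t) powr (p - 1))) (at t)" for k p
          using pos by (auto intro!: derivative_eq_intros)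
        consider "m = 0" | "m = 1" using m by linarith
        then show "(D m has_real_derivative D (Suc m) t) (at t)"
        proof cases
          case 1
          show ?thesis using d[of 1 "- 2 * \<alpha>"] unfolding D_def 1 by simp
        next
          case 2
          show ?thesis using d[of "2 * \<alpha>" "- 2 * \<alpha> - 1"] unfolding D_def 2 by (simp add: algebra_simps)
        qed
      qed
    qed
    then obtain t where t: "\<bar>t\<bar> \<le> u\<^sup>2" and eq: "(s0\<^sup>2 - u\<^sup>2) powr (- 2 * \<alpha>) = (\<Sum>m<2. D m 0 / fact m * (u\<^sup>2) ^ m) + D 2 t / fact 2 * (u\<^sup>2) ^ 2" by auto
    have "(\<Sum>m<2. D m 0 / fact m * (u\<^sup>2) ^ m) = D 0 0 + D 1 0 * u\<^sup>2" by (simp add: numeral_2_eq_2)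
    also have "D 0 0 = s0 powr (- 4 * \<alpha>)" by (simp add: D_def e1)
    also have "D 1 0 = 2 * \<alpha> * s0 powr (- 4 * \<alpha> - 2)" by (simp add: D_def e1 right_diff_distrib)
    finally have "(s0\<^sup>2 - u\<^sup>2) powr (- 2 * \<alpha>) - s0 powr (- 4 * \<alpha>) - 2 * \<alpha> * s0 powr (- 4 * \<alpha> - 2) * u\<^sup>2 = \<alpha> * (2 * \<alpha> + 1) * (s0\<^sup>2 - t) powr (- 2 * \<alpha> - 2) * u ^ 4"
      using eq by (simp add: D_def power_mult[symmetric])
    moreover have "(s0\<^sup>2 - t) powr (- 2 * \<alpha> - 2) \<le> (1/2) powr (- 2 * \<alpha> - 2)"
      using t u2 ss alpha by (intro powr_mono2') auto
    ultimately show "\<bar>(s0\<^sup>2 - u\<^sup>2) powr (- 2 * \<alpha>) - s0 powr (- 4 * \<alpha>) - 2 * \<alpha> * s0 powr (- 4 * \<alpha> - 2) * u\<^sup>2\<bar> \<le> \<alpha> * (2 * \<alpha> + 1) * (1/2) powr (- 2 * \<alpha> - 2) * u ^ 4"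
      using alpha by (auto simp: abs_mult intro!: mult_right_mono mult_left_mono)
  qed
qed

text \<open>On |u| \<le> 1/2 the modulus in the density opens as s0^2 - u^2, and the deviation of
  \<open>h\<close> from 1 is of order u^4 times a bounded power. So the quadratic coefficient comes
  from the power alone.\<close>

lemma spec_dens_expansion:
  assumes s0: "s0 > 1" and alpha: "0 < \<alpha>"
    and h: "\<forall>u. \<bar>u\<bar> \<le> 1 \<longrightarrow> \<bar>h u - 1\<bar> \<le> Kh * u ^ 4"
  shows "\<exists>K. \<forall>u. \<bar>u\<bar> \<le> 1/2 \<longrightarrow> \<bar>spec_dens h s0 \<alpha> u - s0 powr (- 4 * \<alpha>) - 2 * \<alpha> * s0 powr (- 4 * \<alpha> - 2) * u\<^sup>2\<bar> \<le> K * u ^ 4"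
proof -
  obtain Kp where Kp: "\<And>u. \<bar>u\<bar> \<le> 1/2 \<Longrightarrow> \<bar>(s0\<^sup>2 - u\<^sup>2) powr (- 2 * \<alpha>) - s0 powr (- 4 * \<alpha>) - 2 * \<alpha> * s0 powr (- 4 * \<alpha> - 2) * u\<^sup>2\<bar> \<le> Kp * u ^ 4"
    using powr_expansion[OF s0 alpha] by blast
  have ss: "s0\<^sup>2 > 1" using s0 one_less_power[of s0 2] by simp
  show ?thesis
  proof (intro exI[of _ "Kh * (1/2) powr (- 2 * \<alpha>) + Kp"] allI impI)
    fix u :: real assume u: "\<bar>u\<bar> \<le> 1/2"
    have u2: "u\<^sup>2 \<le> 1/4" using abs_le_square_iff[of u "1/2"] u by (simp add: power2_eq_square)
    let ?p = "(s0\<^sup>2 - u\<^sup>2) powr (- 2 * \<alpha>)"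
    have f: "spec_dens h s0 \<alpha> u = h u * ?p"
      using u2 ss by (simp add: spec_dens_def powr_minus_divide abs_if)
    have p: "?p \<le> (1/2) powr (- 2 * \<alpha>)" using u2 ss alpha by (intro powr_mono2') auto
    have "\<bar>spec_dens h s0 \<alpha> u - s0 powr (- 4 * \<alpha>) - 2 * \<alpha> * s0 powr (- 4 * \<alpha> - 2) * u\<^sup>2\<bar>
      = \<bar>(h u - 1) * ?p + (?p - s0 powr (- 4 * \<alpha>) - 2 * \<alpha> * s0 powr (- 4 * \<alpha> - 2) * u\<^sup>2)\<bar>" unfolding f by (simp add: algebra_simps)
    also have "\<dots> \<le> \<bar>(h u - 1) * ?p\<bar> + \<bar>?p - s0 powr (- 4 * \<alpha>) - 2 * \<alpha> * s0 powr (- 4 * \<alpha> - 2) * u\<^sup>2\<bar>" by (rule abs_triangle_ineq)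
    also have "\<dots> \<le> Kh * u ^ 4 * (1/2) powr (- 2 * \<alpha>) + Kp * u ^ 4"
    proof (intro add_mono Kp u)
      have "\<bar>h u - 1\<bar> \<le> Kh * u ^ 4" using h u by auto
      then show "\<bar>(h u - 1) * ?p\<bar> \<le> Kh * u ^ 4 * (1/2) powr (- 2 * \<alpha>)" unfolding abs_mult using p by (intro mult_mono) auto
    qed
    finally show "\<bar>spec_dens h s0 \<alpha> u - s0 powr (- 4 * \<alpha>) - 2 * \<alpha> * s0 powr (- 4 * \<alpha> - 2) * u\<^sup>2\<bar> \<le> (Kh * (1/2) powr (- 2 * \<alpha>) + Kp) * u ^ 4"
      by (simp add: algebra_simps)
  qed
qed

subsection \<open>Wavelet levels\<close>

lemma fourier_tr_continuous:
  assumes w: "integrable lborel w"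
  shows "isCont (fourier_tr w) u"
  unfolding continuous_at_sequentially
proof (intro allI impI)
  have [measurable]: "w \<in> borel_measurable borel" using w by auto
  fix s :: "nat \<Rightarrow> real" assume s: "s \<longlonglongrightarrow> u"
  show "(fourier_tr w \<circ> s) \<longlonglongrightarrow> fourier_tr w u"
    unfolding o_def fourier_tr_def
  proof (rule integral_dominated_convergence[where w="\<lambda>t. \<bar>w t\<bar>"])
    show "AE t in lborel. (\<lambda>i. cis (- s i * t) * complex_of_real (w t)) \<longlonglongrightarrow> cis (- u * t) * complex_of_real (w t)"
      by (intro AE_I2 tendsto_mult tendsto_const isCont_tendsto_compose[OF isCont_cis_real] tendsto_minus s)
  qed (use w in \<open>auto simp: norm_mult\<close>)
qed

lemma fourier_tr_minus:
  assumes w: "integrable lborel w"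
  shows "fourier_tr w (- u) = cnj (fourier_tr w u)"
proof -
  have "cnj (fourier_tr w u) = (LINT t|lborel. cnj (cis (- u * t) * complex_of_real (w t)))"
    unfolding fourier_tr_def by (rule Bochner_Integration.integral_cnj[symmetric])
  also have "\<dots> = fourier_tr w (- u)" unfolding fourier_tr_def by (simp add: cis_cnj)
  finally show ?thesis ..
qed

lemma wavelet_integrable:
  fixes \<psi> :: "real \<Rightarrow> real"
  assumes psi: "integrable lborel \<psi>" and a: "a > 0"
  shows "integrable lborel (\<lambda>t. a powr (-1/2) * \<psi> ((t - b) / a))"
proof -
  have "integrable lborel (\<lambda>t. \<psi> (- b / a + (1 / a) * t))" using a by (intro lborel_integrable_real_affine[OF psi]) auto
  moreover have "(\<lambda>t. \<psi> (- b / a + (1 / a) * t)) = (\<lambda>t. \<psi> ((t - b) / a))" by (simp add: diff_divide_distrib)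
  ultimately show ?thesis by simp
qed

lemma fourier_tr_wavelet:
  assumes a: "a > 0"
  shows "fourier_tr (\<lambda>t. a powr (-1/2) * \<psi> ((t - b) / a)) u = of_real (a powr (1/2)) * (cis (- u * b) * fourier_tr \<psi> (a * u))"
proof -
  have "fourier_tr (\<lambda>t. a powr (-1/2) * \<psi> ((t - b) / a)) u
     = \<bar>a\<bar> *\<^sub>R (LINT t|lborel. cis (- u * (b + a * t)) * complex_of_real (a powr (-1/2) * \<psi> ((b + a * t - b) / a)))"
    unfolding fourier_tr_def using a by (subst lborel_integral_real_affine[of a _ b]) auto
  also have "\<dots> = of_real a * (LINT t|lborel. (of_real (a powr (-1/2)) * cis (- u * b)) * (cis (- (a * u) * t) * complex_of_real (\<psi> t)))"
  proof -
    have "cis (- u * (b + a * t)) * complex_of_real (a powr (-1/2) * \<psi> ((b + a * t - b) / a))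
       = (of_real (a powr (-1/2)) * cis (- u * b)) * (cis (- (a * u) * t) * complex_of_real (\<psi> t))" for t
    proof -
      have "cis (- u * (b + a * t)) = cis (- u * b) * cis (- (a * u) * t)" unfolding cis_mult by (simp add: algebra_simps)
      then show ?thesis using a by simp
    qed
    then show ?thesis using a by (simp only: scaleR_conv_of_real abs_of_pos)
  qed
  also have "\<dots> = of_real (a * a powr (-1/2)) * (cis (- u * b) * fourier_tr \<psi> (a * u))"
    unfolding fourier_tr_def by simp
  also have "a * a powr (-1/2) = a powr (1/2)" using a powr_mult_base[of a "-1/2"] by simp
  finally show ?thesis .
qed

lemma uniform_limit_finite_sum:
  fixes g :: "'n \<Rightarrow> 'i \<Rightarrow> 'x \<Rightarrow> 'b::real_normed_vector"
  assumes "finite T" "\<And>n. n \<in> T \<Longrightarrow> uniform_limit S (g n) (l n) F"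
  shows "uniform_limit S (\<lambda>i x. \<Sum>n\<in>T. g n i x) (\<lambda>x. \<Sum>n\<in>T. l n x) F"
  using assms by (induction T rule: finite_induct) (auto intro!: uniform_limit_add uniform_limit_const)

text \<open>The analytic data of the levels, without the process. Since \<open>a j\<close> tends to
  infinity and the transform of \<open>\<psi>\<close> has bounded support, only the behaviour of
  \<open>f\<close> near 0 enters at high levels; it is recorded in \<open>f0\<close> and
  \<open>Kf\<close>.\<close>

locale wavelet_levels =
  fixes \<psi> :: "real \<Rightarrow> real" and A :: real and f :: "real \<Rightarrow> real" and f0 Kf :: real
    and a \<gamma> :: "nat \<Rightarrow> real" and c :: real
  assumes psi: "integrable lborel \<psi>" and A_pos: "A > 0"
    and psi_supp: "\<And>\<xi>. \<bar>\<xi>\<bar> > A \<Longrightarrow> fourier_tr \<psi> \<xi> = 0"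
    and f_meas [measurable]: "f \<in> borel_measurable borel" and f_even: "\<And>u. f (- u) = f u" and f_nonneg: "\<And>u. f u \<ge> 0"
    and f_near: "\<And>u. \<bar>u\<bar> \<le> 1/2 \<Longrightarrow> \<bar>f u - f0\<bar> \<le> Kf * u\<^sup>2"
    and a_pos: "\<And>j. a j > 0" and a_lim: "filterlim a at_top sequentially"
    and g_pos: "\<And>j. \<gamma> j > 0" and c_pos: "c > 0" and c_lim: "(\<lambda>j. a j / \<gamma> j) \<longlonglongrightarrow> c"
begin

definition \<Psi> :: "real \<Rightarrow> real" where "\<Psi> \<eta> = (cmod (fourier_tr \<psi> \<eta>))\<^sup>2"
text \<open>Spectral density of the coefficients of level \<open>i\<close> as a sequence in the
  translation index: the frequency is rescaled by \<open>\<gamma> i\<close>, so that lag n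
  corresponds to cos (n x) in \<open>cov\<close>.\<close>

definition q :: "nat \<Rightarrow> real \<Rightarrow> real" where "q i x = a i / \<gamma> i * f (x / \<gamma> i) * \<Psi> (a i / \<gamma> i * x)"
definition cov :: "nat \<Rightarrow> int \<Rightarrow> real" where "cov i n = (LINT x|lborel. q i x * cos (of_int n * x))"
definition qper :: "int \<Rightarrow> nat \<Rightarrow> real \<Rightarrow> real" where "qper p i x = (\<Sum>n\<in>{-p..p}. q i (x + 2 * pi * of_int n))"
text \<open>What \<open>qper\<close> becomes when a i / \<gamma> i is replaced by its limit
  \<open>c\<close> and the density by its value \<open>f0\<close> at the origin.\<close>

definition glim :: "int \<Rightarrow> real \<Rightarrow> real" where "glim p x = (\<Sum>n\<in>{-p..p}. c * f0 * \<Psi> (c * (x + 2 * pi * of_int n)))"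
definition BP :: real where "BP = (LINT t|lborel. \<bar>\<psi> t\<bar>)\<^sup>2"

lemma f0_nonneg: "f0 \<ge> 0" using f_near[of 0] f_nonneg[of 0] by simp
lemma Psi_nonneg: "\<Psi> x \<ge> 0" by (simp add: \<Psi>_def)
lemma Psi_le: "\<Psi> x \<le> BP" unfolding \<Psi>_def BP_def by (intro power_mono norm_fourier_tr_le psi) simp
lemma Psi_supp: "\<bar>x\<bar> > A \<Longrightarrow> \<Psi> x = 0" by (simp add: \<Psi>_def psi_supp)
lemma Psi_even: "\<Psi> (- x) = \<Psi> x" by (simp add: \<Psi>_def fourier_tr_minus[OF psi])
lemma Psi_cont: "continuous_on S \<Psi>"
  unfolding \<Psi>_def by (intro continuous_intros continuous_at_imp_continuous_on ballI fourier_tr_continuous psi)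
lemma Psi_meas [measurable]: "\<Psi> \<in> borel_measurable borel"
  using Psi_cont by (rule borel_measurable_continuous_onI)
lemma q_meas [measurable]: "q i \<in> borel_measurable borel" unfolding q_def by measurable
lemma q_nonneg: "q i x \<ge> 0" unfolding q_def using a_pos[of i] g_pos[of i] f_nonneg Psi_nonneg by simp
lemma q_even: "q i (- x) = q i x" unfolding q_def using f_even[of "x / \<gamma> i"] Psi_even[of "a i / \<gamma> i * x"] by simp

lemma BP_nonneg: "BP \<ge> 0" by (simp add: BP_def)

lemma Kf_nonneg: "Kf \<ge> 0" using order_trans[OF abs_ge_zero f_near[of "1/2"]] by (simp add: power2_eq_square)

text \<open>Where \<open>\<Psi>\<close> does not vanish, the frequency x / \<gamma> i is at most A /
  a i, which the size of \<open>a i\<close> puts into the range of \<open>f_near\<close>.\<close>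

lemma f_near_level: "a i \<ge> 2 * A \<Longrightarrow> \<Psi> (a i / \<gamma> i * x) \<noteq> 0 \<Longrightarrow> \<bar>f (x / \<gamma> i) - f0\<bar> \<le> Kf * (A / a i)\<^sup>2"
proof -
  assume ai: "a i \<ge> 2 * A" and nz: "\<Psi> (a i / \<gamma> i * x) \<noteq> 0"
  have ap: "a i > 0" by (rule a_pos)
  have "\<bar>a i / \<gamma> i * x\<bar> \<le> A" using nz Psi_supp[of "a i / \<gamma> i * x"] by force
  then have "a i * \<bar>x / \<gamma> i\<bar> \<le> A" using ap g_pos[of i] by (simp add: abs_mult)
  then have b: "\<bar>x / \<gamma> i\<bar> \<le> A / a i" using ap by (simp add: pos_le_divide_eq mult.commute)
  also have "A / a i \<le> 1/2" using ai ap by (simp add: field_simps)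
  finally have "\<bar>f (x / \<gamma> i) - f0\<bar> \<le> Kf * (x / \<gamma> i)\<^sup>2" by (rule f_near)
  also have "\<dots> \<le> Kf * (A / a i)\<^sup>2"
  proof (rule mult_left_mono)
    show "(x / \<gamma> i)\<^sup>2 \<le> (A / a i)\<^sup>2" using b by (metis abs_ge_zero power2_abs power_mono)
    show "Kf \<ge> 0" by (rule Kf_nonneg)
  qed
  finally show ?thesis .
qed

text \<open>Once a i / \<gamma> i lies within (c/2, 2 c), all levels share a support window, a bound
  and a number of periodization terms. The facts are packed into one existence statement because
  they refer to the same \<open>p\<close>, \<open>B\<close> and \<open>i0\<close>.\<close>

lemma level_facts:
  obtains p :: int and B :: real and i0 :: nat where "p \<ge> 0" "B > 0" "(2 * of_int p + 1) * pi * c > A"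
    "\<forall>i\<ge>i0. a i \<ge> 2 * A"
    "\<forall>i\<ge>i0. \<forall>x. q i x \<noteq> 0 \<longrightarrow> \<bar>x\<bar> < (2 * of_int p + 1) * pi"
    "\<forall>i\<ge>i0. \<forall>x. q i x \<le> B"
    "\<forall>i\<ge>i0. \<forall>x. qper p i x \<le> B"
    "uniform_limit {-pi..pi} (qper p) (glim p) sequentially"
proof -
  \<comment> \<open>As a i / \<gamma> i > c/2 eventually, \<open>q i\<close> vanishes for |x| > 2 A
    / c; the choice of \<open>p\<close> places this bound below (2 p + 1) pi.\<close>
  define p where "p = max 0 \<lceil>2 * A / c\<rceil>"
  have p0: "p \<ge> 0" by (simp add: p_def)
  have p1: "2 * A / c \<le> of_int p"
  proof -
    have "2 * A / c \<le> of_int \<lceil>2 * A / c\<rceil>" by (rule le_of_int_ceiling)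
    also have "\<dots> \<le> of_int p" unfolding p_def of_int_le_iff by simp
    finally show ?thesis .
  qed
  define L where "L = (2 * of_int p + 1) * pi"
  have LA: "2 * A / c < L"
  proof -
    have "real_of_int p < (2 * of_int p + 1) * 1" using p0 by simp
    also have "\<dots> \<le> L" unfolding L_def using p0 pi_gt3 by (intro mult_left_mono) auto
    finally show ?thesis using p1 by linarith
  qed
  have L0: "L > 0" using p0 by (simp add: L_def)
  define d where "d i = a i / \<gamma> i" for i
  have dlim: "d \<longlonglongrightarrow> c" using c_lim by (simp add: d_def[abs_def])
  have dpos: "d i > 0" for i using a_pos g_pos by (simp add: d_def)
  have "\<forall>\<^sub>F i in sequentially. d i > c / 2 \<and> d i < 2 * c \<and> a i \<ge> 2 * A"
    using order_tendstoD(1)[OF dlim, of "c / 2"] order_tendstoD(2)[OF dlim, of "2 * c"] c_pos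
      filterlim_at_top[THEN iffD1, OF a_lim, rule_format, of "2 * A"]
    by (auto intro: eventually_conj)
  then obtain i0 where i0: "\<And>i. i \<ge> i0 \<Longrightarrow> d i > c / 2 \<and> d i < 2 * c \<and> a i \<ge> 2 * A"
    by (auto simp: eventually_sequentially)
  define Q where "Q = 2 * c * (f0 + Kf) * BP"
  have Q0: "Q \<ge> 0" using c_pos f0_nonneg Kf_nonneg BP_nonneg by (simp add: Q_def)
  have supp: "\<bar>x\<bar> < L" if i: "i \<ge> i0" and nz: "q i x \<noteq> 0" for i x
  proof -
    have "\<Psi> (d i * x) \<noteq> 0" using nz by (auto simp: q_def d_def)
    then have "\<bar>d i * x\<bar> \<le> A" using Psi_supp[of "d i * x"] by force
    then have "d i * \<bar>x\<bar> \<le> A" using dpos[of i] by (simp add: abs_mult)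
    moreover have "c / 2 * \<bar>x\<bar> \<le> d i * \<bar>x\<bar>" using i0[OF i] by (intro mult_right_mono) auto
    ultimately have "c / 2 * \<bar>x\<bar> \<le> A" by linarith
    then have "\<bar>x\<bar> \<le> 2 * A / c" using c_pos by (simp add: field_simps)
    then show ?thesis using LA by linarith
  qed
  have qQ: "q i x \<le> Q" if i: "i \<ge> i0" for i x
  proof (cases "\<Psi> (a i / \<gamma> i * x) = 0")
    case False
    have ai: "a i \<ge> 2 * A" using i0[OF i] by simp
    have "(A / a i)\<^sup>2 \<le> 1\<^sup>2" using ai a_pos[of i] A_pos by (intro power_mono) (auto simp: field_simps)
    then have "Kf * (A / a i)\<^sup>2 \<le> Kf" using Kf_nonneg by (simp add: mult_left_le)
    then have fl: "f (x / \<gamma> i) \<le> f0 + Kf" using f_near_level[OF ai False] by linarith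
    have "q i x = d i * f (x / \<gamma> i) * \<Psi> (a i / \<gamma> i * x)" by (simp add: q_def d_def)
    also have "\<dots> \<le> (2 * c) * (f0 + Kf) * BP"
      using i0[OF i] dpos[of i] fl f_nonneg Psi_nonneg Psi_le c_pos f0_nonneg Kf_nonneg
      by (intro mult_mono) auto
    finally show ?thesis by (simp add: Q_def)
  qed (use Q0 in \<open>simp add: q_def\<close>)
  \<comment> \<open>The periodization has 2 p + 1 summands, each at most \<open>Q\<close>; the added
    1 makes the bound strictly positive.\<close>
  define B where "B = (2 * of_int p + 1) * Q + 1"
  have B0: "B > 0" using Q0 p0 by (simp add: B_def add_nonneg_pos)
  have QB: "Q \<le> B"
  proof -
    have "1 * Q \<le> (2 * of_int p + 1) * Q" using Q0 p0 by (intro mult_right_mono) auto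
    then show ?thesis by (simp add: B_def)
  qed
  have qpB: "qper p i x \<le> B" if i: "i \<ge> i0" for i x
  proof -
    have "qper p i x \<le> (\<Sum>n\<in>{-p..p}. Q)" unfolding qper_def by (intro sum_mono qQ i)
    also have "\<dots> = (2 * of_int p + 1) * Q" using p0 by simp
    finally show ?thesis by (simp add: B_def)
  qed
  have qunif: "uniform_limit {-L..L} q (\<lambda>x. c * f0 * \<Psi> (c * x)) sequentially"
    unfolding uniform_limit_iff
  proof (intro allI impI)
    fix e :: real assume e: "e > 0"
    \<comment> \<open>Two of three errors: replacing the density by \<open>f0\<close>, and the outer
      factor a i / \<gamma> i by \<open>c\<close>. The third one, from the changed argument of
      \<open>\<Psi>\<close>, is left to uniform continuity.\<close>
    define E where "E i = d i * (Kf * (A / a i)\<^sup>2 * BP) + \<bar>d i - c\<bar> * (f0 * BP)" for i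
    have "(\<lambda>i. A / a i) \<longlonglongrightarrow> 0" by (rule real_tendsto_divide_at_top[OF tendsto_const a_lim])
    then have "E \<longlonglongrightarrow> c * (Kf * 0\<^sup>2 * BP) + \<bar>c - c\<bar> * (f0 * BP)"
      unfolding E_def[abs_def] by (intro tendsto_intros dlim)
    then have E0: "E \<longlonglongrightarrow> 0" by simp
    \<comment> \<open>Chosen so that 2 c f0 \<epsilon> is at most e / 2; the summand 1 guards
      against \<open>f0 = 0\<close>.\<close>
    define \<epsilon> where "\<epsilon> = e / (2 * (2 * c * f0 + 1))"
    have den: "2 * c * f0 + 1 > 0" using c_pos f0_nonneg by (simp add: add_nonneg_pos)
    have eps: "\<epsilon> > 0" using e den by (simp add: \<epsilon>_def)
    \<comment> \<open>The interval contains both arguments c x and a i / \<gamma> i * x, since both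
      factors are at most 2 c.\<close>
    have "uniformly_continuous_on {-(2 * c * L)..2 * c * L} \<Psi>"
      by (intro compact_uniformly_continuous Psi_cont) auto
    then obtain \<delta> where del: "\<delta> > 0" "\<And>s t. s \<in> {-(2 * c * L)..2 * c * L} \<Longrightarrow> t \<in> {-(2 * c * L)..2 * c * L} \<Longrightarrow> dist t s < \<delta> \<Longrightarrow> dist (\<Psi> t) (\<Psi> s) < \<epsilon>"
      unfolding uniformly_continuous_on_def using eps by metis
    have "(\<lambda>i. \<bar>d i - c\<bar> * L) \<longlonglongrightarrow> \<bar>c - c\<bar> * L" by (intro tendsto_intros dlim)
    then have dc: "\<forall>\<^sub>F i in sequentially. \<bar>d i - c\<bar> * L < \<delta>" using order_tendstoD(2)[of _ 0 sequentially \<delta>] del(1) by simp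
    have "\<forall>\<^sub>F i in sequentially. E i < e / 2" using order_tendstoD(2)[OF E0, of "e / 2"] e by simp
    moreover have "\<forall>\<^sub>F i in sequentially. i \<ge> i0" by (rule eventually_ge_at_top)
    ultimately show "\<forall>\<^sub>F i in sequentially. \<forall>x\<in>{-L..L}. dist (q i x) (c * f0 * \<Psi> (c * x)) < e"
      using dc
    proof eventually_elim
      case (elim i)
      have ai: "a i \<ge> 2 * A" and d2: "d i < 2 * c" using i0[OF elim(2)] by auto
      show ?case
      proof
        fix x assume x: "x \<in> {-L..L}"
        then have xL: "\<bar>x\<bar> \<le> L" by auto
        have in1: "d i * x \<in> {-(2 * c * L)..2 * c * L}"
        proof -
          have "\<bar>d i * x\<bar> \<le> 2 * c * L" unfolding abs_mult using d2 dpos[of i] xL c_pos by (intro mult_mono) auto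
          then show ?thesis by auto
        qed
        have in2: "c * x \<in> {-(2 * c * L)..2 * c * L}"
        proof -
          have "\<bar>c * x\<bar> \<le> 2 * c * L" unfolding abs_mult using xL c_pos by (intro mult_mono) auto
          then show ?thesis by auto
        qed
        have "dist (d i * x) (c * x) = \<bar>d i - c\<bar> * \<bar>x\<bar>" by (simp add: dist_real_def left_diff_distrib[symmetric] abs_mult)
        also have "\<dots> \<le> \<bar>d i - c\<bar> * L" using xL by (intro mult_left_mono) auto
        finally have "dist (d i * x) (c * x) < \<delta>" using elim(3) by linarith
        then have om: "\<bar>\<Psi> (d i * x) - \<Psi> (c * x)\<bar> \<le> \<epsilon>" using del(2)[OF in2 in1] by (simp add: dist_real_def)
        have t1: "\<bar>(f (x / \<gamma> i) - f0) * \<Psi> (d i * x)\<bar> \<le> Kf * (A / a i)\<^sup>2 * BP"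
        proof (cases "\<Psi> (d i * x) = 0")
          case False
          then have "\<bar>f (x / \<gamma> i) - f0\<bar> \<le> Kf * (A / a i)\<^sup>2" using f_near_level[OF ai, of x] by (simp add: d_def)
          then show ?thesis unfolding abs_mult using Psi_nonneg Psi_le Kf_nonneg by (intro mult_mono) auto
        qed (use Kf_nonneg BP_nonneg in simp)
        have "q i x - c * f0 * \<Psi> (c * x) = d i * ((f (x / \<gamma> i) - f0) * \<Psi> (d i * x)) + d i * f0 * (\<Psi> (d i * x) - \<Psi> (c * x)) + (d i - c) * (f0 * \<Psi> (c * x))"
          by (simp add: q_def d_def algebra_simps)
        then have "\<bar>q i x - c * f0 * \<Psi> (c * x)\<bar> \<le> \<bar>d i * ((f (x / \<gamma> i) - f0) * \<Psi> (d i * x))\<bar> + \<bar>d i * f0 * (\<Psi> (d i * x) - \<Psi> (c * x))\<bar> + \<bar>(d i - c) * (f0 * \<Psi> (c * x))\<bar>"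
          by linarith
        also have "\<dots> \<le> d i * (Kf * (A / a i)\<^sup>2 * BP) + 2 * c * f0 * \<epsilon> + \<bar>d i - c\<bar> * (f0 * BP)"
        proof (intro add_mono)
          show "\<bar>d i * ((f (x / \<gamma> i) - f0) * \<Psi> (d i * x))\<bar> \<le> d i * (Kf * (A / a i)\<^sup>2 * BP)"
            unfolding abs_mult[of "d i"] using t1 dpos[of i] by (intro mult_mono) auto
          show "\<bar>d i * f0 * (\<Psi> (d i * x) - \<Psi> (c * x))\<bar> \<le> 2 * c * f0 * \<epsilon>"
            unfolding abs_mult[of "d i * f0"] using om d2 dpos[of i] f0_nonneg c_pos by (intro mult_mono) (auto simp: abs_mult intro!: mult_right_mono)
          show "\<bar>(d i - c) * (f0 * \<Psi> (c * x))\<bar> \<le> \<bar>d i - c\<bar> * (f0 * BP)"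
            unfolding abs_mult[of "d i - c"] using f0_nonneg Psi_nonneg Psi_le by (intro mult_left_mono) (auto simp: abs_mult intro!: mult_left_mono)
        qed
        also have "\<dots> = E i + 2 * c * f0 * \<epsilon>" by (simp add: E_def)
        also have "2 * c * f0 * \<epsilon> \<le> (2 * c * f0 + 1) * \<epsilon>" using eps by (simp add: distrib_right)
        also have "(2 * c * f0 + 1) * \<epsilon> = e / 2" using den unfolding \<epsilon>_def by (metis (no_types) less_irrefl mult.commute nonzero_mult_divide_mult_cancel_left times_divide_eq_right)
        finally show "dist (q i x) (c * f0 * \<Psi> (c * x)) < e" using elim(1) by (simp add: dist_real_def)
      qed
    qed
  qed
  \<comment> \<open>The limit above was taken on [-L, L] because translates of [-pi, pi] by 2 pi n
    with |n| \<le> p stay inside it.\<close>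
  have shift: "uniform_limit {-pi..pi} (\<lambda>i x. q i (x + 2 * pi * of_int n)) (\<lambda>x. c * f0 * \<Psi> (c * (x + 2 * pi * of_int n))) sequentially" if n: "n \<in> {-p..p}" for n
  proof (rule uniform_limit_compose'[OF qunif])
    show "(\<lambda>x. x + 2 * pi * of_int n) \<in> {-pi..pi} \<rightarrow> {-L..L}"
    proof
      fix x assume x: "x \<in> {-pi..pi}"
      have "real_of_int (- p) \<le> of_int n" "real_of_int n \<le> of_int p" using n by (simp_all only: of_int_le_iff atLeastAtMost_iff)
      then have n2: "2 * pi * of_int (- p) \<le> 2 * pi * of_int n" "2 * pi * of_int n \<le> 2 * pi * of_int p"
        by (intro mult_left_mono; simp)+
      have "2 * pi * of_int (- p) = - (2 * pi * of_int p)" "L = 2 * pi * of_int p + pi" by (simp_all add: L_def algebra_simps)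
      then show "x + 2 * pi * of_int n \<in> {-L..L}" using x n2 unfolding atLeastAtMost_iff by linarith
    qed
  qed
  have unif: "uniform_limit {-pi..pi} (qper p) (glim p) sequentially"
    unfolding qper_def[abs_def] glim_def[abs_def] by (rule uniform_limit_finite_sum[OF _ shift]) simp
  have "L * c > A" using LA c_pos A_pos by (simp add: field_simps)
  then have pA: "(2 * of_int p + 1) * pi * c > A" by (simp add: L_def)
  show thesis
  proof (rule that[OF p0 B0 pA _ _ _ _ unif])
    show "\<forall>i\<ge>i0. a i \<ge> 2 * A" using i0 by blast
    show "\<forall>i\<ge>i0. \<forall>x. q i x \<noteq> 0 \<longrightarrow> \<bar>x\<bar> < (2 * of_int p + 1) * pi" using supp unfolding L_def by blast
    show "\<forall>i\<ge>i0. \<forall>x. q i x \<le> B" using qQ QB by (meson order_trans)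
    show "\<forall>i\<ge>i0. \<forall>x. qper p i x \<le> B" using qpB by blast
  qed
qed

section \<open>Toeplitz structure of the covariances at levels with uniform bounds\<close>

context
  fixes p :: int and B :: real and i0 :: nat
  assumes p0: "p \<ge> 0" and B0: "B > 0"
    and supp: "\<And>i x. i \<ge> i0 \<Longrightarrow> q i x \<noteq> 0 \<Longrightarrow> \<bar>x\<bar> < (2 * of_int p + 1) * pi"
    and qB: "\<And>i x. i \<ge> i0 \<Longrightarrow> q i x \<le> B"
    and qpB: "\<And>i x. i \<ge> i0 \<Longrightarrow> qper p i x \<le> B"
begin

lemma qper_meas [measurable]: "qper p i \<in> borel_measurable borel" unfolding qper_def by measurable

lemma qper_nonneg: "qper p i x \<ge> 0" unfolding qper_def by (intro sum_nonneg q_nonneg)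

lemma q_integrable:
  assumes i: "i \<ge> i0" and [measurable]: "g \<in> borel_measurable borel" and g: "\<And>x. \<bar>g x\<bar> \<le> 1"
  shows "integrable lborel (\<lambda>x. q i x * g x)"
proof (rule Bochner_Integration.integrable_bound)
  let ?L = "(2 * of_int p + 1) * pi"
  show "integrable lborel (\<lambda>x. B * indicator {-?L..?L} x)" by (intro integrable_mult_right integrable_real_indicator) (auto simp: emeasure_lborel_Icc_eq)
  show "AE x in lborel. norm (q i x * g x) \<le> norm (B * indicator {-?L..?L} x)"
  proof (rule AE_I2)
    fix x
    show "norm (q i x * g x) \<le> norm (B * indicator {-?L..?L} x)"
    proof (cases "q i x = 0")
      case False
      then have "\<bar>x\<bar> < ?L" using supp i by blast
      then have "x \<in> {-?L..?L}" by auto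
      moreover have "norm (q i x * g x) \<le> B * 1" unfolding norm_mult using qB[OF i] q_nonneg g B0 by (intro mult_mono) auto
      ultimately show ?thesis using B0 by simp
    qed simp
  qed
qed measurable

text \<open>Cosine and sine have period 2 pi at integer frequencies, so \<open>periodization\<close>
  applies. The sine part vanishes by evenness of \<open>q\<close>, which makes the covariances
  themselves the Fourier coefficients of the symbol.\<close>

lemma cov_circ:
  assumes i: "i \<ge> i0"
  shows "cov i n = (LINT x|circ. qper p i x * cos (of_int n * x))"
    and "(LINT x|circ. of_real (qper p i x) * cis (of_int n * x)) = complex_of_real (cov i n)"
proof -
  have per: "cos (of_int n * (x + 2 * pi * of_int k)) = cos (of_int n * x)" "sin (of_int n * (x + 2 * pi * of_int k)) = sin (of_int n * x)" for x :: real and k :: int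
  proof -
    have "of_int n * (x + 2 * pi * of_int k) = of_int n * x + 2 * pi * of_int (n * k)" by (simp add: algebra_simps)
    then show "cos (of_int n * (x + 2 * pi * of_int k)) = cos (of_int n * x)" "sin (of_int n * (x + 2 * pi * of_int k)) = sin (of_int n * x)"
      by (simp_all add: cos_add sin_add cos_int_2pin sin_int_2pin del: of_int_mult)
  qed
  show c: "cov i n = (LINT x|circ. qper p i x * cos (of_int n * x))"
    unfolding cov_def qper_def using supp[OF i] per by (intro periodization q_integrable i) auto
  have "(LINT x|lborel. q i x * sin (of_int n * x)) = (LINT x|circ. qper p i x * sin (of_int n * x))"
    unfolding qper_def using supp[OF i] per by (intro periodization q_integrable i) auto
  moreover have "(LINT x|lborel. q i x * sin (of_int n * x)) = 0"
  proof -
    have "(LINT x|lborel. q i x * sin (of_int n * x)) = (LINT x|lborel. - (q i x * sin (of_int n * x)))"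
      by (subst lborel_integral_real_affine[of "-1" _ 0]) (auto simp: q_even)
    then show ?thesis by simp
  qed
  ultimately have s: "(LINT x|circ. qper p i x * sin (of_int n * x)) = 0" by simp
  have int: "integrable circ (\<lambda>x. qper p i x * g x)" if [measurable]: "g \<in> borel_measurable borel" and g: "\<And>x. \<bar>g x\<bar> \<le> 1" for g
  proof (rule circ.integrable_const_bound[of _ "B * 1"])
    show "AE x in circ. norm (qper p i x * g x) \<le> B * 1"
      unfolding norm_mult using qpB[OF i] qper_nonneg g B0 by (intro AE_I2 mult_mono) auto
  qed measurable
  have "(LINT x|circ. of_real (qper p i x) * cis (of_int n * x)) = (LINT x|circ. of_real (qper p i x * cos (of_int n * x)) + \<i> * of_real (qper p i x * sin (of_int n * x)))"
    by (intro Bochner_Integration.integral_cong refl) (simp add: complex_eq_iff)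
  also have "\<dots> = of_real (LINT x|circ. qper p i x * cos (of_int n * x)) + \<i> * of_real (LINT x|circ. qper p i x * sin (of_int n * x))"
    using int[of "\<lambda>x. cos (of_int n * x)"] int[of "\<lambda>x. sin (of_int n * x)"] by (simp del: of_real_mult)
  finally show "(LINT x|circ. of_real (qper p i x) * cis (of_int n * x)) = complex_of_real (cov i n)" by (simp add: s c)
qed

lemma cov_form_bound:
  assumes i: "i \<ge> i0"
  shows "(\<Sum>k\<in>{1..N}. \<Sum>l\<in>{1..N}. x k * x l * cov i (int k - int l)) \<le> 2 * pi * B * (\<Sum>k\<in>{1..N}. (x k)\<^sup>2)"
  unfolding cov_circ(1)[OF i] by (rule toeplitz_form_bound) (use qper_nonneg qpB[OF i] in auto)

lemma cov_square_mean_limit: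
  assumes unif: "uniform_limit {-pi..pi} (qper p) (glim p) sequentially"
    and J: "filterlim J at_top sequentially" and N: "filterlim N at_top sequentially"
  shows "(\<lambda>j. (\<Sum>k\<in>{1..N j}. \<Sum>l\<in>{1..N j}. (cov (J j) (int k - int l))\<^sup>2) / real (N j)) \<longlonglongrightarrow> 2 * pi * (LINT x|circ. (glim p x)\<^sup>2)"
proof -
  \<comment> \<open>Clipping the level index at \<open>i0\<close> makes the bounds hold for every j,
    as \<open>toeplitz_limit\<close> demands; eventually nothing is changed.\<close>
  define I where "I j = max i0 (J j)" for j
  have I: "filterlim I at_top sequentially"
    by (rule filterlim_at_top_mono[OF J]) (simp add: I_def)
  have Ii: "I j \<ge> i0" for j by (simp add: I_def)
  define C where "C = max B ((2 * of_int p + 1) * (c * f0 * BP))"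
  have cont: "continuous_on S (glim p)" for S
    unfolding glim_def[abs_def] by (intro continuous_intros continuous_on_compose2[OF Psi_cont[of UNIV]]) auto
  have "(\<lambda>j. (\<Sum>k\<in>{1..N j}. \<Sum>l\<in>{1..N j}. (norm (LINT x|circ. of_real (qper p (I j) x) * cis (of_int (int k - int l) * x)))\<^sup>2) / real (N j)) \<longlonglongrightarrow> 2 * pi * (LINT x|circ. (glim p x)\<^sup>2)"
  proof (rule toeplitz_limit[where B=C])
    show "glim p \<in> borel_measurable borel" using cont by (rule borel_measurable_continuous_onI)
    show "\<bar>qper p (I j) x\<bar> \<le> C" for j x using qper_nonneg[of "I j" x] qpB[OF Ii, of j x] by (simp add: C_def)
    show "\<bar>glim p x\<bar> \<le> C" for x
    proof -
      have "glim p x \<le> (\<Sum>n\<in>{-p..p}. c * f0 * BP)"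
        unfolding glim_def using Psi_le c_pos f0_nonneg by (intro sum_mono mult_left_mono) auto
      also have "\<dots> = (2 * of_int p + 1) * (c * f0 * BP)" using p0 by simp
      finally have "glim p x \<le> C" by (simp add: C_def)
      moreover have "glim p x \<ge> 0" unfolding glim_def using Psi_nonneg c_pos f0_nonneg by (intro sum_nonneg) auto
      ultimately show ?thesis by simp
    qed
    show "uniform_limit {-pi..pi} (\<lambda>j. qper p (I j)) (glim p) sequentially" by (rule filterlim_compose[OF unif I])
  qed (use cont N in auto)
  then have "(\<lambda>j. (\<Sum>k\<in>{1..N j}. \<Sum>l\<in>{1..N j}. (cov (I j) (int k - int l))\<^sup>2) / real (N j)) \<longlonglongrightarrow> 2 * pi * (LINT x|circ. (glim p x)\<^sup>2)"
    unfolding cov_circ(2)[OF Ii] by simp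
  moreover have "\<forall>\<^sub>F j in sequentially. I j = J j"
    using J[unfolded filterlim_at_top, rule_format, of i0] by eventually_elim (simp add: I_def)
  then have "\<forall>\<^sub>F j in sequentially. (\<Sum>k\<in>{1..N j}. \<Sum>l\<in>{1..N j}. (cov (I j) (int k - int l))\<^sup>2) / real (N j) = (\<Sum>k\<in>{1..N j}. \<Sum>l\<in>{1..N j}. (cov (J j) (int k - int l))\<^sup>2) / real (N j)"
    by eventually_elim simp
  ultimately show ?thesis by (rule Lim_transform_eventually)
qed

end

text \<open>For |\<eta>| \<le> c pi and |n| > p the argument of \<open>\<Psi>\<close> has modulus at
  least (2 p + 1) pi c > A, so the infinite sum is the finite one. The substitution \<eta> = c x
  costs one factor \<open>c\<close> of the square (c f0)^2.\<close>

lemma glim_integral: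
  assumes p0: "p \<ge> 0" and pA: "(2 * of_int p + 1) * pi * c > A"
  shows "2 * pi * (LINT x|circ. (glim p x)\<^sup>2)
    = 2 * pi * c * f0\<^sup>2 * (LINT \<eta>:{-c*pi..c*pi}|lborel. (\<bar>\<Sum>\<^sub>\<infinity>n::int. \<Psi> (\<eta> + 2 * real_of_int n * c * pi)\<bar>)\<^sup>2)"
proof -
  define H where "H \<eta> = (\<Sum>n\<in>{-p..p}. \<Psi> (\<eta> + 2 * real_of_int n * c * pi))" for \<eta>
  have inf: "(\<Sum>\<^sub>\<infinity>n::int. \<Psi> (\<eta> + 2 * real_of_int n * c * pi)) = H \<eta>" if eta: "\<eta> \<in> {-c*pi..c*pi}" for \<eta>
  proof -
    have "(\<Sum>\<^sub>\<infinity>n::int. \<Psi> (\<eta> + 2 * real_of_int n * c * pi)) = (\<Sum>\<^sub>\<infinity>n\<in>{-p..p}. \<Psi> (\<eta> + 2 * real_of_int n * c * pi))"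
    proof (rule infsum_cong_neutral)
      fix n :: int assume "n \<in> UNIV - {-p..p}"
      then have "\<bar>n\<bar> \<ge> p + 1" by auto
      then have "real_of_int (p + 1) \<le> \<bar>real_of_int n\<bar>" by (simp only: of_int_abs[symmetric] of_int_le_iff)
      then have "2 * (c * pi) * real_of_int (p + 1) \<le> 2 * (c * pi) * \<bar>real_of_int n\<bar>" using c_pos by (intro mult_left_mono) auto
      also have "\<dots> = \<bar>2 * real_of_int n * c * pi\<bar>" using c_pos by (simp add: abs_mult)
      finally have "2 * (c * pi) * (of_int p + 1) \<le> \<bar>2 * real_of_int n * c * pi\<bar>" by simp
      moreover have "\<bar>\<eta>\<bar> \<le> c * pi" using eta by auto
      moreover have "2 * (c * pi) * (of_int p + 1) - c * pi = (2 * of_int p + 1) * pi * c" by (simp add: algebra_simps)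
      ultimately have "\<bar>\<eta> + 2 * real_of_int n * c * pi\<bar> > A" using pA by linarith
      then show "\<Psi> (\<eta> + 2 * real_of_int n * c * pi) = 0" by (rule Psi_supp)
    qed auto
    then show ?thesis by (simp add: H_def)
  qed
  have H0: "H \<eta> \<ge> 0" for \<eta> unfolding H_def by (intro sum_nonneg Psi_nonneg)
  have Hm [measurable]: "H \<in> borel_measurable borel" unfolding H_def by measurable
  have "glim p x = c * f0 * H (c * x)" for x
    unfolding glim_def H_def sum_distrib_left by (intro sum.cong refl arg_cong[where f="\<lambda>z. c * f0 * \<Psi> z"]) (simp add: algebra_simps)
  then have "(LINT x|circ. (glim p x)\<^sup>2) = (LINT x|circ. (c * f0)\<^sup>2 * (H (c * x))\<^sup>2)" by (simp add: power_mult_distrib)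
  also have "\<dots> = (c * f0)\<^sup>2 * (LINT x|lborel. indicator {-pi..pi} x *\<^sub>R (H (c * x))\<^sup>2)"
    by (subst integral_mult_right_zero, subst circ_integral) auto
  also have "(LINT x|lborel. indicator {-pi..pi} x *\<^sub>R (H (c * x))\<^sup>2) = (1 / c) * (LINT \<eta>|lborel. indicator {-c*pi..c*pi} \<eta> *\<^sub>R (H \<eta>)\<^sup>2)"
  proof -
    have "(LINT \<eta>|lborel. indicator {-c*pi..c*pi} \<eta> *\<^sub>R (H \<eta>)\<^sup>2) = c * (LINT x|lborel. indicator {-c*pi..c*pi} (0 + c * x) *\<^sub>R (H (0 + c * x))\<^sup>2)"
      using c_pos by (subst lborel_integral_real_affine[of c _ 0]) auto
    also have "(\<lambda>x. indicator {-c*pi..c*pi} (0 + c * x) *\<^sub>R (H (0 + c * x))\<^sup>2) = (\<lambda>x. indicator {-pi..pi} x *\<^sub>R (H (c * x))\<^sup>2)"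
    proof
      fix x
      have "c * x \<in> {-c*pi..c*pi} \<longleftrightarrow> x \<in> {-pi..pi}"
      proof -
        have "- c * pi \<le> c * x \<longleftrightarrow> c * (- pi) \<le> c * x" by simp
        then show ?thesis using c_pos by (simp only: atLeastAtMost_iff mult_le_cancel_left_pos)
      qed
      then show "indicator {-c*pi..c*pi} (0 + c * x) *\<^sub>R (H (0 + c * x))\<^sup>2 = indicator {-pi..pi} x *\<^sub>R (H (c * x))\<^sup>2"
        by (simp add: indicator_def)
    qed
    finally show ?thesis using c_pos by simp
  qed
  also have "(LINT \<eta>|lborel. indicator {-c*pi..c*pi} \<eta> *\<^sub>R (H \<eta>)\<^sup>2) = (LINT \<eta>:{-c*pi..c*pi}|lborel. (\<bar>\<Sum>\<^sub>\<infinity>n::int. \<Psi> (\<eta> + 2 * real_of_int n * c * pi)\<bar>)\<^sup>2)"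
    unfolding set_lebesgue_integral_def using inf by (intro Bochner_Integration.integral_cong refl) (auto simp: indicator_def)
  finally show ?thesis using c_pos by (simp add: power2_eq_square)
qed

end

text \<open>For positive variance the identity on the normal law is itself a centred Gaussian
  variable, so the earlier computation is reused; zero variance is a point mass.\<close>

lemma gaussian_law_char:
  assumes v: "v \<ge> 0"
  shows "real_distribution (gaussian_law 0 v)" "char (gaussian_law 0 v) t = of_real (exp (- v * t\<^sup>2 / 2))"
proof -
  have "real_distribution (gaussian_law 0 v) \<and> char (gaussian_law 0 v) t = of_real (exp (- v * t\<^sup>2 / 2))"
  proof (cases "v = 0")
    case True
    have "prob_space (return borel (0::real))" by (rule prob_space_return) simp
    then show ?thesis using True
      by (auto simp: gaussian_law_def real_distribution_def real_distribution_axioms_def char_def integral_return)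
  next
    case False
    then have s: "sqrt v > 0" using v by simp
    let ?N = "density lborel (normal_density 0 (sqrt v))"
    interpret N: prob_space ?N by (rule prob_space_normal_density[OF s])
    have D: "distributed ?N lborel (\<lambda>x. x) (normal_density 0 (sqrt v))"
      unfolding distributed_def by (auto simp: distr_id2)
    have g: "real_gaussian_rv ?N (\<lambda>x. x)"
      unfolding real_gaussian_rv_def using D s by (intro conjI exI[of _ 0] exI[of _ "sqrt v"] disjI2) auto
    have m: "N.expectation (\<lambda>x. x) = 0" by (rule N.normal_distributed_expectation[OF s D])
    have "N.expectation (\<lambda>x. x\<^sup>2) = v" using N.normal_distributed_variance[OF s D] m v by simp
    then have "(LINT x|?N. cis (t * x)) = of_real (exp (- v * t\<^sup>2 / 2))"
      using N.centred_gaussian_rv_cf(2)[OF g m, of t] by (simp add: mult.commute)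
    moreover have "real_distribution ?N"
      unfolding real_distribution_def real_distribution_axioms_def using N.prob_space_axioms by auto
    ultimately show ?thesis using False by (simp add: gaussian_law_def char_def cis_conv_exp)
  qed
  then show "real_distribution (gaussian_law 0 v)" "char (gaussian_law 0 v) t = of_real (exp (- v * t\<^sup>2 / 2))" by auto
qed

section \<open>Variance expansion at lag zero and separation of the frequency bands\<close>

context wavelet_levels
begin

lemma Psi_poly_integrable: "integrable lborel (\<lambda>\<eta>. \<eta> ^ k * \<Psi> \<eta>)"
proof (rule Bochner_Integration.integrable_bound)
  show "integrable lborel (\<lambda>\<eta>. A ^ k * BP * indicator {-A..A} \<eta>)"
    by (intro integrable_mult_right integrable_real_indicator) (auto simp: emeasure_lborel_Icc_eq)
  show "AE \<eta> in lborel. norm (\<eta> ^ k * \<Psi> \<eta>) \<le> norm (A ^ k * BP * indicator {-A..A} \<eta>)"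
  proof (rule AE_I2)
    fix \<eta>
    show "norm (\<eta> ^ k * \<Psi> \<eta>) \<le> norm (A ^ k * BP * indicator {-A..A} \<eta>)"
    proof (cases "\<bar>\<eta>\<bar> > A")
      case False
      then have "\<bar>\<eta>\<bar> ^ k * \<Psi> \<eta> \<le> A ^ k * BP" using Psi_nonneg Psi_le A_pos by (intro mult_mono power_mono) auto
      then show ?thesis using False Psi_nonneg A_pos BP_nonneg by (auto simp: abs_mult power_abs indicator_def)
    qed (simp add: Psi_supp)
  qed
qed measurable

text \<open>At lag zero the grid step drops out: the substitution \<eta> = a i / \<gamma> i * x
  absorbs it.\<close>

lemma cov_zero: "cov i 0 = (LINT \<eta>|lborel. f (\<eta> / a i) * \<Psi> \<eta>)"
proof -
  have ag: "a i > 0" "\<gamma> i > 0" by (rule a_pos g_pos)+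
  have "(LINT \<eta>|lborel. f (\<eta> / a i) * \<Psi> \<eta>) = \<bar>a i / \<gamma> i\<bar> *\<^sub>R (LINT x|lborel. f ((0 + a i / \<gamma> i * x) / a i) * \<Psi> (0 + a i / \<gamma> i * x))"
    using ag by (intro lborel_integral_real_affine) auto
  also have "\<dots> = (LINT x|lborel. q i x)" using ag by (simp add: q_def mult.assoc)
  finally show ?thesis by (simp add: cov_def)
qed

text \<open>On the support of \<open>\<Psi>\<close> the argument \<eta> / a i is at most 1/2, so the
  expansion of \<open>f\<close> can be integrated term by term against
  \<open>\<Psi>\<close>.\<close>

lemma cov_zero_expansion:
  assumes f4: "\<And>u. \<bar>u\<bar> \<le> 1/2 \<Longrightarrow> \<bar>f u - f0 - f2 * u\<^sup>2\<bar> \<le> K4 * u ^ 4"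
    and ai: "a i \<ge> 2 * A"
  shows "\<bar>cov i 0 - f0 * (LINT \<eta>|lborel. \<Psi> \<eta>) - f2 * (LINT \<eta>|lborel. \<eta>\<^sup>2 * \<Psi> \<eta>) / (a i)\<^sup>2\<bar> \<le> K4 * (LINT \<eta>|lborel. \<eta> ^ 4 * \<Psi> \<eta>) / (a i) ^ 4"
proof -
  have ap: "a i > 0" by (rule a_pos)
  have pw: "\<bar>f (\<eta> / a i) * \<Psi> \<eta> - f0 * \<Psi> \<eta> - f2 / (a i)\<^sup>2 * (\<eta>\<^sup>2 * \<Psi> \<eta>)\<bar> \<le> K4 / (a i) ^ 4 * (\<eta> ^ 4 * \<Psi> \<eta>)" for \<eta>
  proof (cases "\<bar>\<eta>\<bar> > A")
    case False
    have "\<bar>\<eta> / a i\<bar> \<le> 1/2" using False ai ap A_pos by (simp add: field_simps)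
    then have "\<bar>f (\<eta> / a i) - f0 - f2 * (\<eta> / a i)\<^sup>2\<bar> * \<Psi> \<eta> \<le> K4 * (\<eta> / a i) ^ 4 * \<Psi> \<eta>"
      using Psi_nonneg by (intro mult_right_mono f4) auto
    moreover have "\<bar>f (\<eta> / a i) - f0 - f2 * (\<eta> / a i)\<^sup>2\<bar> * \<Psi> \<eta> = \<bar>(f (\<eta> / a i) - f0 - f2 * (\<eta> / a i)\<^sup>2) * \<Psi> \<eta>\<bar>"
      using Psi_nonneg by (simp add: abs_mult)
    moreover have "(f (\<eta> / a i) - f0 - f2 * (\<eta> / a i)\<^sup>2) * \<Psi> \<eta> = f (\<eta> / a i) * \<Psi> \<eta> - f0 * \<Psi> \<eta> - f2 / (a i)\<^sup>2 * (\<eta>\<^sup>2 * \<Psi> \<eta>)"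
      by (simp add: left_diff_distrib power_divide)
    ultimately show ?thesis by (simp add: power_divide)
  qed (simp add: Psi_supp)
  have i0: "integrable lborel \<Psi>" using Psi_poly_integrable[of 0] by simp
  have i2: "integrable lborel (\<lambda>\<eta>. \<eta>\<^sup>2 * \<Psi> \<eta>)" and i4: "integrable lborel (\<lambda>\<eta>. \<eta> ^ 4 * \<Psi> \<eta>)" by (rule Psi_poly_integrable)+
  have idiff: "integrable lborel (\<lambda>\<eta>. f (\<eta> / a i) * \<Psi> \<eta> - f0 * \<Psi> \<eta> - f2 / (a i)\<^sup>2 * (\<eta>\<^sup>2 * \<Psi> \<eta>))"
    by (rule Bochner_Integration.integrable_bound[OF integrable_mult_right[OF i4, of "K4 / (a i) ^ 4"]])
       (use pw order_trans[OF pw abs_ge_self] in auto)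
  \<comment> \<open>Integrability is read off backwards: the expansion error is dominated by an
    integrable function, and so are the subtracted terms.\<close>
  have ifp: "integrable lborel (\<lambda>\<eta>. f (\<eta> / a i) * \<Psi> \<eta>)"
    using Bochner_Integration.integrable_add[OF Bochner_Integration.integrable_add[OF idiff integrable_mult_right[OF i0, of f0]] integrable_mult_right[OF i2, of "f2 / (a i)\<^sup>2"]]
    by simp
  have e1: "cov i 0 - f0 * (LINT \<eta>|lborel. \<Psi> \<eta>) - f2 * (LINT \<eta>|lborel. \<eta>\<^sup>2 * \<Psi> \<eta>) / (a i)\<^sup>2
    = (LINT \<eta>|lborel. f (\<eta> / a i) * \<Psi> \<eta> - f0 * \<Psi> \<eta> - f2 / (a i)\<^sup>2 * (\<eta>\<^sup>2 * \<Psi> \<eta>))"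
    unfolding cov_zero using i0 i2 ifp integrable_mult_right[OF i0, of f0] integrable_mult_right[OF i2, of "f2 / (a i)\<^sup>2"]
    by (subst Bochner_Integration.integral_diff, simp, simp, subst Bochner_Integration.integral_diff, simp, simp) simp
  have e2: "norm (LINT \<eta>|lborel. f (\<eta> / a i) * \<Psi> \<eta> - f0 * \<Psi> \<eta> - f2 / (a i)\<^sup>2 * (\<eta>\<^sup>2 * \<Psi> \<eta>)) \<le> (LINT \<eta>|lborel. K4 / (a i) ^ 4 * (\<eta> ^ 4 * \<Psi> \<eta>))"
    using idiff i4 pw by (intro norm_integral_le_integral) auto
  have "(LINT \<eta>|lborel. K4 / (a i) ^ 4 * (\<eta> ^ 4 * \<Psi> \<eta>)) = K4 * (LINT \<eta>|lborel. \<eta> ^ 4 * \<Psi> \<eta>) / (a i) ^ 4" by simp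
  then show ?thesis unfolding e1 using e2 by (simp only: real_norm_def)
qed

text \<open>The two normalisations combine to the factor \<open>a i\<close>, the translations to the
  phase of frequency \<gamma> i n, and the remaining product is \<open>\<Psi>\<close>. The
  substitution u = x / \<gamma> i then produces \<open>q\<close>.\<close>

lemma cov_fourier:
  assumes b: "b k - b l = \<gamma> i * of_int n"
  shows "(LINT u|lborel. f u * Re (fourier_tr (\<lambda>t. a i powr (-1/2) * \<psi> ((t - b k) / a i)) u
            * cnj (fourier_tr (\<lambda>t. a i powr (-1/2) * \<psi> ((t - b l) / a i)) u))) = cov i n"
proof -
  have ag: "a i > 0" "\<gamma> i > 0" by (rule a_pos g_pos)+
  have e: "f u * Re (fourier_tr (\<lambda>t. a i powr (-1/2) * \<psi> ((t - b k) / a i)) u * cnj (fourier_tr (\<lambda>t. a i powr (-1/2) * \<psi> ((t - b l) / a i)) u))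
     = f u * a i * \<Psi> (a i * u) * cos (\<gamma> i * of_int n * u)" for u
  proof -
    define z where "z = fourier_tr \<psi> (a i * u)"
    have "fourier_tr (\<lambda>t. a i powr (-1/2) * \<psi> ((t - b k) / a i)) u * cnj (fourier_tr (\<lambda>t. a i powr (-1/2) * \<psi> ((t - b l) / a i)) u)
      = of_real (a i powr (1/2) * a i powr (1/2)) * ((cis (- u * b k) * cnj (cis (- u * b l))) * (z * cnj z))"
      unfolding fourier_tr_wavelet[OF ag(1)] z_def by simp
    also have "a i powr (1/2) * a i powr (1/2) = a i" using ag by (simp flip: powr_add)
    also have "cis (- u * b k) * cnj (cis (- u * b l)) = cis (- (\<gamma> i * of_int n * u))"
    proof -
      have "- u * b k + u * b l = - (\<gamma> i * of_int n * u)" using b by (simp add: algebra_simps)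
      then show ?thesis by (simp add: cis_cnj cis_mult)
    qed
    also have "z * cnj z = of_real (\<Psi> (a i * u))" unfolding \<Psi>_def z_def complex_norm_square ..
    finally show ?thesis by simp
  qed
  have "(LINT u|lborel. f u * a i * \<Psi> (a i * u) * cos (\<gamma> i * of_int n * u))
     = \<bar>1 / \<gamma> i\<bar> *\<^sub>R (LINT x|lborel. f (0 + 1 / \<gamma> i * x) * a i * \<Psi> (a i * (0 + 1 / \<gamma> i * x)) * cos (\<gamma> i * of_int n * (0 + 1 / \<gamma> i * x)))"
    using ag by (intro lborel_integral_real_affine) auto
  also have "\<dots> = (LINT x|lborel. \<bar>1 / \<gamma> i\<bar> *\<^sub>R (f (0 + 1 / \<gamma> i * x) * a i * \<Psi> (a i * (0 + 1 / \<gamma> i * x)) * cos (\<gamma> i * of_int n * (0 + 1 / \<gamma> i * x))))"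
    by (rule integral_scaleR_right[symmetric])
  also have "\<dots> = cov i n"
    unfolding cov_def q_def using ag by (intro Bochner_Integration.integral_cong refl) simp
  finally show ?thesis unfolding e .
qed

text \<open>One factor lives on |u| \<ge> B / a i, the other on |u| \<le> A / a i', and the growth
  ratio gives A / a i' \<le> B / a i. The bands can meet only in the two points of modulus B / a i,
  which are null.\<close>

lemma Psi_disjoint:
  assumes B: "0 < B" "B < A" and low: "\<And>\<xi>. \<bar>\<xi>\<bar> < B \<Longrightarrow> fourier_tr \<psi> \<xi> = 0" and ratio: "a i' / a i \<ge> A / B"
  shows "AE u in lborel. fourier_tr \<psi> (a i * u) * cnj (fourier_tr \<psi> (a i' * u)) = 0"
proof -
  have "AE u in lborel. u \<noteq> B / a i" "AE u in lborel. u \<noteq> - (B / a i)" by (rule AE_lborel_singleton)+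
  then show ?thesis
  proof eventually_elim
    case (elim u)
    have ap: "a i > 0" "a i' > 0" by (rule a_pos)+
    show ?case
    proof (rule ccontr)
      assume nz: "fourier_tr \<psi> (a i * u) * cnj (fourier_tr \<psi> (a i' * u)) \<noteq> 0"
      then have 1: "\<bar>a i * u\<bar> \<ge> B" and 2: "\<bar>a i' * u\<bar> \<le> A" using low psi_supp by (force, force)
      have "a i' \<ge> A / B * a i" using ratio ap by (simp add: pos_le_divide_eq)
      then have "A / B * a i * \<bar>u\<bar> \<le> a i' * \<bar>u\<bar>" by (intro mult_right_mono) auto
      also have "\<dots> \<le> A" using 2 ap by (simp add: abs_mult)
      finally have "a i * \<bar>u\<bar> \<le> B" using B by (simp add: field_simps)
      then have "a i * \<bar>u\<bar> = B" using 1 ap by (simp add: abs_mult)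
      then have "\<bar>u\<bar> = B / a i" using ap by (simp add: field_simps)
      then show False using elim by (auto simp: abs_if split: if_splits)
    qed
  qed
qed

end

locale wavelet_process = SP: spectral_gaussian_process M X f + wavelet_levels \<psi> A f f0 Kf a \<gamma> c
  for M :: "'a measure" and X \<psi> A f f0 Kf a \<gamma> c +
  fixes b :: "nat \<Rightarrow> int \<Rightarrow> real" and B :: real
  assumes b: "\<And>j k l. b j k - b j l = \<gamma> j * real_of_int (k - l)"
    and B: "0 < B" "B < A" and low: "\<And>\<xi>. \<bar>\<xi>\<bar> < B \<Longrightarrow> fourier_tr \<psi> \<xi> = 0"
begin

lemma wcoef_functional:
  "wcoef \<psi> X a b i k \<omega> = (LINT t|lborel. (a i powr (-1/2) * \<psi> ((t - b i k) / a i)) * X t \<omega>)"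
  unfolding wcoef_def mult.assoc integral_mult_right_zero ..

lemma wcoef_measurable [measurable]: "wcoef \<psi> X a b i k \<in> borel_measurable M"
  unfolding wcoef_functional[abs_def] by (rule SP.kernel_measurable[OF wavelet_integrable[OF psi a_pos]])

text \<open>Both levels form one Gaussian family over a disjoint union of index sets, with sign -1
  on the second copy. Disjoint bands make its covariance matrix block diagonal, so the form bounds
  and the square sums of the blocks add up without mixed terms; separate independence statements are
  avoided.\<close>

theorem two_level_cf:
  fixes N i i' :: nat and \<rho> C t :: real
  assumes ratio: "a i' / a i \<ge> A / B" and C: "C > 0"
    and Ci: "\<And>x. (\<Sum>k\<in>{1..N}. \<Sum>l\<in>{1..N}. x k * x l * cov i (int k - int l)) \<le> C * (\<Sum>k\<in>{1..N}. (x k)\<^sup>2)"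
    and Ci': "\<And>x. (\<Sum>k\<in>{1..N}. \<Sum>l\<in>{1..N}. x k * x l * cov i' (int k - int l)) \<le> C * (\<Sum>k\<in>{1..N}. (x k)\<^sup>2)"
  defines "T \<equiv> \<lambda>\<omega>. \<rho> * ((\<Sum>k\<in>{1..N}. (wcoef \<psi> X a b i (int k) \<omega>)\<^sup>2 - cov i 0) - (\<Sum>k\<in>{1..N}. (wcoef \<psi> X a b i' (int k) \<omega>)\<^sup>2 - cov i' 0))"
    and "v \<equiv> 2 * \<rho>\<^sup>2 * ((\<Sum>k\<in>{1..N}. \<Sum>l\<in>{1..N}. (cov i (int k - int l))\<^sup>2) + (\<Sum>k\<in>{1..N}. \<Sum>l\<in>{1..N}. (cov i' (int k - int l))\<^sup>2))"
  shows "norm ((LINT \<omega>|M. cis (t * T \<omega>)) - of_real (exp (- v * t\<^sup>2 / 2)))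
      \<le> 4 * \<bar>\<rho>\<bar>^3 * C\<^sup>2 * (real N * (cov i 0 + cov i' 0)) * \<bar>t\<bar>^3 * exp (\<bar>v\<bar> * t\<^sup>2)"
proof -
  define I where "I = {1..N} <+> {1..N}"
  define lev where "lev = case_sum (\<lambda>_::nat. i) (\<lambda>_::nat. i')"
  define pos where "pos = case_sum (\<lambda>k::nat. int k) (\<lambda>k::nat. int k)"
  define \<epsilon> where "\<epsilon> = case_sum (\<lambda>_::nat. 1::real) (\<lambda>_::nat. -1)"
  define w where "w x t = a (lev x) powr (-1/2) * \<psi> ((t - b (lev x) (pos x)) / a (lev x))" for x t
  define S where "S x y = (LINT u|lborel. f u * Re (fourier_tr (w x) u * cnj (fourier_tr (w y) u)))" for x y
  define Y where "Y x \<omega> = (LINT t|lborel. w x t * X t \<omega>)" for x \<omega>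
  have wi: "integrable lborel (w x)" for x
    unfolding w_def[abs_def] by (rule wavelet_integrable[OF psi a_pos])
  have "gaussian_family M I (\<lambda>k \<omega>. LINT t|lborel. w k t * X t \<omega>) (\<lambda>k l. LINT u|lborel. f u * Re (fourier_tr (w k) u * cnj (fourier_tr (w l) u)))"
    by (rule SP.gaussian_family_functionals) (auto simp: I_def wi)
  then have "gaussian_family M I Y S" unfolding Y_def[abs_def] S_def[abs_def] .
  then interpret GF: gaussian_family M I Y S .
  have Yl: "Y (Inl k) \<omega> = wcoef \<psi> X a b i (int k) \<omega>" "Y (Inr k) \<omega> = wcoef \<psi> X a b i' (int k) \<omega>" for k \<omega>
    by (simp_all add: Y_def w_def lev_def pos_def wcoef_functional)
  have Sll: "S (Inl k) (Inl l) = cov i (int k - int l)" "S (Inr k) (Inr l) = cov i' (int k - int l)" for k l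
    using cov_fourier[of "\<lambda>k. b i (int k)" k l i "int k - int l"] cov_fourier[of "\<lambda>k. b i' (int k)" k l i' "int k - int l"] b
    by (simp_all add: S_def w_def[abs_def] lev_def pos_def)
  have Slr: "S (Inl k) (Inr l) = 0" for k l
  proof -
    have dis: "AE u in lborel. fourier_tr \<psi> (a i * u) * cnj (fourier_tr \<psi> (a i' * u)) = 0"
      by (rule Psi_disjoint[OF B _ ratio]) (rule low)
    have "AE u in lborel. f u * Re (fourier_tr (w (Inl k)) u * cnj (fourier_tr (w (Inr l)) u)) = 0"
      using dis
    proof eventually_elim
      case (elim u)
      have "fourier_tr (w (Inl k)) u * cnj (fourier_tr (w (Inr l)) u) = 0"
        using elim unfolding w_def[abs_def] fourier_tr_wavelet[OF a_pos] by (auto simp: lev_def pos_def)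
      then show ?case by (simp only:) simp
    qed
    then show ?thesis unfolding S_def by (rule integral_eq_zero_AE)
  qed
  have Srl: "S (Inr k) (Inl l) = 0" for k l using Slr GF.S_sym by metis
  have fin: "finite {1..N}" by simp
  have form: "(\<Sum>k\<in>I. \<Sum>l\<in>I. x k * x l * S k l) \<le> C * (\<Sum>k\<in>I. (x k)\<^sup>2)" for x
    using Ci[of "\<lambda>k. x (Inl k)"] Ci'[of "\<lambda>k. x (Inr k)"]
    by (simp add: I_def sum.Plus Sll Slr Srl distrib_left)
  have T: "T \<omega> = \<rho> * (\<Sum>k\<in>I. \<epsilon> k * ((Y k \<omega>)\<^sup>2 - S k k))" for \<omega>
    by (simp add: T_def I_def sum.Plus Yl Sll \<epsilon>_def sum_negf sum_subtractf)
  have v: "v = 2 * \<rho>\<^sup>2 * (\<Sum>k\<in>I. \<Sum>l\<in>I. \<epsilon> k * \<epsilon> l * (S k l)\<^sup>2)"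
    by (simp add: v_def I_def sum.Plus Sll Slr Srl \<epsilon>_def)
  have tr: "(\<Sum>k\<in>I. S k k) = real N * (cov i 0 + cov i' 0)"
    by (simp add: I_def sum.Plus Sll distrib_left)
  have "\<bar>\<epsilon> k\<bar> \<le> 1" for k by (cases k) (auto simp: \<epsilon>_def)
  from GF.quadratic_form_cf_bound[OF form C this, of t \<rho>]
  show ?thesis unfolding T[abs_def] v tr .
qed

end

subsection \<open>The limit theorem\<close>

theorem theorem3:
  fixes M :: "'a measure" and X :: "real \<Rightarrow> 'a \<Rightarrow> real"
    and h :: "real \<Rightarrow> real" and s0 \<alpha> :: real
    and \<psi> :: "real \<Rightarrow> real" and A B :: real
    and a :: "nat \<Rightarrow> real" and m :: "nat \<Rightarrow> nat" and b :: "nat \<Rightarrow> int \<Rightarrow> real"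
    and \<gamma> :: "nat \<Rightarrow> real" and c :: real
  assumes prob: "prob_space M"
    and s0: "s0 > 1" and alpha: "0 < \<alpha>" "\<alpha> < 1/2"
    \<comment> \<open>conditions on h\<close>
    and h_even: "\<And>u. h (- u) = h u"
    and h_nonneg: "\<And>u. h u \<ge> 0"
    and h_bdd: "bounded (range h)"
    and h_diff: "\<And>i x. i < 4 \<Longrightarrow> (deriv ^^ i) h differentiable (at x)"
    and h_C4: "continuous_on UNIV ((deriv ^^ 4) h)"
    and h_deriv0: "\<And>i. 1 \<le> i \<Longrightarrow> i \<le> 4 \<Longrightarrow> (deriv ^^ i) h 0 = 0"
    and h_0: "h 0 = 1"
    and h_pos: "\<exists>e>0. \<forall>u. \<bar>\<bar>u\<bar> - s0\<bar> < e \<longrightarrow> h u > 0"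
    and h_int: "\<And>\<epsilon>. \<epsilon> > 0 \<Longrightarrow> integrable lborel (\<lambda>u. h u * (1 + \<bar>u\<bar>) powr (- \<epsilon>))"
    \<comment> \<open>the process X\<close>
    and X_meas: "(\<lambda>(t, \<omega>). X t \<omega>) \<in> borel_measurable (lborel \<Otimes>\<^sub>M M)"
    and X_gauss: "gaussian_process M X"
    and X_mean: "\<And>t. integrable M (X t) \<and> prob_space.expectation M (X t) = 0"
    and X_cov: "\<And>t s. complex_of_real (prob_space.expectation M (\<lambda>\<omega>. X t \<omega> * X s \<omega>))
                  = (LINT u|lborel. cis (u * (t - s)) * complex_of_real (spec_dens h s0 \<alpha> u))"
    and X_msc: "\<And>t. ((\<lambda>s. prob_space.expectation M (\<lambda>\<omega>. (X s \<omega> - X t \<omega>)\<^sup>2)) \<longlongrightarrow> 0) (at t)"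
    \<comment> \<open>the wavelet psi\<close>
    and psi_L1: "integrable lborel \<psi>"
    and A_pos: "A > 0"
    and psi_supp: "\<And>\<xi>. \<bar>\<xi>\<bar> > A \<Longrightarrow> fourier_tr \<psi> \<xi> = 0"
    and psi_bv: "bounded_variation_on (fourier_tr \<psi>) (- A) A"
    \<comment> \<open>the sequences\<close>
    and a_pos: "\<And>j. a j > 0" and a_mono: "strict_mono a" and a_unb: "\<not> bdd_above (range a)"
    and m_pos: "\<And>j. m j > 0" and m_mono: "incseq m" and m_unb: "\<not> bdd_above (range m)"
    \<comment> \<open>(i)\<close>
    and cond_i: "0 < B" "B < A" "closure {\<xi>. fourier_tr \<psi> \<xi> \<noteq> 0} \<subseteq> {\<xi>. B \<le> \<bar>\<xi>\<bar> \<and> \<bar>\<xi>\<bar> \<le> A}"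
    \<comment> \<open>(ii)\<close>
    and cond_ii_b: "\<And>j k l. b j k - b j l = \<gamma> j * real_of_int (k - l)"
    and cond_ii_gamma: "\<And>j. \<gamma> j > 0"
    and cond_ii_c: "c > 0" "(\<lambda>j. a j / \<gamma> j) \<longlonglongrightarrow> c"
    and cond_ii_rate: "(\<lambda>j. (real (m j))\<^sup>2 * (a j) ^ 8 * (\<gamma> j / a j - 1 / c)) \<longlonglongrightarrow> 0"
    and cond_ii_j0: "\<exists>j0. \<forall>j\<ge>j0. a (Suc j) / a j \<ge> A / B"
    \<comment> \<open>(iii)\<close>
    and cond_iii: "(\<lambda>j. real (m j) * a j powr (-4)) \<longlonglongrightarrow> 0"
  shows
    "let Mj = (\<lambda>j. nat \<lfloor>real (m j) / (a (j+1) powr (-2) - a (j+2) powr (-2))\<^sup>2\<rfloor>);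
         Delta = (\<lambda>j \<omega>. (wmean2 \<psi> X a b (j+1) (Mj j) \<omega> - wmean2 \<psi> X a b (j+2) (Mj j) \<omega>)
                           / (a (j+1) powr (-2) - a (j+2) powr (-2)));
         Z = (\<lambda>j \<omega>. sqrt (real (m j)) * (Delta j \<omega>
                 - 2 * \<alpha> * s0 powr (-4 * \<alpha> - 2) *
                   (LINT \<eta>|lborel. \<eta>\<^sup>2 * (cmod (fourier_tr \<psi> \<eta>))\<^sup>2)));
         V1 = 4 * c * pi * s0 powr (-8 * \<alpha>) *
              (LINT \<eta>:{-c*pi..c*pi}|lborel.
                 (\<bar>\<Sum>\<^sub>\<infinity>n::int. (cmod (fourier_tr \<psi> (\<eta> + 2 * real_of_int n * c * pi)))\<^sup>2\<bar>)\<^sup>2)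
     in weak_conv_m (\<lambda>j. distr M borel (Z j)) (gaussian_law 0 (2 * V1))"
proof -
  interpret prob_space M by (rule prob)
  define f where "f = spec_dens h s0 \<alpha>"
  define f0 where "f0 = s0 powr (-4 * \<alpha>)"
  define f2 where "f2 = 2 * \<alpha> * s0 powr (-4 * \<alpha> - 2)"
  have h_cont: "continuous_on UNIV h"
    using h_diff[of 0] by (auto intro!: continuous_at_imp_continuous_on differentiable_imp_continuous_within)
  have f_int: "integrable lborel f"
    unfolding f_def by (rule spec_dens_integrable[OF s0 alpha h_cont h_nonneg h_bdd h_int])
  have f_nonneg: "f u \<ge> 0" for u unfolding f_def by (rule spec_dens_nonneg, rule h_nonneg)
  have f_even: "f (- u) = f u" for u by (simp add: f_def spec_dens_def h_even)
  have f_meas: "f \<in> borel_measurable borel" using f_int by auto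
  obtain Kh where "\<forall>u. \<bar>u\<bar> \<le> 1 \<longrightarrow> \<bar>h u - 1\<bar> \<le> Kh * u ^ 4" using h_expansion[OF h_diff h_C4 h_deriv0 h_0] by blast
  from spec_dens_expansion[OF s0 alpha(1) this] obtain K4
    where f4: "\<And>u. \<bar>u\<bar> \<le> 1/2 \<Longrightarrow> \<bar>f u - f0 - f2 * u\<^sup>2\<bar> \<le> K4 * u ^ 4"
    unfolding f_def f0_def f2_def by blast
  \<comment> \<open>A quadratic bound is enough for the limits of the symbols; the quartic term is
    absorbed since |u| \<le> 1. The finer \<open>f4\<close> is kept for the bias.\<close>
  have f_near: "\<bar>f u - f0\<bar> \<le> (\<bar>f2\<bar> + \<bar>K4\<bar>) * u\<^sup>2" if u: "\<bar>u\<bar> \<le> 1/2" for u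
  proof -
    have "\<bar>u\<bar> ^ 2 \<le> 1 ^ 2" using u by (intro power_mono) auto
    then have "u\<^sup>2 * u\<^sup>2 \<le> u\<^sup>2 * 1" by (intro mult_left_mono) auto
    then have "u ^ 4 \<le> u\<^sup>2" by (simp add: power2_eq_square power4_eq_xxxx mult.assoc)
    then have "K4 * u ^ 4 \<le> \<bar>K4\<bar> * u\<^sup>2" by (intro mult_mono) auto
    moreover have "\<bar>f2 * u\<^sup>2\<bar> = \<bar>f2\<bar> * u\<^sup>2" by (simp add: abs_mult)
    ultimately show ?thesis using f4[OF u] by (simp add: distrib_right)
  qed
  have a_lim: "filterlim a at_top sequentially"
    unfolding filterlim_at_top eventually_sequentially
  proof
    fix Z
    obtain n where "a n > Z" using a_unb by (auto simp: bdd_above_def not_le)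
    then show "\<exists>n. \<forall>k\<ge>n. Z \<le> a k" using strict_mono_mono[OF a_mono] by (meson monoD less_imp_le order_trans)
  qed
  have low: "fourier_tr \<psi> \<xi> = 0" if "\<bar>\<xi>\<bar> < B" for \<xi>
  proof (rule ccontr)
    assume "fourier_tr \<psi> \<xi> \<noteq> 0"
    then have "\<xi> \<in> closure {\<xi>. fourier_tr \<psi> \<xi> \<noteq> 0}" by (intro subsetD[OF closure_subset]) simp
    then have "B \<le> \<bar>\<xi>\<bar>" using subsetD[OF cond_i(3)] by blast
    then show False using that by simp
  qed
  interpret WP: wavelet_process M X \<psi> A f f0 "\<bar>f2\<bar> + \<bar>K4\<bar>" a \<gamma> c b B
  proof unfold_locales
    show "(\<lambda>(t, \<omega>). X t \<omega>) \<in> borel_measurable (lborel \<Otimes>\<^sub>M M)" by (rule X_meas)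
    show "complex_of_real (expectation (\<lambda>\<omega>. X t \<omega> * X s \<omega>)) = (LINT u|lborel. cis (u * (t - s)) * complex_of_real (f u))" for t s
      unfolding f_def by (rule X_cov)
  qed (use X_gauss X_mean X_msc f_int f_nonneg f_even f_meas f_near psi_L1 A_pos psi_supp a_pos a_lim cond_ii_gamma cond_ii_c cond_ii_b cond_i(1,2) low in auto)
  define m0 where "m0 = (LINT \<eta>|lborel. WP.\<Psi> \<eta>)"
  define m2 where "m2 = (LINT \<eta>|lborel. \<eta>\<^sup>2 * WP.\<Psi> \<eta>)"
  obtain p Bq i0 where p: "p \<ge> 0" "Bq > 0" "(2 * of_int p + 1) * pi * c > A"
    and a_large: "\<forall>i\<ge>i0. a i \<ge> 2 * A"
    and q_supp: "\<forall>i\<ge>i0. \<forall>x. WP.q i x \<noteq> 0 \<longrightarrow> \<bar>x\<bar> < (2 * of_int p + 1) * pi"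
    and q_le: "\<forall>i\<ge>i0. \<forall>x. WP.q i x \<le> Bq"
    and qper_le: "\<forall>i\<ge>i0. \<forall>x. WP.qper p i x \<le> Bq"
    and unif: "uniform_limit {-pi..pi} (WP.qper p) (WP.glim p) sequentially"
    by (rule WP.level_facts)
  have ai: "a i \<ge> 2 * A" if "i \<ge> i0" for i using a_large that by blast
  have supp: "\<bar>x\<bar> < (2 * of_int p + 1) * pi" if "i \<ge> i0" "WP.q i x \<noteq> 0" for i x using q_supp that by blast
  have qB: "WP.q i x \<le> Bq" if "i \<ge> i0" for i x using q_le that by blast
  have qpB: "WP.qper p i x \<le> Bq" if "i \<ge> i0" for i x using qper_le that by blast
  \<comment> \<open>The limit of the averaged squared covariances of a single level.\<close>
  define W where "W = 2 * pi * (LINT x|circ. (WP.glim p x)\<^sup>2)"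
  define C where "C = 2 * pi * Bq"
  have C: "C > 0" using p by (simp add: C_def)

  \<comment> \<open>Sample size and normalisation\<close>
  define D where "D j = a (j+1) powr (-2) - a (j+2) powr (-2)" for j
  define x where "x j = real (m j) / (D j)\<^sup>2" for j
  define N where "N j = nat \<lfloor>x j\<rfloor>" for j
  \<comment> \<open>The factor in front of the difference of the two sums of squares. Its square
    times \<open>N j\<close> equals x j / N j, so only the rounding of \<open>x j\<close> separates
    it from 1.\<close>
  define \<rho> where "\<rho> j = sqrt (real (m j)) / (D j * real (N j))" for j
  have m1: "real (m j) \<ge> 1" for j using m_pos[of j] by linarith
  have pw: "a i powr (-2) = 1 / (a i)\<^sup>2" for i using a_pos[of i] by (simp add: powr_minus_divide)
  have Dpos: "D j > 0" for j
  proof -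
    have "a (j+1) < a (j+2)" using a_mono by (simp add: strict_mono_def)
    then have "a (j+2) powr (-2) < a (j+1) powr (-2)" using a_pos by (intro powr_less_mono2_neg) auto
    then show ?thesis by (simp add: D_def)
  qed
  have J1: "filterlim (\<lambda>j::nat. j + 1) at_top sequentially" and J2: "filterlim (\<lambda>j::nat. j + 2) at_top sequentially"
    by (rule filterlim_at_top_mono[OF filterlim_ident]; simp)+
  have a1_lim: "filterlim (\<lambda>j. a (j+1)) at_top sequentially" and a2_lim: "filterlim (\<lambda>j. a (j+2)) at_top sequentially"
    by (rule filterlim_compose[OF a_lim J1], rule filterlim_compose[OF a_lim J2])
  \<comment> \<open>The difference \<open>D j\<close> is at most a (j+1)^(-2) and \<open>m j\<close>
    at least 1, so \<open>x j\<close> is at least a (j+1)^4, hence at least a (j+1) once this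
    exceeds 1.\<close>
  have x_lim: "filterlim x at_top sequentially"
  proof (rule filterlim_at_top_mono[OF a1_lim])
    have "\<forall>\<^sub>F j in sequentially. a (j+1) \<ge> 1" using a1_lim unfolding filterlim_at_top by blast
    then show "\<forall>\<^sub>F j in sequentially. a (j+1) \<le> x j"
    proof eventually_elim
      case (elim j)
      have "D j \<le> 1 / (a (j+1))\<^sup>2" using a_pos[of "j+2"] by (simp add: D_def pw)
      then have "(D j)\<^sup>2 \<le> (1 / (a (j+1))\<^sup>2)\<^sup>2" using Dpos[of j] by (intro power_mono) auto
      also have "\<dots> = 1 / (a (j+1)) ^ 4" by (simp add: power_divide power_mult[symmetric])
      finally have d: "(D j)\<^sup>2 \<le> 1 / (a (j+1)) ^ 4" .
      have "a (j+1) = a (j+1) ^ 1" by simp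
      also have "\<dots> \<le> (a (j+1)) ^ 4" using elim by (intro power_increasing) auto
      also have "\<dots> = 1 / (1 / (a (j+1)) ^ 4)" by simp
      also have "\<dots> \<le> real (m j) / (D j)\<^sup>2" using d m1[of j] Dpos[of j] by (intro frac_le) auto
      finally show ?case by (simp add: x_def)
    qed
  qed
  have N_lim: "filterlim N at_top sequentially"
    unfolding filterlim_at_top
  proof
    fix Z :: nat
    have "\<forall>\<^sub>F j in sequentially. real Z \<le> x j" using x_lim unfolding filterlim_at_top by blast
    then show "\<forall>\<^sub>F j in sequentially. Z \<le> N j" by eventually_elim (simp add: N_def le_nat_floor)
  qed
  have Nr_lim: "filterlim (\<lambda>j. real (N j)) at_top sequentially"
    by (rule filterlim_compose[OF filterlim_real_sequentially N_lim])
  have N1: "\<forall>\<^sub>F j in sequentially. N j > 0"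
  proof -
    have "\<forall>\<^sub>F j in sequentially. 1 \<le> N j" using N_lim unfolding filterlim_at_top by blast
    then show ?thesis by eventually_elim simp
  qed
  have r2: "(\<rho> j)\<^sup>2 * real (N j) = x j / real (N j)" for j
    by (simp add: \<rho>_def x_def power_divide power_mult_distrib power2_eq_square)
  have inv_N: "(\<lambda>j. 1 / real (N j)) \<longlonglongrightarrow> 0" by (rule real_tendsto_divide_at_top[OF tendsto_const Nr_lim])
  have r2_lim: "(\<lambda>j. (\<rho> j)\<^sup>2 * real (N j)) \<longlonglongrightarrow> 1"
  proof (rule tendsto_sandwich[where f="\<lambda>_. 1" and h="\<lambda>j. 1 + 1 / real (N j)"])
    show "(\<lambda>j. 1 + 1 / real (N j)) \<longlonglongrightarrow> 1" using tendsto_add[OF tendsto_const[of 1] inv_N] by simp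
    have bnd: "real (N j) \<le> x j \<and> x j \<le> real (N j) + 1" for j
    proof -
      have "x j \<ge> 0" by (simp add: x_def)
      then have "real (N j) = of_int \<lfloor>x j\<rfloor>" by (simp add: N_def)
      then show ?thesis by linarith
    qed
    show "\<forall>\<^sub>F j in sequentially. 1 \<le> (\<rho> j)\<^sup>2 * real (N j)"
      using N1 by eventually_elim (use bnd in \<open>simp add: r2 pos_le_divide_eq\<close>)
    show "\<forall>\<^sub>F j in sequentially. (\<rho> j)\<^sup>2 * real (N j) \<le> 1 + 1 / real (N j)"
      using N1
    proof eventually_elim
      case (elim j)
      have "x j / real (N j) \<le> (real (N j) + 1) / real (N j)" using bnd by (intro divide_right_mono) auto
      also have "\<dots> = 1 + 1 / real (N j)" using elim by (simp add: add_divide_distrib)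
      finally show ?case by (simp add: r2)
    qed
  qed auto
  have r_lim: "\<rho> \<longlonglongrightarrow> 0"
  proof -
    have "(\<lambda>j. ((\<rho> j)\<^sup>2 * real (N j)) * (1 / real (N j))) \<longlonglongrightarrow> 1 * 0" by (rule tendsto_mult[OF r2_lim inv_N])
    moreover have "\<forall>\<^sub>F j in sequentially. ((\<rho> j)\<^sup>2 * real (N j)) * (1 / real (N j)) = (\<rho> j)\<^sup>2"
      using N1 by eventually_elim simp
    ultimately have "(\<lambda>j. (\<rho> j)\<^sup>2) \<longlonglongrightarrow> 0" using Lim_transform_eventually by fastforce
    from tendsto_real_sqrt[OF this] have "(\<lambda>j. \<bar>\<rho> j\<bar>) \<longlonglongrightarrow> 0" by simp
    then show ?thesis by (rule tendsto_rabs_zero_cancel)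
  qed

  \<comment> \<open>The deterministic bias\<close>
  define K where "K = \<bar>K4\<bar> * (LINT \<eta>|lborel. \<eta> ^ 4 * WP.\<Psi> \<eta>)"
  have m4: "(LINT \<eta>|lborel. \<eta> ^ 4 * WP.\<Psi> \<eta>) \<ge> 0" using WP.Psi_nonneg by (intro integral_nonneg_AE) auto
  have K0: "K \<ge> 0" using m4 by (simp add: K_def)
  define e where "e i = WP.cov i 0 - f0 * m0 - f2 * m2 / (a i)\<^sup>2" for i
  have eb: "\<bar>e i\<bar> \<le> K / (a i) ^ 4" if i: "i \<ge> i0" for i
  proof -
    have "\<bar>e i\<bar> \<le> K4 * (LINT \<eta>|lborel. \<eta> ^ 4 * WP.\<Psi> \<eta>) / (a i) ^ 4"
      unfolding e_def m0_def m2_def by (rule WP.cov_zero_expansion[OF f4 ai[OF i]])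
    also have "\<dots> \<le> K / (a i) ^ 4" unfolding K_def using a_pos[of i] m4
      by (intro divide_right_mono mult_right_mono) auto
    finally show ?thesis .
  qed
  have cov_lim: "(\<lambda>i. WP.cov i 0) \<longlonglongrightarrow> f0 * m0"
  proof -
    have ia: "(\<lambda>i. 1 / a i) \<longlonglongrightarrow> 0" by (rule real_tendsto_divide_at_top[OF tendsto_const a_lim])
    have "(\<lambda>i. K * (1 / a i) ^ 4) \<longlonglongrightarrow> K * 0 ^ 4" by (intro tendsto_intros ia)
    then have kl: "(\<lambda>i. K * (1 / a i) ^ 4) \<longlonglongrightarrow> 0" by simp
    have "e \<longlonglongrightarrow> 0"
    proof (rule Lim_null_comparison[OF _ kl])
      have "\<forall>\<^sub>F i in sequentially. i \<ge> i0" by (rule eventually_ge_at_top)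
      then show "\<forall>\<^sub>F i in sequentially. norm (e i) \<le> K * (1 / a i) ^ 4"
        by eventually_elim (use eb in \<open>simp add: power_divide\<close>)
    qed
    then have "(\<lambda>i. e i + f0 * m0 + f2 * m2 * (1 / a i)\<^sup>2) \<longlonglongrightarrow> 0 + f0 * m0 + f2 * m2 * 0\<^sup>2"
      by (intro tendsto_intros ia)
    then show ?thesis by (simp add: e_def power_divide)
  qed
  obtain j0 where j0: "\<And>j. j \<ge> j0 \<Longrightarrow> a (Suc j) / a j \<ge> A / B" using cond_ii_j0 by blast
  \<comment> \<open>Difference between the mean of the normalised increment and its target. The term
    f0 m0 is equal at both levels and cancels, f2 m2 is reproduced exactly, and only the errors
    \<open>e\<close> survive.\<close>
  define bias where "bias j = sqrt (real (m j)) * ((WP.cov (j+1) 0 - WP.cov (j+2) 0) / D j - f2 * m2)" for j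
  have bias_lim: "bias \<longlonglongrightarrow> 0"
  proof -
    \<comment> \<open>The ratio a (j+2) / a (j+1) \<ge> A / B gives D j \<ge> \<theta> / a (j+1)^2.
      Without such a lower bound, division by \<open>D j\<close> could undo the gain of the
      fourth-order expansion.\<close>
    define \<theta> where "\<theta> = 1 - (B / A)\<^sup>2"
    have "(B / A)\<^sup>2 < 1" using cond_i(1,2) by (simp add: power_less_one_iff)
    then have th: "\<theta> > 0" by (simp add: \<theta>_def)
    have "(\<lambda>j. sqrt (real (m j) * a j powr (-4))) \<longlonglongrightarrow> sqrt 0" by (intro tendsto_real_sqrt cond_iii)
    then have "(\<lambda>j. 2 * K / \<theta> * sqrt (real (m j) * a j powr (-4))) \<longlonglongrightarrow> 2 * K / \<theta> * sqrt 0" by (intro tendsto_mult tendsto_const)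
    then have lim: "(\<lambda>j. 2 * K / \<theta> * sqrt (real (m j) * a j powr (-4))) \<longlonglongrightarrow> 0" by simp
    show ?thesis
    proof (rule Lim_null_comparison[OF _ lim])
      have "\<forall>\<^sub>F j in sequentially. j \<ge> max i0 j0" by (rule eventually_ge_at_top)
      then show "\<forall>\<^sub>F j in sequentially. norm (bias j) \<le> 2 * K / \<theta> * sqrt (real (m j) * a j powr (-4))"
      proof eventually_elim
        case (elim j)
        have ap: "a j > 0" "a (j+1) > 0" "a (j+2) > 0" by (rule a_pos)+
        have mono: "a j \<le> a (j+1)" "a (j+1) \<le> a (j+2)" using strict_mono_mono[OF a_mono] by (auto intro: monoD)
        have "a (j+2) / a (j+1) \<ge> A / B" using j0[of "j+1"] elim by simp
        then have "A * a (j+1) \<le> B * a (j+2)" using cond_i(1) ap by (simp add: field_simps)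
        then have "a (j+1) / a (j+2) \<le> B / A" using A_pos ap by (simp add: field_simps)
        then have "(a (j+1) / a (j+2))\<^sup>2 \<le> (B / A)\<^sup>2" using ap by (intro power_mono) auto
        then have "\<theta> / (a (j+1))\<^sup>2 \<le> (1 - (a (j+1) / a (j+2))\<^sup>2) / (a (j+1))\<^sup>2" by (intro divide_right_mono) (auto simp: \<theta>_def)
        also have "\<dots> = D j" using ap by (simp add: D_def pw diff_divide_distrib power_divide)
        finally have Dth: "\<theta> / (a (j+1))\<^sup>2 \<le> D j" .
        have "WP.cov (j+1) 0 - WP.cov (j+2) 0 = f2 * m2 * D j + (e (j+1) - e (j+2))"
          by (simp add: e_def D_def pw right_diff_distrib)
        then have bj: "bias j = sqrt (real (m j)) * ((e (j+1) - e (j+2)) / D j)"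
          using Dpos[of j] by (simp add: bias_def add_divide_distrib)
        have "K / (a (j+2)) ^ 4 \<le> K / (a (j+1)) ^ 4" using mono ap K0 by (intro divide_left_mono power_mono mult_pos_pos) auto
        then have "\<bar>e (j+1) - e (j+2)\<bar> \<le> 2 * K / (a (j+1)) ^ 4"
          using eb[of "j+1"] eb[of "j+2"] elim by simp
        then have "\<bar>e (j+1) - e (j+2)\<bar> / D j \<le> (2 * K / (a (j+1)) ^ 4) / (\<theta> / (a (j+1))\<^sup>2)"
          using Dth th ap K0 by (intro frac_le) auto
        also have "\<dots> = 2 * K / \<theta> * (1 / (a (j+1))\<^sup>2)" using ap th by (simp add: field_simps power2_eq_square power4_eq_xxxx)
        \<comment> \<open>Passage from index j+1 to j, because \<open>cond_iii\<close> compares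
          \<open>m j\<close> with \<open>a j\<close>.\<close>
        also have "\<dots> \<le> 2 * K / \<theta> * (1 / (a j)\<^sup>2)"
          using ap mono th K0 by (intro mult_left_mono divide_left_mono power_mono mult_pos_pos) auto
        finally have ebd: "\<bar>e (j+1) - e (j+2)\<bar> / D j \<le> 2 * K / \<theta> * (1 / (a j)\<^sup>2)" .
        have "a j powr (-4) = (1 / (a j)\<^sup>2)\<^sup>2" using ap by (simp add: powr_minus_divide power_divide power_mult[symmetric])
        then have sq: "sqrt (real (m j) * a j powr (-4)) = sqrt (real (m j)) * (1 / (a j)\<^sup>2)" by (simp add: real_sqrt_mult)
        have "norm (bias j) = sqrt (real (m j)) * (\<bar>e (j+1) - e (j+2)\<bar> / D j)" using Dpos[of j] by (simp add: bj abs_mult)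
        also have "\<dots> \<le> sqrt (real (m j)) * (2 * K / \<theta> * (1 / (a j)\<^sup>2))" by (intro mult_left_mono ebd) simp
        finally show ?case unfolding sq by (simp only: ac_simps)
      qed
    qed
  qed

  \<comment> \<open>The limiting variance\<close>
  define Q where "Q i n = (\<Sum>k\<in>{1..n}. \<Sum>l\<in>{1..n}. (WP.cov i (int k - int l))\<^sup>2)" for i n :: nat
  have Q_lim: "(\<lambda>j. Q (J j) (N j) / real (N j)) \<longlonglongrightarrow> W" if "filterlim J at_top sequentially" for J
    unfolding Q_def W_def
    by (rule WP.cov_square_mean_limit[where ?i0.0=i0, OF p(1,2) _ _ _ unif that N_lim]) (use supp qB qpB in auto)
  note Q1 = Q_lim[OF J1] and Q2 = Q_lim[OF J2]
  define v where "v j = 2 * (\<rho> j)\<^sup>2 * (Q (j+1) (N j) + Q (j+2) (N j))" for j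
  have v_lim: "v \<longlonglongrightarrow> 4 * W"
  \<comment> \<open>The factor 2 belongs to squares of Gaussian variables, and each of the two
    levels contributes \<open>W\<close>; together they give 4 W.\<close>
  proof -
    have "(\<lambda>j. 2 * ((\<rho> j)\<^sup>2 * real (N j)) * (Q (j+1) (N j) / real (N j) + Q (j+2) (N j) / real (N j))) \<longlonglongrightarrow> 2 * 1 * (W + W)"
      by (intro tendsto_intros r2_lim Q1 Q2)
    moreover have "\<forall>\<^sub>F j in sequentially. 2 * ((\<rho> j)\<^sup>2 * real (N j)) * (Q (j+1) (N j) / real (N j) + Q (j+2) (N j) / real (N j)) = v j"
      using N1 by eventually_elim (simp add: v_def add_divide_distrib[symmetric])
    ultimately show ?thesis using Lim_transform_eventually by fastforce
  qed

  \<comment> \<open>Convergence of the characteristic functions\<close>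
  define T where "T j \<omega> = \<rho> j * ((\<Sum>k\<in>{1..N j}. (wcoef \<psi> X a b (j+1) (int k) \<omega>)\<^sup>2 - WP.cov (j+1) 0) - (\<Sum>k\<in>{1..N j}. (wcoef \<psi> X a b (j+2) (int k) \<omega>)\<^sup>2 - WP.cov (j+2) 0))" for j \<omega>
  define Z where "Z j \<omega> = sqrt (real (m j)) * ((wmean2 \<psi> X a b (j+1) (N j) \<omega> - wmean2 \<psi> X a b (j+2) (N j) \<omega>) / D j - f2 * m2)" for j \<omega>
  have Z_meas [measurable]: "Z j \<in> borel_measurable M" for j
    unfolding Z_def[abs_def] wmean2_def by measurable
  \<comment> \<open>Centring each square by its variance splits \<open>Z\<close> into the quadratic
    form and a deterministic shift. The finitely many j with \<open>N j = 0\<close> are irrelevant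
    for the limit.\<close>
  have ZT: "Z j \<omega> = T j \<omega> + bias j" if Nj: "N j > 0" for j \<omega>
  proof -
    define s where "s i = (\<Sum>k\<in>{1..N j}. (wcoef \<psi> X a b i (int k) \<omega>)\<^sup>2)" for i
    have "T j \<omega> = \<rho> j * ((s (j+1) - real (N j) * WP.cov (j+1) 0) - (s (j+2) - real (N j) * WP.cov (j+2) 0))"
      by (simp add: T_def s_def sum_subtractf)
    also have "\<dots> = sqrt (real (m j)) * ((s (j+1) - s (j+2)) / real (N j) / D j - (WP.cov (j+1) 0 - WP.cov (j+2) 0) / D j)"
      using Nj Dpos[of j] by (simp add: \<rho>_def field_simps)
    finally have "T j \<omega> + bias j = sqrt (real (m j)) * ((s (j+1) - s (j+2)) / real (N j) / D j - f2 * m2)"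
      by (simp add: bias_def algebra_simps)
    then show ?thesis by (simp add: Z_def wmean2_def s_def diff_divide_distrib)
  qed
  have cf_lim: "(\<lambda>j. LINT \<omega>|M. cis (t * Z j \<omega>)) \<longlonglongrightarrow> of_real (exp (- (4 * W) * t\<^sup>2 / 2))" for t
  proof -
    define err where "err j = 4 * \<bar>\<rho> j\<bar>^3 * C\<^sup>2 * (real (N j) * (WP.cov (j+1) 0 + WP.cov (j+2) 0)) * \<bar>t\<bar>^3 * exp (\<bar>v j\<bar> * t\<^sup>2)" for j
    have err_lim: "err \<longlonglongrightarrow> 0"
    proof -
      have c1: "(\<lambda>j. WP.cov (j+1) 0) \<longlonglongrightarrow> f0 * m0" "(\<lambda>j. WP.cov (j+2) 0) \<longlonglongrightarrow> f0 * m0"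
        by (rule filterlim_compose[OF cov_lim J1], rule filterlim_compose[OF cov_lim J2])
      \<comment> \<open>The product of |\<rho>|^3 and N is grouped as (\<rho>^2 N) |\<rho>|, with
        limits 1 and 0; all other factors converge.\<close>
      have "(\<lambda>j. 4 * (((\<rho> j)\<^sup>2 * real (N j)) * \<bar>\<rho> j\<bar>) * C\<^sup>2 * (WP.cov (j+1) 0 + WP.cov (j+2) 0) * \<bar>t\<bar>^3 * exp (\<bar>v j\<bar> * t\<^sup>2))
        \<longlonglongrightarrow> 4 * (1 * \<bar>0\<bar>) * C\<^sup>2 * (f0 * m0 + f0 * m0) * \<bar>t\<bar>^3 * exp (\<bar>4 * W\<bar> * t\<^sup>2)"
        by (intro tendsto_intros r2_lim r_lim c1 v_lim)
      moreover have "4 * (((\<rho> j)\<^sup>2 * real (N j)) * \<bar>\<rho> j\<bar>) * C\<^sup>2 * (WP.cov (j+1) 0 + WP.cov (j+2) 0) * \<bar>t\<bar>^3 * exp (\<bar>v j\<bar> * t\<^sup>2) = err j" for j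
      proof -
        have "\<bar>\<rho> j\<bar>^3 = (\<rho> j)\<^sup>2 * \<bar>\<rho> j\<bar>" by (simp add: power3_eq_cube power2_eq_square)
        then show ?thesis unfolding err_def by (simp only: ac_simps)
      qed
      ultimately show ?thesis by simp
    qed
    have "(\<lambda>j. (LINT \<omega>|M. cis (t * T j \<omega>)) - of_real (exp (- v j * t\<^sup>2 / 2))) \<longlonglongrightarrow> 0"
    proof (rule Lim_null_comparison[OF _ err_lim])
      have "\<forall>\<^sub>F j in sequentially. j \<ge> max i0 j0" by (rule eventually_ge_at_top)
      then show "\<forall>\<^sub>F j in sequentially. norm ((LINT \<omega>|M. cis (t * T j \<omega>)) - of_real (exp (- v j * t\<^sup>2 / 2))) \<le> err j"
      proof eventually_elim
        case (elim j)
        have ratio: "a (j+2) / a (j+1) \<ge> A / B" using j0[of "j+1"] elim by simp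
        have form: "(\<Sum>k\<in>{1..N j}. \<Sum>l\<in>{1..N j}. y k * y l * WP.cov i (int k - int l)) \<le> C * (\<Sum>k\<in>{1..N j}. (y k)\<^sup>2)" if "i \<ge> i0" for i y
          unfolding C_def by (rule WP.cov_form_bound[where ?i0.0=i0, OF p(1,2) _ _ _ that]) (use supp qB qpB in auto)
        show ?case unfolding T_def v_def Q_def err_def
          by (rule WP.two_level_cf[OF ratio C form form]) (use elim in auto)
      qed
    qed
    moreover have "(\<lambda>j. complex_of_real (exp (- v j * t\<^sup>2 / 2))) \<longlonglongrightarrow> of_real (exp (- (4 * W) * t\<^sup>2 / 2))"
      by (intro tendsto_intros v_lim) auto
    ultimately have "(\<lambda>j. ((LINT \<omega>|M. cis (t * T j \<omega>)) - of_real (exp (- v j * t\<^sup>2 / 2))) + of_real (exp (- v j * t\<^sup>2 / 2))) \<longlonglongrightarrow> 0 + of_real (exp (- (4 * W) * t\<^sup>2 / 2))"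
      by (rule tendsto_add)
    then have "(\<lambda>j. LINT \<omega>|M. cis (t * T j \<omega>)) \<longlonglongrightarrow> of_real (exp (- (4 * W) * t\<^sup>2 / 2))" by simp
    \<comment> \<open>The deterministic shift multiplies the characteristic function by a phase that
      tends to 1.\<close>
    moreover have "(\<lambda>j. cis (t * bias j)) \<longlonglongrightarrow> cis (t * 0)"
      by (intro isCont_tendsto_compose[OF isCont_cis_real] tendsto_intros bias_lim)
    ultimately have "(\<lambda>j. cis (t * bias j) * (LINT \<omega>|M. cis (t * T j \<omega>))) \<longlonglongrightarrow> cis (t * 0) * of_real (exp (- (4 * W) * t\<^sup>2 / 2))"
      by (intro tendsto_mult)
    moreover have "\<forall>\<^sub>F j in sequentially. cis (t * bias j) * (LINT \<omega>|M. cis (t * T j \<omega>)) = (LINT \<omega>|M. cis (t * Z j \<omega>))"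
      using N1
    proof eventually_elim
      case (elim j)
      have "cis (t * Z j \<omega>) = cis (t * bias j) * cis (t * T j \<omega>)" for \<omega>
        unfolding ZT[OF elim] cis_mult by (simp add: algebra_simps)
      then show ?case by simp
    qed
    ultimately show ?thesis using Lim_transform_eventually by fastforce
  qed
  define V where "V = 2 * (4 * c * pi * s0 powr (-8 * \<alpha>) * (LINT \<eta>:{-c*pi..c*pi}|lborel.
                 (\<bar>\<Sum>\<^sub>\<infinity>n::int. (cmod (fourier_tr \<psi> (\<eta> + 2 * real_of_int n * c * pi)))\<^sup>2\<bar>)\<^sup>2))"
  \<comment> \<open>Constants: \<open>glim_integral\<close> gives W = 2 pi c f0^2 times the
    integral, and f0^2 = s0^(-8 \<alpha>). Four times this is twice 4 c pi s0^(-8 \<alpha>) times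
    the integral.\<close>
  have V: "V = 4 * W"
  proof -
    have "f0\<^sup>2 = s0 powr (-8 * \<alpha>)" using s0 by (simp add: f0_def power2_eq_square flip: powr_add)
    then show ?thesis unfolding W_def WP.glim_integral[OF p(1,3)] WP.\<Psi>_def V_def by simp
  qed
  have W0: "W \<ge> 0" unfolding W_def by (intro mult_nonneg_nonneg integral_nonneg_AE) auto
  have "weak_conv_m (\<lambda>j. distr M borel (Z j)) (gaussian_law 0 V)"
  proof (rule levy_continuity)
    show "real_distribution (distr M borel (Z n))" for n
      by (rule real_distribution_distr) simp
    show "real_distribution (gaussian_law 0 V)" using gaussian_law_char(1)[of V] V W0 by simp
    fix t
    have "char (distr M borel (Z n)) t = (LINT \<omega>|M. cis (t * Z n \<omega>))" for n
      unfolding char_def by (subst integral_distr) (auto simp: cis_conv_exp)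
    moreover have "char (gaussian_law 0 V) t = of_real (exp (- (4 * W) * t\<^sup>2 / 2))"
      using gaussian_law_char(2)[of V t] V W0 by simp
    ultimately show "(\<lambda>n. char (distr M borel (Z n)) t) \<longlonglongrightarrow> char (gaussian_law 0 V) t" using cf_lim[of t] by simp
  qed
  then show ?thesis
    unfolding Let_def Z_def[abs_def] V_def N_def x_def D_def f2_def m2_def WP.\<Psi>_def .
qed

end
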